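(* Let $n\ge 1$ and let $\Omega\subset\mathbb{R}^n$ be an open set that is bounded in one direction. Suppose that either (a) $2\le p<\infty$ and $0\le s\le t<\infty$, or (b) $1<p<2$, $1\le t<\infty$ and $0\le s\le t$. Then there exists a constant $C=C(n,p,s,t,\Omega)>0$ such that $$\|(-\Delta)^{s/2}u\|_{L^p(\mathbb{R}^n)}\le C\,\|(-\Delta)^{t/2}u\|_{L^p(\mathbb{R}^n)}$$ for all $u\in\widetilde{H}^{t,p}(\Omega)$.
   Context: A cylindrical domain is an open set $\Omega_\infty=\mathbb{R}^{n-k}\times\omega\subset\mathbb{R}^n$ with $n\ge k>0$ and $\omega\subset\mathbb{R}^k$ a bounded open set. An open set $\Omega\subset\mathbb{R}^n$ is bounded in one direction if there exist a cylindrical domain $\Omega_\infty$ and a rigid Euclidean motion $A(x)=Lx+x_0$ ($L$ a linear isometry, $x_0\in\mathbb{R}^n$) such that $\Omega\subset A\Omega_\infty$. For $s\in\mathbb{R}$, $1\le p\le\infty$, the Bessel potential space is $H^{s,p}(\mathbb{R}^n)=\{u\in\mathscr{S}'(\mathbb{R}^n): \mathcal{F}^{-1}((1+|\xi|^2)^{s/2}\hat u)\in L^p(\mathbb{R}^n)\}$ with norm $\|u\|_{H^{s,p}(\mathbb{R}^n)}=\|\mathcal{F}^{-1}((1+|\xi|^2)^{s/2}\hat u)\|_{L^p(\mathbb{R}^n)}$, and $\widetilde{H}^{s,p}(\Omega)$ is the closure of $C_c^\infty(\Omega)$ in $H^{s,p}(\mathbb{R}^n)$. The fractional Laplacian is the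 Fourier multiplier $(-\Delta)^{s/2}u=\mathcal{F}^{-1}(|\xi|^s\hat u)$, which for $s\ge0$ is bounded $H^{t,p}(\mathbb{R}^n)\to H^{t-s,p}(\mathbb{R}^n)$ for $1<p<\infty$, $t\in\mathbb{R}$. *)

theory Defs
  imports "HOL-Analysis.Analysis"
begin

subsection \<open>Sets bounded in one direction\<close>

definition coord_subspace :: "'n set \<Rightarrow> (real ^ 'n) set" where
  "coord_subspace K = {x. \<forall>i. i \<notin> K \<longrightarrow> x $ i = 0}"

text \<open>
  The index type carries no order, so the factor \<open>\<real>\<^sup>k\<close> is the span of any \<open>k = card K > 0\<close>
  coordinate axes rather than of the last \<open>k\<close> ones. Permuting coordinates is a rigid motion,
  so this choice does not affect which sets are bounded in one direction.
\<close>

definition cylindrical_domain :: "(real ^ 'n) set \<Rightarrow> bool" where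
  "cylindrical_domain S \<longleftrightarrow>
    (\<exists>K \<omega>. K \<noteq> {} \<and> openin (top_of_set (coord_subspace K)) \<omega> \<and> bounded \<omega> \<and>
           S = {y + z | y z. y \<in> coord_subspace (- K) \<and> z \<in> \<omega>})"

definition bounded_in_one_direction :: "(real ^ 'n) set \<Rightarrow> bool" where
  "bounded_in_one_direction \<Omega> \<longleftrightarrow>
    (\<exists>(S :: (real ^ 'n) set) L x0. cylindrical_domain S \<and> orthogonal_transformation L \<and>
       \<Omega> \<subseteq> (\<lambda>x. L x + x0) ` S)"

subsection \<open>Smooth functions, test functions, Schwartz functions\<close>

definition partial_deriv :: "'n \<Rightarrow> (real ^ 'n \<Rightarrow> complex) \<Rightarrow> real ^ 'n \<Rightarrow> complex" where
  "partial_deriv i f x = frechet_derivative f (at x) (axis i 1)"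

text \<open>A list of coordinate indices plays the role of a multi-index.\<close>

definition iter_partial_deriv :: "'n list \<Rightarrow> (real ^ 'n \<Rightarrow> complex) \<Rightarrow> real ^ 'n \<Rightarrow> complex" where
  "iter_partial_deriv is f = foldr partial_deriv is f"

text \<open>
  Differentiability is total (Frechet) differentiability; since it is required of every iterated
  partial derivative, all of these are continuous and \<open>smooth\<close> is \<open>C\<^sup>\<infinity>(\<real>\<^sup>n)\<close>.
\<close>

definition smooth :: "(real ^ 'n \<Rightarrow> complex) \<Rightarrow> bool" where
  "smooth f \<longleftrightarrow> (\<forall>is x. iter_partial_deriv is f differentiable (at x))"

definition test_functions :: "(real ^ 'n) set \<Rightarrow> (real ^ 'n \<Rightarrow> complex) set" where
  "test_functions \<Omega> =
    {f. smooth f \<and> compact (closure {x. f x \<noteq> 0}) \<and> closure {x. f x \<noteq> 0} \<subseteq> \<Omega>}"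

definition schwartz :: "(real ^ 'n \<Rightarrow> complex) set" where
  "schwartz = {f. smooth f \<and>
    (\<forall>m is. bdd_above (range (\<lambda>x. (1 + norm x) ^ m * norm (iter_partial_deriv is f x))))}"

definition schwartz_seminorm :: "nat \<Rightarrow> 'n list \<Rightarrow> (real ^ 'n \<Rightarrow> complex) \<Rightarrow> real" where
  "schwartz_seminorm m is f = (SUP x. (1 + norm x) ^ m * norm (iter_partial_deriv is f x))"

subsection \<open>Fourier transform\<close>

definition fourier :: "(real ^ 'n \<Rightarrow> complex) \<Rightarrow> real ^ 'n \<Rightarrow> complex" where
  "fourier f \<xi> = (LINT x|lborel. cis (- (x \<bullet> \<xi>)) * f x)"

definition inv_fourier :: "(real ^ 'n \<Rightarrow> complex) \<Rightarrow> real ^ 'n \<Rightarrow> complex" where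
  "inv_fourier f x = of_real (1 / (2 * pi) ^ CARD('n)) * (LINT \<xi>|lborel. cis (x \<bullet> \<xi>) * f \<xi>)"

subsection \<open>Tempered distributions\<close>

type_synonym 'n distr = "(real ^ 'n \<Rightarrow> complex) \<Rightarrow> complex"

text \<open>
  Distributions are functionals on all functions that vanish outside the Schwartz space, so that
  two of them are equal as soon as they agree on Schwartz functions.
\<close>

definition on_schwartz :: "('n::finite) distr \<Rightarrow> 'n distr" where
  "on_schwartz T = (\<lambda>\<phi>. if \<phi> \<in> schwartz then T \<phi> else 0)"

definition tempered :: "('n::finite) distr set" where
  "tempered = {T.
     on_schwartz T = T \<and>
     (\<forall>\<phi>\<in>schwartz. \<forall>\<psi>\<in>schwartz. T (\<lambda>x. \<phi> x + \<psi> x) = T \<phi> + T \<psi>) \<and>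
     (\<forall>c. \<forall>\<phi>\<in>schwartz. T (\<lambda>x. c * \<phi> x) = c * T \<phi>) \<and>
     (\<exists>C N. \<forall>\<phi>\<in>schwartz. norm (T \<phi>) \<le> C * (\<Sum>is | length is \<le> N. schwartz_seminorm N is \<phi>))}"

definition distr_of :: "(real ^ 'n \<Rightarrow> complex) \<Rightarrow> 'n distr" where
  "distr_of f = on_schwartz (\<lambda>\<phi>. LINT x|lborel. f x * \<phi> x)"

definition distr_diff :: "('n::finite) distr \<Rightarrow> 'n distr \<Rightarrow> 'n distr" where
  "distr_diff T U = (\<lambda>\<phi>. T \<phi> - U \<phi>)"

definition fourier_distr :: "('n::finite) distr \<Rightarrow> 'n distr" where
  "fourier_distr T = on_schwartz (\<lambda>\<phi>. T (fourier \<phi>))"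

definition inv_fourier_distr :: "('n::finite) distr \<Rightarrow> 'n distr" where
  "inv_fourier_distr T = on_schwartz (\<lambda>\<phi>. T (inv_fourier \<phi>))"

text \<open>Meaningful for smooth \<open>m\<close> all of whose derivatives grow at most polynomially.\<close>

definition mult_distr :: "(real ^ 'n \<Rightarrow> complex) \<Rightarrow> 'n distr \<Rightarrow> 'n distr" where
  "mult_distr m T = on_schwartz (\<lambda>\<phi>. T (\<lambda>x. m x * \<phi> x))"

subsection \<open>Lebesgue and Bessel potential spaces\<close>

definition Lp_space :: "real \<Rightarrow> (real ^ 'n \<Rightarrow> complex) set" where
  "Lp_space p = {f \<in> borel_measurable lborel. integrable lborel (\<lambda>x. norm (f x) powr p)}"

definition Lp_norm :: "real \<Rightarrow> (real ^ 'n \<Rightarrow> complex) \<Rightarrow> real" where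
  "Lp_norm p f = (LINT x|lborel. norm (f x) powr p) powr (1 / p)"

text \<open>
  The \<open>L\<^sup>p\<close> norm of a tempered distribution. All \<open>f \<in> L\<^sup>p\<close> representing \<open>T\<close> agree almost
  everywhere, so the infimum is over at most one value; it is \<open>\<infinity>\<close> if \<open>T\<close> is not in \<open>L\<^sup>p\<close>.
\<close>

definition distr_Lp_norm :: "real \<Rightarrow> ('n::finite) distr \<Rightarrow> ennreal" where
  "distr_Lp_norm p T = (INF f\<in>{f \<in> Lp_space p. T = distr_of f}. ennreal (Lp_norm p f))"

definition bessel_potential :: "real \<Rightarrow> ('n::finite) distr \<Rightarrow> 'n distr" where
  "bessel_potential s u =
    inv_fourier_distr (mult_distr (\<lambda>\<xi>. of_real ((1 + (norm \<xi>)\<^sup>2) powr (s / 2))) (fourier_distr u))"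

definition bessel_space :: "real \<Rightarrow> real \<Rightarrow> ('n::finite) distr set" where
  "bessel_space s p = {u \<in> tempered. \<exists>f \<in> Lp_space p. bessel_potential s u = distr_of f}"

definition bessel_norm :: "real \<Rightarrow> real \<Rightarrow> ('n::finite) distr \<Rightarrow> ennreal" where
  "bessel_norm s p u = distr_Lp_norm p (bessel_potential s u)"

definition bessel_space_tilde :: "real \<Rightarrow> real \<Rightarrow> (real ^ 'n) set \<Rightarrow> 'n distr set" where
  "bessel_space_tilde s p \<Omega> = {u \<in> bessel_space s p.
    \<exists>\<phi>. (\<forall>k::nat. \<phi> k \<in> test_functions \<Omega>) \<and>
        (\<lambda>k. bessel_norm s p (distr_diff (distr_of (\<phi> k)) u)) \<longlonglongrightarrow> 0}"

subsection \<open>The fractional Laplacian\<close>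

text \<open>
  \<open>(-\<Delta>)\<^bsup>s/2\<^esup>\<close> on Schwartz functions. For \<open>s = 0\<close> the convention \<open>0 powr 0 = 0\<close>
  changes the symbol only at the single point \<open>\<xi> = 0\<close>, hence not the integral.
\<close>

definition frac_laplacian_schwartz :: "real \<Rightarrow> (real ^ 'n \<Rightarrow> complex) \<Rightarrow> real ^ 'n \<Rightarrow> complex" where
  "frac_laplacian_schwartz s \<phi> = inv_fourier (\<lambda>\<xi>. of_real (norm \<xi> powr s) * fourier \<phi> \<xi>)"

text \<open>
  The symbol \<open>|\<xi>|\<^sup>s\<close> is not smooth at the origin, so \<open>|\<xi>|\<^sup>s\<close> times the Fourier transform of \<open>u\<close>
  is not an instance of \<open>mult_distr\<close>. As an operator on \<open>H\<^bsup>r,p\<^esup>\<close> (\<open>s \<ge> 0\<close>, \<open>1 < p < \<infinity>\<close>) the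
  multiplier is the unique bounded extension \<open>H\<^bsup>r,p\<^esup> \<rightarrow> H\<^bsup>r-s,p\<^esup>\<close> of its restriction to Schwartz
  functions, which are dense in \<open>H\<^bsup>r,p\<^esup>\<close>.
\<close>

definition frac_laplacian :: "real \<Rightarrow> real \<Rightarrow> real \<Rightarrow> ('n::finite) distr \<Rightarrow> 'n distr" where
  "frac_laplacian s r p u = (THE v. v \<in> bessel_space (r - s) p \<and>
    (\<exists>\<phi>. (\<forall>k::nat. \<phi> k \<in> schwartz) \<and>
         (\<lambda>k. bessel_norm r p (distr_diff (distr_of (\<phi> k)) u)) \<longlonglongrightarrow> 0 \<and>
         (\<lambda>k. bessel_norm (r - s) p
                (distr_diff (distr_of (frac_laplacian_schwartz s (\<phi> k))) v)) \<longlonglongrightarrow> 0))"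

end

theory Submission
  imports Defs "HOL-Probability.Probability"
begin

text \<open>Since \<open>\<Omega>\<close> lies in a slab, a limit argument reduces the claim to Schwartz functions \<open>\<phi>\<close> supported in
  \<open>{x. \<bar>x \<bullet> v - c\<bar> \<le> R}\<close>. Write \<open>b = (1 + |\<xi>|\<^sup>2)\<^sup>-\<^sup>1\<close>. The powers \<open>b\<^bsup>a\<^esup>\<close> (Gaussian mixtures, by the
  Gamma integral) and \<open>(1 - b)\<^bsup>a\<^esup>\<close> (1 plus an absolutely convergent binomial series in the \<open>b\<^bsup>m\<^esup>\<close>)
  are Fourier transforms of finite measures, so by Young's inequality they are multipliers of
  \<open>L\<^sup>p\<close> for every \<open>p \<ge> 1\<close>, and no Mikhlin theorem is needed.

  In particular \<open>1 - (1 - b)\<^bsup>t/2\<^esup>\<close> is the transform of an integrable kernel \<open>K\<close>. Rescale \<open>K\<close> by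
  \<open>\<epsilon>\<close>: then \<open>\<phi> - K\<^sub>\<epsilon> * \<phi>\<close> is bounded by \<open>(-\<Delta>)\<^bsup>t/2\<^esup>\<phi>\<close> in \<open>L\<^sup>p\<close>, while on the slab \<open>K\<^sub>\<epsilon> * \<phi>\<close> only sees the
  mass of \<open>K\<close> in \<open>{w. \<bar>w \<bullet> v\<bar> \<le> 2R\<epsilon>}\<close>, which tends to 0. Hence that term can be absorbed, and
  \<open>\<parallel>\<phi>\<parallel>\<^sub>p \<le> C \<parallel>(-\<Delta>)\<^bsup>t/2\<^esup>\<phi>\<parallel>\<^sub>p\<close>. Finally \<open>|\<xi>|\<^sup>s\<close> is dominated by \<open>(1 + |\<xi>|\<^sup>2)\<^bsup>t/2\<^esup>\<close>, and the latter by
  \<open>1\<close> and \<open>|\<xi>|\<^sup>t\<close>, in the sense of multipliers.\<close>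

subsection \<open>Schwartz functions\<close>

text \<open>The obstacle is the symbol |xi|^s, which is not smooth at the origin:
  \<open>frac_laplacian_schwartz s\<close> leaves the Schwartz space, so the multiplier calculus
  acts on inverse transforms of merely integrable functions. The same point troubles (1 - b)^a,
  because b reaches 1 there and the binomial series sits on the boundary of its disc. Absolute
  summability comes from coefficients of size O(n^(-a-1)) and from kernels of all powers of b having
  mass at most 1. Rescaling is affordable because (1 - b(xi/epsilon))^(t/2) is epsilon^(-t) |xi|^t
  times a multiplier, so a thin slab costs only a constant. Sizes are measured by the p-th power of
  the norm, valued in \<open>ennreal\<close>; a factor 2^p then replaces Minkowski's inequality. In
  the limit argument, the description operator in \<open>frac_laplacian\<close> is resolved along an
  arbitrary approximating sequence, so one sequence of test functions serves both orders
  \<open>s\<close> and \<open>t\<close>.\<close>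

lemma nn_integral_lborel_affine:
  fixes a :: "'a::euclidean_space"
  assumes [measurable]: "f \<in> borel_measurable borel" and "c \<noteq> 0"
  shows "(\<integral>\<^sup>+x. f x \<partial>lborel) = ennreal (\<bar>c\<bar> ^ DIM('a)) * (\<integral>\<^sup>+x. f (a + c *\<^sub>R x) \<partial>lborel)"
  by (subst lborel_affine[OF assms(2), of a])
    (simp add: nn_integral_density nn_integral_distr nn_integral_cmult)

lemma integrable_lborel_affine:
  fixes a :: "'a::euclidean_space" and f :: "'a \<Rightarrow> 'b::{banach, second_countable_topology}"
  assumes "integrable lborel f" and "c \<noteq> 0"
  shows "integrable lborel (\<lambda>x. f (a + c *\<^sub>R x))"
proof -
  have f: "f \<in> borel_measurable borel" using assms(1) by auto
  have "integrable (density (distr lborel borel (\<lambda>x. a + c *\<^sub>R x)) (\<lambda>_. \<bar>c\<bar> ^ DIM('a))) f"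
    using assms lborel_affine[OF assms(2), of a] by metis
  then have "integrable lborel (\<lambda>x. \<bar>c\<bar> ^ DIM('a) *\<^sub>R f (a + c *\<^sub>R x))"
    using f by (simp add: integrable_density integrable_distr_eq)
  then have "integrable lborel (\<lambda>x. inverse (\<bar>c\<bar> ^ DIM('a)) *\<^sub>R \<bar>c\<bar> ^ DIM('a) *\<^sub>R f (a + c *\<^sub>R x))"
    by (rule integrable_scaleR_right)
  then show ?thesis
    using assms(2) by simp
qed

lemma integral_lborel_affine:
  fixes a :: "'a::euclidean_space" and f :: "'a \<Rightarrow> 'b::{banach, second_countable_topology}"
  assumes [measurable]: "f \<in> borel_measurable borel" and "c \<noteq> 0"
  shows "(LINT x|lborel. f x) = (\<bar>c\<bar> ^ DIM('a)) *\<^sub>R (LINT x|lborel. f (a + c *\<^sub>R x))"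
  by (subst lborel_affine[OF assms(2), of a])
    (simp add: integral_density integral_distr)

lemma integral_lborel_translate:
  fixes a :: "'a::euclidean_space" and f :: "'a \<Rightarrow> 'b::{banach, second_countable_topology}"
  assumes [measurable]: "f \<in> borel_measurable borel"
  shows "(LINT x|lborel. f (a + x)) = (LINT x|lborel. f x)"
  using integral_lborel_affine[OF assms, of 1 a] by simp

lemma integral_lborel_reflect:
  fixes f :: "'a::euclidean_space \<Rightarrow> 'b::{banach, second_countable_topology}"
  assumes [measurable]: "f \<in> borel_measurable borel"
  shows "(LINT x|lborel. f (a - x)) = (LINT x|lborel. f x)"
  using integral_lborel_affine[OF assms, of "-1" a] by simp

lemma integrable_lborel_translate:
  fixes a :: "'a::euclidean_space" and f :: "'a \<Rightarrow> 'b::{banach, second_countable_topology}"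
  assumes "integrable lborel f"
  shows "integrable lborel (\<lambda>x. f (a + x))"
  using integrable_lborel_affine[OF assms, of 1 a] by simp

section \<open>An integrable weight and rapid decay\<close>

text \<open>Moves the product formula for \<open>lborel\<close>, which is indexed by
  \<open>Basis\<close>, to coordinates. It serves both the integrability of \<open>weight\<close>
  and the Gaussian integral.\<close>

lemma nn_integral_prod_vec:
  fixes f :: "real \<Rightarrow> real"
  assumes [measurable]: "f \<in> borel_measurable borel" and "\<And>x. 0 \<le> f x"
  shows "(\<integral>\<^sup>+x. ennreal (\<Prod>i\<in>UNIV. f (x $ i)) \<partial>(lborel :: (real ^ 'n) measure))
         = (\<integral>\<^sup>+x. f x \<partial>lborel) ^ CARD('n)"
proof -
  have inj: "inj (\<lambda>i::'n. axis i (1::real))"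
    by (auto simp: inj_on_def axis_eq_axis)
  have B: "(Basis :: (real ^ 'n) set) = (\<lambda>i. axis i 1) ` UNIV"
    by (auto simp: Basis_vec_def)
  have "(\<Prod>b\<in>(Basis :: (real ^ 'n) set). ennreal (f (x \<bullet> b))) = ennreal (\<Prod>i\<in>UNIV. f (x $ i))" for x
    unfolding B using assms(2) by (subst prod.reindex[OF inj]) (simp add: inner_axis prod_ennreal)
  moreover have "card (Basis :: (real ^ 'n) set) = CARD('n)" by simp
  ultimately show ?thesis
    using nn_integral_lborel_prod[where ?'a = "real ^ 'n" and f = "\<lambda>_ x. ennreal (f x)"] assms
    by (simp only: prod_constant) simp
qed

text \<open>The fixed integrable majorant with which rapidly decreasing functions are compared, in
  dominated convergence and in pairings with L^p functions.\<close>

definition weight :: "real ^ 'n \<Rightarrow> real" where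
  "weight x = inverse ((1 + norm x) ^ (2 * CARD('n)))"

lemma weight_pos: "0 < weight x"
  by (simp add: weight_def add_pos_nonneg)

lemma weight_nonneg[simp]: "0 \<le> weight x"
  by (rule less_imp_le[OF weight_pos])

lemma weight_le_1: "weight x \<le> 1"
  by (simp add: weight_def inverse_le_1_iff one_le_power)

lemma weight_measurable[measurable]: "weight \<in> borel_measurable borel"
  unfolding weight_def by measurable

text \<open>The exponent \<open>2 * CARD('n)\<close> is chosen so that \<open>weight x\<close> lies
  below the product over i of 1 / (1 + x_i^2), each factor of which is integrable on the
  line.\<close>

lemma integrable_weight: "integrable lborel (weight :: real ^ 'n \<Rightarrow> real)"
proof (rule integrableI_bounded)
  let ?g = "\<lambda>x::real. inverse (1 + x\<^sup>2)"
  have g: "integrable lborel ?g"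
    using integrable_inverse_1_plus_square
    by (simp add: set_integrable_def)
  have *: "ennreal (norm (weight x)) \<le> ennreal (\<Prod>i\<in>UNIV. ?g (x $ i))" for x :: "real ^ 'n"
  proof (rule ennreal_leI)
    have "(\<Prod>i\<in>UNIV. 1 + (x $ i)\<^sup>2) \<le> (\<Prod>i\<in>(UNIV::'n set). (1 + norm x)\<^sup>2)"
    proof (rule prod_mono, safe)
      fix i
      have "(x $ i)\<^sup>2 \<le> (norm x)\<^sup>2"
        using component_le_norm_cart[of x i] by (metis abs_le_square_iff abs_norm_cancel)
      then show "1 + (x $ i)\<^sup>2 \<le> (1 + norm x)\<^sup>2" by (simp add: power2_sum add_increasing2)
    qed auto
    also have "\<dots> = (1 + norm x) ^ (2 * CARD('n))" by (simp add: power_mult)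
    finally have "(\<Prod>i\<in>UNIV. 1 + (x $ i)\<^sup>2) \<le> (1 + norm x) ^ (2 * CARD('n))" .
    moreover have "0 < (\<Prod>i\<in>UNIV. 1 + (x $ i)\<^sup>2)"
      by (intro prod_pos ballI) (simp add: add_pos_nonneg)
    ultimately show "norm (weight x) \<le> (\<Prod>i\<in>UNIV. ?g (x $ i))"
      by (simp add: weight_def prod_inversef[unfolded o_def] le_imp_inverse_le)
  qed
  have "(\<integral>\<^sup>+x. norm (weight (x :: real ^ 'n)) \<partial>lborel) \<le> (\<integral>\<^sup>+x. ennreal (\<Prod>i\<in>UNIV. ?g (x $ i)) \<partial>(lborel :: (real ^ 'n) measure))"
    by (intro nn_integral_mono *)
  also have "\<dots> = (\<integral>\<^sup>+x. ?g x \<partial>lborel) ^ CARD('n)"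
    by (rule nn_integral_prod_vec) auto
  also have "\<dots> < \<infinity>"
    using g by (auto simp: integrable_iff_bounded power_less_top_ennreal)
  finally show "(\<integral>\<^sup>+x. norm (weight (x :: real ^ 'n)) \<partial>lborel) < \<infinity>" .
qed auto


lemma weight_mult_power: "weight (x :: real ^ 'n) * (1 + norm x) ^ (2 * CARD('n)) = 1"
proof -
  have "1 + norm x \<noteq> 0" using norm_ge_zero[of x] by linarith
  then show ?thesis unfolding weight_def by simp
qed

text \<open>The decay half of the Schwartz condition, kept apart from smoothness: |xi|^s times a
  Schwartz function is still \<open>rapid\<close>, although it need not be smooth at the
  origin.\<close>

definition rapid :: "(real ^ 'n \<Rightarrow> complex) \<Rightarrow> bool" where
  "rapid f \<longleftrightarrow> (\<forall>m. \<exists>B. \<forall>x. (1 + norm x) ^ m * norm (f x) \<le> B)"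

lemma rapid_add:
  assumes "rapid f" "rapid g"
  shows "rapid (\<lambda>x. f x + g x)"
  unfolding rapid_def
proof
  fix m
  obtain A B where A: "\<And>x. (1 + norm x) ^ m * norm (f x) \<le> A"
    and B: "\<And>x. (1 + norm x) ^ m * norm (g x) \<le> B"
    using assms unfolding rapid_def by meson
  have "(1 + norm x) ^ m * norm (f x + g x) \<le> A + B" for x
  proof -
    have "(1 + norm x) ^ m * norm (f x + g x) \<le> (1 + norm x) ^ m * (norm (f x) + norm (g x))"
      by (intro mult_left_mono norm_triangle_ineq) simp
    then show ?thesis using A[of x] B[of x] by (simp add: distrib_left)
  qed
  then show "\<exists>B. \<forall>x. (1 + norm x) ^ m * norm (f x + g x) \<le> B" by blast
qed

lemma rapid_mult_polynomial_growth:
  assumes "rapid f" and g: "\<And>x. norm (g x) \<le> C * (1 + norm x) ^ k"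
  shows "rapid (\<lambda>x. g x * f x)"
  unfolding rapid_def
proof
  fix m
  obtain B where B: "\<And>x. (1 + norm x) ^ (m + k) * norm (f x) \<le> B"
    using assms(1) unfolding rapid_def by meson
  have C: "0 \<le> C" using order_trans[OF norm_ge_zero g[of 0]] by simp
  have "(1 + norm x) ^ m * norm (g x * f x) \<le> C * B" for x
  proof -
    have "(1 + norm x) ^ m * norm (g x * f x) \<le> (1 + norm x) ^ m * (C * (1 + norm x) ^ k * norm (f x))"
      unfolding norm_mult by (intro mult_left_mono mult_right_mono g) auto
    also have "\<dots> = C * ((1 + norm x) ^ (m + k) * norm (f x))" by (simp add: power_add)
    also have "\<dots> \<le> C * B" by (intro mult_left_mono B C)
    finally show ?thesis .
  qed
  then show "\<exists>B. \<forall>x. (1 + norm x) ^ m * norm (g x * f x) \<le> B" by blast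
qed

lemma rapid_cmult: "rapid f \<Longrightarrow> rapid (\<lambda>x. c * f x)"
  by (rule rapid_mult_polynomial_growth[where C = "norm c" and k = 0]) auto

lemma rapid_coord: "rapid f \<Longrightarrow> rapid (\<lambda>x :: real ^ 'n. of_real (x $ i) * f x)"
proof (rule rapid_mult_polynomial_growth[where C = 1 and k = 1])
  show "norm (complex_of_real (x $ i)) \<le> 1 * (1 + norm x) ^ 1" for x :: "real ^ 'n"
    using component_le_norm_cart[of x i] by (simp add: add_increasing)
qed

lemma one_plus_norm_square_powr_le:
  "(1 + (norm x)\<^sup>2) powr r \<le> (1 + norm x) ^ nat \<lceil>2 * \<bar>r\<bar>\<rceil>"
proof -
  have 1: "1 \<le> 1 + norm x" by simp
  have "(1 + (norm x)\<^sup>2) powr r \<le> (1 + (norm x)\<^sup>2) powr \<bar>r\<bar>"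
    by (intro powr_mono) auto
  also have "\<dots> \<le> ((1 + norm x)\<^sup>2) powr \<bar>r\<bar>"
    by (intro powr_mono2) (auto simp: power2_sum)
  also have "\<dots> = (1 + norm x) powr (2 * \<bar>r\<bar>)"
    using 1 by (simp add: powr_powr flip: powr_numeral)
  also have "\<dots> \<le> (1 + norm x) powr real (nat \<lceil>2 * \<bar>r\<bar>\<rceil>)"
    by (intro powr_mono) (auto simp: real_nat_ceiling_ge)
  also have "\<dots> = (1 + norm x) ^ nat \<lceil>2 * \<bar>r\<bar>\<rceil>"
    using 1 by (intro powr_realpow) linarith
  finally show ?thesis .
qed

lemma rapid_one_plus_norm_square_powr:
  "rapid f \<Longrightarrow> rapid (\<lambda>x. of_real ((1 + (norm x)\<^sup>2) powr r) * f x)"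
  by (rule rapid_mult_polynomial_growth[where C = 1 and k = "nat \<lceil>2 * \<bar>r\<bar>\<rceil>"])
    (auto simp: one_plus_norm_square_powr_le)

lemma rapid_le_weight:
  fixes f :: "real ^ 'n \<Rightarrow> complex"
  assumes "rapid f"
  obtains B where "0 \<le> B" "\<And>x. norm (f x) \<le> B * weight x"
proof -
  obtain B where B: "\<And>x. (1 + norm x) ^ (2 * CARD('n)) * norm (f x) \<le> B"
    using assms unfolding rapid_def by meson
  have "norm (f x) = weight x * ((1 + norm x) ^ (2 * CARD('n)) * norm (f x))" for x
    using weight_mult_power[of x] by (simp add: mult.assoc[symmetric])
  also have "\<dots> x \<le> weight x * B" for x
    by (intro mult_left_mono B less_imp_le weight_pos)
  finally have *: "norm (f x) \<le> B * weight x" for x by (simp add: mult.commute)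
  have "0 \<le> B"
    using order_trans[OF norm_ge_zero *[of 0]] weight_pos[of "0 :: real ^ 'n"]
    by (auto simp: zero_le_mult_iff)
  with * show ?thesis using that by blast
qed

section \<open>Closure properties of the Schwartz space\<close>

lemma partial_derivI: "(f has_derivative f') (at x) \<Longrightarrow> partial_deriv i f x = f' (axis i 1)"
  unfolding partial_deriv_def using frechet_derivative_at by metis

lemma has_derivative_partial_deriv:
  fixes f :: "real ^ 'n \<Rightarrow> complex"
  assumes "f differentiable (at x)"
  shows "(f has_derivative (\<lambda>h. \<Sum>i\<in>UNIV. of_real (h $ i) * partial_deriv i f x)) (at x)"
proof -
  let ?D = "frechet_derivative f (at x)"
  have D: "(f has_derivative ?D) (at x)"
    using assms frechet_derivative_works by blast
  interpret bounded_linear ?D using D by (rule has_derivative_bounded_linear)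
  have "?D h = (\<Sum>i\<in>UNIV. of_real (h $ i) * partial_deriv i f x)" for h
  proof -
    have "?D h = ?D (\<Sum>i\<in>UNIV. (h $ i) *\<^sub>R axis i 1)"
      using basis_expansion[of h] by (simp add: scalar_mult_eq_scaleR)
    also have "\<dots> = (\<Sum>i\<in>UNIV. (h $ i) *\<^sub>R ?D (axis i 1))"
      by (simp only: sum scaleR)
    finally show ?thesis by (simp add: partial_deriv_def scaleR_conv_of_real)
  qed
  then show ?thesis using D by presburger
qed

lemma iter_partial_deriv_simps:
  "iter_partial_deriv [] f = f"
  "iter_partial_deriv (i # is) f = partial_deriv i (iter_partial_deriv is f)"
  "iter_partial_deriv (is @ [i]) f = iter_partial_deriv is (partial_deriv i f)"
  by (simp_all add: iter_partial_deriv_def)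

lemma smooth_differentiable: "smooth f \<Longrightarrow> f differentiable (at x)"
  unfolding smooth_def using iter_partial_deriv_simps(1) by metis

lemma smooth_partial_deriv: "smooth f \<Longrightarrow> smooth (partial_deriv i f)"
  unfolding smooth_def using iter_partial_deriv_simps(3) by metis

text \<open>Membership without computing iterated derivatives: exhibit a family \<open>C\<close>
  that contains \<open>f\<close>, is stable under \<open>partial_deriv\<close> and consists of
  differentiable rapid functions. Most closure properties below amount to naming such a
  family.\<close>

lemma schwartzI:
  assumes "f \<in> C"
    and "\<And>g x. g \<in> C \<Longrightarrow> g differentiable (at x)"
    and "\<And>g i. g \<in> C \<Longrightarrow> partial_deriv i g \<in> C"
    and "\<And>g. g \<in> C \<Longrightarrow> rapid g"
  shows "f \<in> schwartz"
proof -
  have "iter_partial_deriv is f \<in> C" for "is"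
    by (induction "is") (auto simp: iter_partial_deriv_simps assms)
  then show ?thesis
    using assms(2,4) unfolding schwartz_def smooth_def bdd_above_def rapid_def by fastforce
qed

lemma schwartz_differentiable: "f \<in> schwartz \<Longrightarrow> f differentiable (at x)"
  by (simp add: schwartz_def smooth_differentiable)

lemma schwartz_bdd:
  "f \<in> schwartz \<Longrightarrow> bdd_above (range (\<lambda>x. (1 + norm x) ^ m * norm (iter_partial_deriv is f x)))"
  by (auto simp: schwartz_def)

lemma schwartz_partial_deriv: "f \<in> schwartz \<Longrightarrow> partial_deriv i f \<in> schwartz"
  unfolding schwartz_def mem_Collect_eq using smooth_partial_deriv iter_partial_deriv_simps(3) by metis

lemma schwartz_rapid: "f \<in> schwartz \<Longrightarrow> rapid f"
  using schwartz_bdd[of f _ "[]"] unfolding rapid_def bdd_above_def iter_partial_deriv_simps by auto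

lemma schwartz_has_derivative:
  fixes f :: "real ^ 'n \<Rightarrow> complex"
  shows "f \<in> schwartz \<Longrightarrow>
    (f has_derivative (\<lambda>h. \<Sum>i\<in>UNIV. of_real (h $ i) * partial_deriv i f x)) (at x)"
  by (intro has_derivative_partial_deriv schwartz_differentiable)

lemma schwartz_continuous: "f \<in> schwartz \<Longrightarrow> continuous_on A f"
  using schwartz_differentiable differentiable_imp_continuous_within
  by (metis continuous_at_imp_continuous_on)

lemma schwartz_measurable: "f \<in> schwartz \<Longrightarrow> f \<in> borel_measurable borel"
  by (intro borel_measurable_continuous_onI schwartz_continuous)

lemma rapid_integrable:
  assumes "f \<in> borel_measurable borel" "rapid f"
  shows "integrable lborel f"
proof -
  obtain B where B: "\<And>x. norm (f x) \<le> B * weight x" using rapid_le_weight[OF assms(2)] by metis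
  show ?thesis
    by (rule Bochner_Integration.integrable_bound[OF integrable_mult_right[OF integrable_weight, of B]])
      (use assms(1) B in \<open>auto intro: order_trans[OF _ abs_ge_self]\<close>)
qed

lemma schwartz_integrable: "f \<in> schwartz \<Longrightarrow> integrable lborel f"
  by (intro rapid_integrable schwartz_measurable schwartz_rapid)

lemma partial_deriv_add:
  assumes "f differentiable (at x)" "g differentiable (at x)"
  shows "partial_deriv i (\<lambda>x. f x + g x) x = partial_deriv i f x + partial_deriv i g x"
  by (subst partial_derivI[OF has_derivative_add[OF assms[unfolded frechet_derivative_works]]])
    (simp add: partial_deriv_def)

lemma partial_deriv_cmult:
  assumes "f differentiable (at x)"
  shows "partial_deriv i (\<lambda>x. c * f x) x = c * partial_deriv i f x"
  by (subst partial_derivI[OF has_derivative_mult_right[OF assms[unfolded frechet_derivative_works]]])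
    (simp add: partial_deriv_def)

lemma partial_deriv_mult:
  assumes "f differentiable (at x)" "g differentiable (at x)"
  shows "partial_deriv i (\<lambda>x. f x * g x) x = f x * partial_deriv i g x + partial_deriv i f x * g x"
  by (subst partial_derivI[OF has_derivative_mult[OF assms[unfolded frechet_derivative_works]]])
    (simp add: partial_deriv_def)

lemma schwartz_add:
  assumes "f \<in> schwartz" "g \<in> schwartz"
  shows "(\<lambda>x. f x + g x) \<in> schwartz"
proof (rule schwartzI[where C = "{\<lambda>x. f x + g x | f g. f \<in> schwartz \<and> g \<in> schwartz}"])
  fix h :: "real ^ 'a \<Rightarrow> complex" and i
  assume "h \<in> {\<lambda>x. f x + g x | f g. f \<in> schwartz \<and> g \<in> schwartz}"
  then obtain f g where fg: "h = (\<lambda>x. f x + g x)" "f \<in> schwartz" "g \<in> schwartz" by blast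
  then have "partial_deriv i h = (\<lambda>x. partial_deriv i f x + partial_deriv i g x)"
    by (auto simp: partial_deriv_add schwartz_differentiable)
  then show "partial_deriv i h \<in> {\<lambda>x. f x + g x | f g. f \<in> schwartz \<and> g \<in> schwartz}"
    using fg schwartz_partial_deriv by blast
  show "h differentiable (at x)" for x
    unfolding fg(1) by (intro differentiable_add schwartz_differentiable fg(2,3))
  show "rapid h" unfolding fg(1) by (intro rapid_add schwartz_rapid fg(2,3))
qed (use assms in auto)

lemma schwartz_cmult:
  assumes "f \<in> schwartz"
  shows "(\<lambda>x. c * f x) \<in> schwartz"
proof (rule schwartzI[where C = "(\<lambda>f x. c * f x) ` schwartz"])
  fix h :: "real ^ 'a \<Rightarrow> complex" and i
  assume "h \<in> (\<lambda>f x. c * f x) ` schwartz"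
  then obtain f where f: "h = (\<lambda>x. c * f x)" "f \<in> schwartz" by blast
  then have "partial_deriv i h = (\<lambda>x. c * partial_deriv i f x)"
    by (auto simp: partial_deriv_cmult schwartz_differentiable)
  then show "partial_deriv i h \<in> (\<lambda>f x. c * f x) ` schwartz"
    using f schwartz_partial_deriv by blast
  show "h differentiable (at x)" for x
    unfolding f(1) by (intro differentiable_mult differentiable_const schwartz_differentiable[OF f(2)])
  show "rapid h" unfolding f(1) by (intro rapid_cmult schwartz_rapid f(2))
qed (use assms in auto)

lemma schwartz_diff:
  assumes "f \<in> schwartz" "g \<in> schwartz"
  shows "(\<lambda>x. f x - g x) \<in> schwartz"
  using schwartz_add[OF assms(1) schwartz_cmult[OF assms(2), of "-1"]] by simp

lemma has_derivative_coord:
  "((\<lambda>x. complex_of_real (x $ i)) has_derivative (\<lambda>h. of_real (h $ i))) (at x)"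
  by (intro bounded_linear_imp_has_derivative bounded_linear_compose[OF bounded_linear_of_real]
      bounded_linear_vec_nth)

lemma partial_deriv_coord_mult:
  assumes "f differentiable (at x)"
  shows "partial_deriv j (\<lambda>x. of_real (x $ i) * f x) x =
    of_real (x $ i) * partial_deriv j f x + (if i = j then 1 else 0) * f x"
proof -
  have "partial_deriv j (\<lambda>x. complex_of_real (x $ i)) x = (if i = j then 1 else 0)"
    by (subst partial_derivI[OF has_derivative_coord]) (simp add: axis_def)
  moreover have "(\<lambda>x. complex_of_real (x $ i)) differentiable (at x)"
    using has_derivative_coord by (auto simp: differentiable_def)
  ultimately show ?thesis
    using partial_deriv_mult[OF _ assms] by simp
qed

lemma schwartz_coord:
  assumes "f \<in> schwartz"
  shows "(\<lambda>x. of_real (x $ i) * f x) \<in> schwartz"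
\<comment> \<open>The free summand \<open>g\<close> absorbs the term without coordinate factor that
  the product rule produces when i = j.\<close>
proof (rule schwartzI[where C = "{\<lambda>x. of_real (x $ i) * f x + g x | f g. f \<in> schwartz \<and> g \<in> schwartz}"])
  fix h :: "real ^ 'a \<Rightarrow> complex" and j x
  assume "h \<in> {\<lambda>x. of_real (x $ i) * f x + g x | f g. f \<in> schwartz \<and> g \<in> schwartz}"
  then obtain f g where fg: "h = (\<lambda>x. of_real (x $ i) * f x + g x)" "f \<in> schwartz" "g \<in> schwartz"
    by blast
  have d: "(\<lambda>x. of_real (x $ i) * f x) differentiable (at x)" for x
    using fg has_derivative_coord
    by (intro differentiable_mult schwartz_differentiable[OF fg(2)]) (auto simp: differentiable_def)
  show "h differentiable (at x)"
    unfolding fg(1) by (intro differentiable_add d schwartz_differentiable fg)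
  have "partial_deriv j h = (\<lambda>x. of_real (x $ i) * partial_deriv j f x +
      ((if i = j then 1 else 0) * f x + partial_deriv j g x))"
    unfolding fg(1)
    by (intro ext, subst partial_deriv_add)
      (use fg d in \<open>auto simp: partial_deriv_coord_mult schwartz_differentiable\<close>)
  moreover have "(\<lambda>x. (if i = j then 1 else 0) * f x + partial_deriv j g x) \<in> schwartz"
    by (intro schwartz_add schwartz_cmult schwartz_partial_deriv fg)
  ultimately show "partial_deriv j h \<in> {\<lambda>x. of_real (x $ i) * f x + g x | f g. f \<in> schwartz \<and> g \<in> schwartz}"
    unfolding mem_Collect_eq using schwartz_partial_deriv[OF fg(2)] by (intro exI conjI)
  show "rapid h" unfolding fg(1) by (intro rapid_add rapid_coord schwartz_rapid fg)
next
  have "(\<lambda>x :: real ^ 'a. 0) \<in> schwartz" using schwartz_cmult[OF assms, of 0] by simp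
  then have "(\<lambda>x. of_real (x $ i) * f x) = (\<lambda>x. of_real (x $ i) * f x + (\<lambda>x. 0) x) \<and>
      f \<in> schwartz \<and> (\<lambda>x :: real ^ 'a. 0 :: complex) \<in> schwartz"
    using assms by simp
  then show "(\<lambda>x. of_real (x $ i) * f x) \<in> {\<lambda>x. of_real (x $ i) * f x + g x | f g. f \<in> schwartz \<and> g \<in> schwartz}"
    unfolding mem_Collect_eq by (intro exI)
qed


text \<open>The stable family carries a scalar \<open>k\<close> because the chain rule produces a
  factor \<open>c\<close>. Since |c x| = |x|, decay survives through 1 + |x| <= (1 + |a|) (1 + |a +
  c x|).\<close>

lemma schwartz_affine:
  assumes "f \<in> schwartz" and "\<bar>c\<bar> = 1"
  shows "(\<lambda>x. f (a + c *\<^sub>R x)) \<in> schwartz"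
proof (rule schwartzI[where C = "{\<lambda>x. k * f (a + c *\<^sub>R x) | f k. f \<in> schwartz}"])
  fix h :: "real ^ 'a \<Rightarrow> complex" and j x
  assume "h \<in> {\<lambda>x. k * f (a + c *\<^sub>R x) | f k. f \<in> schwartz}"
  then obtain f k where f: "h = (\<lambda>x. k * f (a + c *\<^sub>R x))" "f \<in> schwartz" by blast
  have d: "(h has_derivative (\<lambda>v. k * (\<Sum>i\<in>UNIV. of_real ((c *\<^sub>R v) $ i) * partial_deriv i f (a + c *\<^sub>R x)))) (at x)" for x
    unfolding f(1)
    by (intro has_derivative_mult_right has_derivative_compose[OF _ schwartz_has_derivative[OF f(2)]])
      (auto intro!: derivative_eq_intros)
  then show "h differentiable (at x)" unfolding differentiable_def by blast
  have "partial_deriv j h x = (k * of_real c) * partial_deriv j f (a + c *\<^sub>R x)" for x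
    by (subst partial_derivI[OF d]) (simp add: axis_def if_distrib if_distribR sum.delta cong: if_cong)
  then have "partial_deriv j h = (\<lambda>x. (k * of_real c) * partial_deriv j f (a + c *\<^sub>R x))" by blast
  then show "partial_deriv j h \<in> {\<lambda>x. k * f (a + c *\<^sub>R x) | f k. f \<in> schwartz}"
    unfolding mem_Collect_eq using schwartz_partial_deriv[OF f(2)] by (intro exI conjI)
  show "rapid h" unfolding f(1)
  proof (rule rapid_cmult, unfold rapid_def, intro allI)
    fix m
    obtain B where B: "\<And>x. (1 + norm x) ^ m * norm (f x) \<le> B"
      using schwartz_rapid[OF f(2)] unfolding rapid_def by meson
    have "(1 + norm x) ^ m * norm (f (a + c *\<^sub>R x)) \<le> (1 + norm a) ^ m * B" for x
    proof -
      have "norm x = norm (c *\<^sub>R x)" using assms(2) by simp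
      also have "\<dots> \<le> norm (a + c *\<^sub>R x) + norm a"
        using norm_triangle_ineq4[of "a + c *\<^sub>R x" a] by simp
      finally have "1 + norm x \<le> (1 + norm a) * (1 + norm (a + c *\<^sub>R x))"
        using mult_nonneg_nonneg[OF norm_ge_zero[of a] norm_ge_zero[of "a + c *\<^sub>R x"]]
        by (simp only: ring_distribs mult_1 mult_1_right)
      then have "(1 + norm x) ^ m \<le> (1 + norm a) ^ m * (1 + norm (a + c *\<^sub>R x)) ^ m"
        by (metis power_mono power_mult_distrib norm_ge_zero add_nonneg_nonneg zero_le_one)
      then have "(1 + norm x) ^ m * norm (f (a + c *\<^sub>R x)) \<le>
          ((1 + norm a) ^ m * (1 + norm (a + c *\<^sub>R x)) ^ m) * norm (f (a + c *\<^sub>R x))"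
        by (rule mult_right_mono) simp
      also have "\<dots> \<le> (1 + norm a) ^ m * B"
        using B by (simp add: mult.assoc mult_left_mono)
      finally show ?thesis .
    qed
    then show "\<exists>B. \<forall>x. (1 + norm x) ^ m * norm (f (a + c *\<^sub>R x)) \<le> B" by blast
  qed
next
  have "(\<lambda>x. f (a + c *\<^sub>R x)) = (\<lambda>x. 1 * f (a + c *\<^sub>R x)) \<and> f \<in> schwartz" using assms by simp
  then show "(\<lambda>x. f (a + c *\<^sub>R x)) \<in> {\<lambda>x. k * f (a + c *\<^sub>R x) | f k. f \<in> schwartz}"
    unfolding mem_Collect_eq by (intro exI)
qed

lemma schwartz_uminus: "f \<in> schwartz \<Longrightarrow> (\<lambda>x. f (- x)) \<in> schwartz"
  using schwartz_affine[of f "-1" 0] by simp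

lemma schwartz_translate: "f \<in> schwartz \<Longrightarrow> (\<lambda>x. f (a + x)) \<in> schwartz"
  using schwartz_affine[of f 1 a] by simp

text \<open>Differentiating (1 + |x|^2)^r f yields a second term with exponent r - 1, so a stable
  family has to mix exponents. Scalars and coordinate factors go into the Schwartz factor, which
  leaves sums as the only further closure.\<close>

inductive_set powr_span :: "(real ^ 'n \<Rightarrow> complex) set" where
  gen: "f \<in> schwartz \<Longrightarrow> (\<lambda>x. of_real ((1 + (norm x)\<^sup>2) powr r) * f x) \<in> powr_span"
| add: "f \<in> powr_span \<Longrightarrow> g \<in> powr_span \<Longrightarrow> (\<lambda>x. f x + g x) \<in> powr_span"

lemma has_derivative_one_plus_norm_square_powr:
  "((\<lambda>x :: real ^ 'n. complex_of_real ((1 + (norm x)\<^sup>2) powr r)) has_derivative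
    (\<lambda>h. of_real (2 * r * (1 + (norm x)\<^sup>2) powr (r - 1) * (x \<bullet> h)))) (at x)"
proof -
  have pos: "0 < 1 + (norm y)\<^sup>2" for y :: "real ^ 'n" by (simp add: add_pos_nonneg)
  have "((\<lambda>x :: real ^ 'n. (1 + x \<bullet> x) powr r) has_derivative
    (\<lambda>h. 2 * r * (1 + x \<bullet> x) powr (r - 1) * (x \<bullet> h))) (at x)"
    using pos[of x]
    by (auto intro!: derivative_eq_intros ext simp: power2_norm_eq_inner inner_commute
        powr_diff field_simps)
  then show ?thesis
    unfolding power2_norm_eq_inner by (rule has_derivative_of_real)
qed

lemma powr_span_props:
  assumes "h \<in> powr_span"
  shows "h differentiable (at x)" "partial_deriv j h \<in> powr_span" "rapid h"
proof -
  have "(\<forall>x. h differentiable (at x)) \<and> partial_deriv j h \<in> powr_span \<and> rapid h"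
    using assms
  proof (induction)
    case (gen f r)
    let ?m = "\<lambda>r (x :: real ^ 'a). complex_of_real ((1 + (norm x)\<^sup>2) powr r)"
    have m: "?m r differentiable (at x)" for x
      using has_derivative_one_plus_norm_square_powr unfolding differentiable_def by blast
    have pm: "partial_deriv j (?m r) x = 2 * of_real r * ?m (r - 1) x * of_real (x $ j)" for x
      by (subst partial_derivI[OF has_derivative_one_plus_norm_square_powr]) (simp add: inner_axis)
    have "partial_deriv j (\<lambda>x. ?m r x * f x) x = ?m r x * partial_deriv j f x +
        ?m (r - 1) x * ((2 * of_real r) * (of_real (x $ j) * f x))" for x
      by (subst partial_deriv_mult) (use m gen in \<open>auto simp: schwartz_differentiable pm\<close>)
    then have "partial_deriv j (\<lambda>x. ?m r x * f x) = (\<lambda>x. ?m r x * partial_deriv j f x +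
        ?m (r - 1) x * ((2 * of_real r) * (of_real (x $ j) * f x)))" by blast
    also have "\<dots> \<in> powr_span"
      by (rule powr_span.add; rule powr_span.gen)
        (intro schwartz_partial_deriv schwartz_cmult schwartz_coord gen)+
    finally show ?case
      by (intro conjI allI differentiable_mult m rapid_one_plus_norm_square_powr
          schwartz_differentiable[OF gen] schwartz_rapid gen)
  next
    case (add f g)
    then have "partial_deriv j (\<lambda>x. f x + g x) = (\<lambda>x. partial_deriv j f x + partial_deriv j g x)"
      by (auto simp: partial_deriv_add)
    then show ?case
      using add powr_span.add by (auto intro!: rapid_add differentiable_add)
  qed
  then show "h differentiable (at x)" "partial_deriv j h \<in> powr_span" "rapid h" by auto
qed

lemma schwartz_one_plus_norm_square_powr:
  assumes "f \<in> schwartz"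
  shows "(\<lambda>x. of_real ((1 + (norm x)\<^sup>2) powr r) * f x) \<in> schwartz"
  by (rule schwartzI[where C = powr_span]) (use assms powr_span_props powr_span.gen in auto)

definition gauss :: "real \<Rightarrow> real ^ 'n \<Rightarrow> complex" where
  "gauss a x = of_real (exp (- a * (norm x)\<^sup>2))"

text \<open>Polynomials times one fixed Gaussian, a family that survives differentiation.\<close>

inductive_set gauss_span :: "real \<Rightarrow> (real ^ 'n \<Rightarrow> complex) set" for a where
  gen: "gauss a \<in> gauss_span a"
| add: "f \<in> gauss_span a \<Longrightarrow> g \<in> gauss_span a \<Longrightarrow> (\<lambda>x. f x + g x) \<in> gauss_span a"
| cmult: "f \<in> gauss_span a \<Longrightarrow> (\<lambda>x. c * f x) \<in> gauss_span a"
| coord: "f \<in> gauss_span a \<Longrightarrow> (\<lambda>x. of_real (x $ i) * f x) \<in> gauss_span a"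

lemma has_derivative_gauss:
  "(gauss a has_derivative (\<lambda>h. of_real (- 2 * a * (x \<bullet> h)) * gauss a x)) (at x)"
proof -
  have "((\<lambda>x :: real ^ 'n. exp (- a * (x \<bullet> x))) has_derivative
    (\<lambda>h. - 2 * a * (x \<bullet> h) * exp (- a * (x \<bullet> x)))) (at x)" for x
    by (auto intro!: derivative_eq_intros ext simp: inner_commute algebra_simps)
  then have "((\<lambda>x :: real ^ 'n. complex_of_real (exp (- a * (norm x)\<^sup>2))) has_derivative
    (\<lambda>h. of_real (- 2 * a * (x \<bullet> h) * exp (- a * (norm x)\<^sup>2)))) (at x)" for x
    unfolding power2_norm_eq_inner by (rule has_derivative_of_real)
  then show ?thesis unfolding gauss_def[abs_def] by simp
qed

lemma partial_deriv_gauss: "partial_deriv i (gauss a) x = of_real (- 2 * a) * (of_real (x $ i) * gauss a x)"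
  by (subst partial_derivI[OF has_derivative_gauss]) (simp add: inner_axis)

text \<open>By 1 + r <= exp r the polynomial weight costs exp (m r); the exponent m r - a r^2 is
  then bounded by completing the square.\<close>

lemma rapid_gauss:
  assumes "0 < a"
  shows "rapid (gauss a :: real ^ 'n \<Rightarrow> complex)"
  unfolding rapid_def
proof
  fix m :: nat
  have "(1 + norm x) ^ m * norm (gauss a x) \<le> exp ((real m)\<^sup>2 / (4 * a))" for x :: "real ^ 'n"
  proof -
    have "(1 + norm x) ^ m \<le> exp (norm x) ^ m"
      by (intro power_mono) (auto simp: exp_ge_add_one_self)
    then have "(1 + norm x) ^ m * norm (gauss a x) \<le> exp (real m * norm x) * exp (- a * (norm x)\<^sup>2)"
      unfolding gauss_def by (simp add: exp_of_nat_mult mult_right_mono)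
    also have "\<dots> = exp (real m * norm x - a * (norm x)\<^sup>2)" by (simp add: exp_diff exp_minus field_simps)
    also have "\<dots> \<le> exp ((real m)\<^sup>2 / (4 * a))"
    proof -
      have "0 \<le> (real m - 2 * a * norm x)\<^sup>2" by simp
      then show ?thesis using assms by (simp add: field_simps power2_eq_square)
    qed
    finally show ?thesis .
  qed
  then show "\<exists>B. \<forall>x :: real ^ 'n. (1 + norm x) ^ m * norm (gauss a x) \<le> B" by blast
qed

lemma schwartz_gauss:
  assumes "0 < a"
  shows "gauss a \<in> schwartz"
proof -
  have *: "(\<forall>x. h differentiable (at x)) \<and> partial_deriv j h \<in> gauss_span a \<and> rapid h"
    if "h \<in> gauss_span a" for h :: "real ^ 'a \<Rightarrow> complex" and j
    using that
  proof induction
    case gen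
    have "partial_deriv j (gauss a) = (\<lambda>x. of_real (- 2 * a) * (of_real (x $ j) * gauss a x))"
      by (intro ext partial_deriv_gauss)
    also have "\<dots> \<in> gauss_span a"
      by (intro gauss_span.intros)
    finally show ?case
      using has_derivative_gauss rapid_gauss[OF assms] by (auto simp: differentiable_def)
  next
    case (add f g)
    then have "partial_deriv j (\<lambda>x. f x + g x) = (\<lambda>x. partial_deriv j f x + partial_deriv j g x)"
      by (auto simp: partial_deriv_add)
    with add show ?case by (auto intro!: rapid_add differentiable_add gauss_span.add)
  next
    case (cmult f c)
    then have "partial_deriv j (\<lambda>x. c * f x) = (\<lambda>x. c * partial_deriv j f x)"
      by (auto simp: partial_deriv_cmult)
    with cmult show ?case by (auto intro!: rapid_cmult differentiable_mult gauss_span.cmult)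
  next
    case (coord f i)
    then have "partial_deriv j (\<lambda>x. of_real (x $ i) * f x) =
        (\<lambda>x. of_real (x $ i) * partial_deriv j f x + (if i = j then 1 else 0) * f x)"
      by (auto simp: partial_deriv_coord_mult)
    moreover have "(\<lambda>x. complex_of_real (x $ i)) differentiable (at x)" for x
      using has_derivative_coord by (auto simp: differentiable_def)
    ultimately show ?case
      using coord by (auto intro!: rapid_coord differentiable_mult gauss_span.add
          gauss_span.coord gauss_span.cmult)
  qed
  show ?thesis
  proof (rule schwartzI[where C = "gauss_span a", OF gauss_span.gen])
    fix h :: "real ^ 'a \<Rightarrow> complex" assume h: "h \<in> gauss_span a"
    show "h differentiable (at x)" for x using *[OF h] by simp
    show "partial_deriv j h \<in> gauss_span a" for j using *[OF h, of j] by simp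
    show "rapid h" using *[OF h] by simp
  qed
qed

text \<open>Compact support passes to derivatives: \<open>g\<close> vanishes on the open complement
  of the closure of its support set, so its derivative vanishes there too. Decay is then boundedness
  of a continuous function on a compact set.\<close>

lemma test_functions_schwartz:
  assumes "f \<in> test_functions \<Omega>"
  shows "f \<in> schwartz"
proof (rule schwartzI[where C = "{g. smooth g \<and> compact (closure {x. g x \<noteq> 0})}"])
  fix g :: "real ^ 'a \<Rightarrow> complex" and i x
  assume "g \<in> {g. smooth g \<and> compact (closure {x. g x \<noteq> 0})}"
  then have g: "smooth g" "compact (closure {x. g x \<noteq> 0})" by auto
  then show d: "g differentiable (at x)" for x by (simp add: smooth_differentiable)
  have "{x. partial_deriv i g x \<noteq> 0} \<subseteq> closure {x. g x \<noteq> 0}"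
  proof (rule subsetI, rule ccontr)
    fix x assume x: "x \<in> {x. partial_deriv i g x \<noteq> 0}" "x \<notin> closure {x. g x \<noteq> 0}"
    have *: "0 = g y" if "y \<in> - closure {x. g x \<noteq> 0}" for y
    proof (rule ccontr)
      assume "0 \<noteq> g y"
      then have "y \<in> {x. g x \<noteq> 0}" by (intro CollectI) (rule not_sym)
      then show False using that closure_subset[of "{x. g x \<noteq> 0}"] by blast
    qed
    have "x \<in> - closure {x. g x \<noteq> 0}" using x(2) by blast
    then have "(g has_derivative (\<lambda>_. 0)) (at x)"
      by (rule has_derivative_transform_within_open[OF has_derivative_const
            open_Compl[OF closed_closure]]) (rule *)
    from partial_derivI[OF this, of i] show False using x(1) by simp
  qed
  then have "closure {x. partial_deriv i g x \<noteq> 0} \<subseteq> closure {x. g x \<noteq> 0}"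
    by (simp add: closure_minimal)
  then have "compact (closure {x. partial_deriv i g x \<noteq> 0})"
    by (metis compact_Int_closed[OF g(2) closed_closure] inf.absorb2)
  then show "partial_deriv i g \<in> {g. smooth g \<and> compact (closure {x. g x \<noteq> 0})}"
    using smooth_partial_deriv[OF g(1)] by simp
  show "rapid g" unfolding rapid_def
  proof
    fix m
    have "continuous_on UNIV g"
      by (intro continuous_at_imp_continuous_on ballI differentiable_imp_continuous_within d)
    then have "continuous_on (closure {x. g x \<noteq> 0}) g"
      by (rule continuous_on_subset[OF _ subset_UNIV])
    then have "continuous_on (closure {x. g x \<noteq> 0}) (\<lambda>x. (1 + norm x) ^ m * norm (g x))"
      by (intro continuous_on_mult continuous_on_power continuous_on_add continuous_on_const
          continuous_on_norm continuous_on_id)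
    then have "bounded ((\<lambda>x. (1 + norm x) ^ m * norm (g x)) ` closure {x. g x \<noteq> 0})"
      using g(2) compact_imp_bounded compact_continuous_image by blast
    then obtain B where B: "\<And>x. x \<in> closure {x. g x \<noteq> 0} \<Longrightarrow> norm ((1 + norm x) ^ m * norm (g x)) \<le> B"
      unfolding bounded_iff by blast
    have "(1 + norm x) ^ m * norm (g x) \<le> max B 0" for x
    proof (cases "g x = 0")
      case False
      then have "x \<in> closure {x. g x \<noteq> 0}" using closure_subset[of "{x. g x \<noteq> 0}"] by blast
      from B[OF this] show ?thesis by simp
    qed auto
    then show "\<exists>B. \<forall>x. (1 + norm x) ^ m * norm (g x) \<le> B" by blast
  qed
qed (use assms in \<open>auto simp: test_functions_def\<close>)

subsection \<open>Fourier inversion\<close>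

lemma cis_measurable[measurable]: "cis \<in> borel_measurable borel"
  by (intro borel_measurable_continuous_onI continuous_intros)

lemma integrable_cis_mult:
  fixes f :: "'a \<Rightarrow> complex"
  assumes "integrable M f" and [measurable]: "g \<in> borel_measurable M"
  shows "integrable M (\<lambda>x. cis (g x) * f x)"
proof (rule Bochner_Integration.integrable_bound[OF assms(1)])
  have [measurable]: "f \<in> borel_measurable M" using assms(1) by auto
  show "(\<lambda>x. cis (g x) * f x) \<in> borel_measurable M" by measurable
qed (simp add: norm_mult)

lemma norm_fourier_le:
  "integrable lborel f \<Longrightarrow> norm (fourier f \<xi>) \<le> (LINT x|lborel. norm (f x))"
  unfolding fourier_def
  by (rule order_trans[OF integral_norm_bound]) (simp add: norm_mult)

lemma fourier_add:
  assumes "integrable lborel f" "integrable lborel g"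
  shows "fourier (\<lambda>x. f x + g x) \<xi> = fourier f \<xi> + fourier g \<xi>"
  unfolding fourier_def distrib_left
  by (intro Bochner_Integration.integral_add integrable_cis_mult assms) auto

lemma fourier_cmult: "fourier (\<lambda>x. c * f x) \<xi> = c * fourier f \<xi>"
  by (simp add: fourier_def mult.left_commute)

lemma inv_fourier_fourier_uminus:
  "inv_fourier f x = of_real (1 / (2 * pi) ^ CARD('n)) * fourier f (- x)" for x :: "real ^ 'n"
  by (simp add: inv_fourier_def fourier_def inner_commute)

lemma fourier_uminus:
  assumes [measurable]: "f \<in> borel_measurable borel"
  shows "fourier (\<lambda>x. f (- x)) \<xi> = fourier f (- \<xi>)"
  unfolding fourier_def
  using integral_lborel_reflect[of "\<lambda>x. cis (- (x \<bullet> \<xi>)) * f (- x)" 0]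
  by simp

section \<open>Differentiation and decay of Fourier transforms\<close>

text \<open>The form in which the Taylor bound for \<open>cis\<close> arrives after integration: a
  quadratic remainder.\<close>

lemma has_derivativeI_quadratic:
  fixes F :: "'a::real_normed_vector \<Rightarrow> 'b::real_normed_vector"
  assumes "bounded_linear F'" and "\<And>h. norm (F (x + h) - F x - F' h) \<le> C * (norm h)\<^sup>2"
  shows "(F has_derivative F') (at x)"
  unfolding has_derivative_at
proof (rule conjI[OF assms(1)], rule Lim_null_comparison[where g = "\<lambda>h. \<bar>C\<bar> * norm h"])
  show "\<forall>\<^sub>F h in at 0. norm (norm (F (x + h) - F x - F' h) / norm h) \<le> \<bar>C\<bar> * norm h"
  proof (rule always_eventually, rule allI)
    fix h :: 'a
    have "C * (norm h)\<^sup>2 \<le> \<bar>C\<bar> * (norm h)\<^sup>2" by (intro mult_right_mono) auto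
    with assms(2)[of h] have "norm (F (x + h) - F x - F' h) \<le> \<bar>C\<bar> * norm h * norm h"
      by (simp add: power2_eq_square mult.assoc)
    then show "norm (norm (F (x + h) - F x - F' h) / norm h) \<le> \<bar>C\<bar> * norm h"
      by (cases "h = 0") (simp_all add: divide_simps)
  qed
next
  show "((\<lambda>h::'a. \<bar>C\<bar> * norm h) \<longlongrightarrow> 0) (at 0)"
    by (intro tendsto_mult_right_zero tendsto_norm_zero tendsto_ident_at)
qed

lemma norm_cis_minus_linear_le: "norm (cis t - 1 - \<i> * t) \<le> t\<^sup>2 / 2"
  using iexp_approx1[of t 1] by (simp add: cis_conv_exp diff_diff_eq power2_eq_square)

text \<open>The remainder under the integral is at most |x|^2 |h|^2 |f x|, and |x|^2 f is integrable
  by rapid decay; so no limit has to be taken inside the integral.\<close>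

lemma fourier_has_derivative:
  fixes f :: "real ^ 'n \<Rightarrow> complex"
  assumes f: "f \<in> schwartz"
  shows "(fourier f has_derivative
    (\<lambda>h. \<Sum>j\<in>UNIV. of_real (h $ j) * fourier (\<lambda>x. - \<i> * (of_real (x $ j) * f x)) \<xi>)) (at \<xi>)"
proof -
  let ?F' = "\<lambda>h. \<Sum>j\<in>UNIV. of_real (h $ j) * fourier (\<lambda>x. - \<i> * (of_real (x $ j) * f x)) \<xi>"
  have [measurable]: "f \<in> borel_measurable borel" by (rule schwartz_measurable[OF f])
  have i1: "integrable lborel (\<lambda>x. - \<i> * (of_real (x $ j) * f x))" for j
    by (intro schwartz_integrable schwartz_cmult schwartz_coord f)
  have m2: "(\<lambda>x. complex_of_real ((norm x)\<^sup>2) * f x) \<in> borel_measurable borel" by measurable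
  have "rapid (\<lambda>x. of_real ((norm x)\<^sup>2) * f x)"
    by (rule rapid_mult_polynomial_growth[OF schwartz_rapid[OF f], where C = 1 and k = 2])
      (auto simp: power2_sum norm_power)
  then have i2: "integrable lborel (\<lambda>x. of_real ((norm x)\<^sup>2) * f x)"
    by (intro rapid_integrable m2)
  have F': "?F' h = (LINT x|lborel. cis (- (x \<bullet> \<xi>)) * (- \<i> * of_real (x \<bullet> h) * f x))" for h
  proof -
    have "?F' h = (\<Sum>j\<in>UNIV. (LINT x|lborel. cis (- (x \<bullet> \<xi>)) * (of_real (h $ j) * (- \<i> * (of_real (x $ j) * f x)))))"
      unfolding fourier_cmult[symmetric] by (simp only: fourier_def)
    also have "\<dots> = (LINT x|lborel. (\<Sum>j\<in>UNIV. cis (- (x \<bullet> \<xi>)) * (of_real (h $ j) * (- \<i> * (of_real (x $ j) * f x)))))"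
      by (intro Bochner_Integration.integral_sum[symmetric] integrable_cis_mult integrable_mult_right i1) auto
    finally show ?thesis
      by (simp add: inner_vec_def sum_distrib_left sum_distrib_right mult_ac)
  qed
  let ?C = "LINT x|lborel. norm (of_real ((norm x)\<^sup>2) * f x)"
  show ?thesis
  proof (rule has_derivativeI_quadratic[where C = ?C])
    show "bounded_linear ?F'"
      by (intro bounded_linear_sum bounded_linear_mult_const bounded_linear_compose[OF bounded_linear_of_real]
          bounded_linear_vec_nth)
    fix h
    have ii: "integrable lborel (\<lambda>x. cis (- (x \<bullet> \<xi>)) * (- \<i> * of_real (x \<bullet> h) * f x))"
    proof (intro integrable_cis_mult rapid_integrable)
      have "rapid (\<lambda>x. (- \<i> * of_real (x \<bullet> h)) * f x)"
      proof (rule rapid_mult_polynomial_growth[OF schwartz_rapid[OF f], where C = "norm h" and k = 1])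
        fix x
        have "\<bar>x \<bullet> h\<bar> \<le> norm x * norm h" by (rule Cauchy_Schwarz_ineq2)
        then show "norm (- \<i> * complex_of_real (x \<bullet> h)) \<le> norm h * (1 + norm x) ^ 1"
          by (simp add: norm_mult algebra_simps add_increasing)
      qed
      then show "rapid (\<lambda>x. - \<i> * of_real (x \<bullet> h) * f x)" by simp
    qed auto
    have if1: "integrable lborel (\<lambda>x. cis (- (x \<bullet> \<eta>)) * f x)" for \<eta>
      by (intro integrable_cis_mult schwartz_integrable f) auto
    have "fourier f (\<xi> + h) - fourier f \<xi> - ?F' h =
      (LINT x|lborel. cis (- (x \<bullet> (\<xi> + h))) * f x - cis (- (x \<bullet> \<xi>)) * f x - cis (- (x \<bullet> \<xi>)) * (- \<i> * of_real (x \<bullet> h) * f x))"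
      unfolding F' unfolding fourier_def
      using if1 ii by (simp add: Bochner_Integration.integral_diff)
    also have "norm \<dots> \<le> (LINT x|lborel. norm (of_real ((norm x)\<^sup>2) * f x) * (norm h)\<^sup>2)"
    proof (rule order_trans[OF integral_norm_bound], rule integral_mono[OF integrable_norm])
      show "integrable lborel (\<lambda>x. cis (- (x \<bullet> (\<xi> + h))) * f x - cis (- (x \<bullet> \<xi>)) * f x - cis (- (x \<bullet> \<xi>)) * (- \<i> * of_real (x \<bullet> h) * f x))"
        by (intro Bochner_Integration.integrable_diff if1 ii)
      show "integrable lborel (\<lambda>x. norm (of_real ((norm x)\<^sup>2) * f x) * (norm h)\<^sup>2)"
        by (intro integrable_mult_left integrable_norm i2)
      fix x
      have "cis (- (x \<bullet> (\<xi> + h))) * f x - cis (- (x \<bullet> \<xi>)) * f x - cis (- (x \<bullet> \<xi>)) * (- \<i> * of_real (x \<bullet> h) * f x)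
         = cis (- (x \<bullet> \<xi>)) * (cis (- (x \<bullet> h)) - 1 - \<i> * of_real (- (x \<bullet> h))) * f x"
      proof -
        have "cis (- (x \<bullet> (\<xi> + h))) = cis (- (x \<bullet> \<xi>)) * cis (- (x \<bullet> h))"
          by (simp add: cis_mult inner_add_right)
        then show ?thesis by (simp add: algebra_simps)
      qed
      also have "norm \<dots> \<le> (x \<bullet> h)\<^sup>2 / 2 * norm (f x)"
        unfolding norm_mult
          using norm_cis_minus_linear_le[of "- (x \<bullet> h)"] by (intro mult_right_mono) simp_all
      also have "\<dots> \<le> (norm x * norm h)\<^sup>2 * norm (f x)"
      proof (rule mult_right_mono)
        have "(x \<bullet> h)\<^sup>2 \<le> (norm x * norm h)\<^sup>2"
          using Cauchy_Schwarz_ineq2[of x h] by (intro abs_le_square_iff[THEN iffD1]) simp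
        then show "(x \<bullet> h)\<^sup>2 / 2 \<le> (norm x * norm h)\<^sup>2"
          using zero_le_power2[of "x \<bullet> h"] by linarith
      qed simp
      finally show "norm (cis (- (x \<bullet> (\<xi> + h))) * f x - cis (- (x \<bullet> \<xi>)) * f x - cis (- (x \<bullet> \<xi>)) * (- \<i> * of_real (x \<bullet> h) * f x))
         \<le> norm (of_real ((norm x)\<^sup>2) * f x) * (norm h)\<^sup>2"
        by (simp add: norm_mult norm_power power_mult_distrib mult_ac)
    qed
    finally show "norm (fourier f (\<xi> + h) - fourier f \<xi> - ?F' h) \<le> ?C * (norm h)\<^sup>2"
      by simp
  qed
qed

lemma fourier_coord:
  fixes f :: "real ^ 'n \<Rightarrow> complex"
  assumes f: "f \<in> schwartz"
  shows "partial_deriv j (fourier f) = fourier (\<lambda>x. - \<i> * (of_real (x $ j) * f x))"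
  by (rule ext, subst partial_derivI[OF fourier_has_derivative[OF f]])
    (simp add: axis_def if_distrib if_distribR sum.delta cong: if_cong)

text \<open>Lets one multiple of \<open>weight x\<close> dominate a rapid function along a whole
  segment of length at most 1 starting at \<open>x\<close>. The factor comes from 1 + |x| <= 2 (1 +
  |x + y|).\<close>

lemma weight_shift_le:
  fixes x :: "real ^ 'n"
  assumes "norm y \<le> 1"
  shows "weight (x + y) \<le> 2 ^ (2 * CARD('n)) * weight x"
proof -
  have "norm x \<le> norm (x + y) + norm y" using norm_triangle_ineq4[of "x + y" y] by simp
  then have "1 + norm x \<le> 2 * (1 + norm (x + y))" using assms norm_ge_zero[of "x + y"]
    unfolding distrib_left by linarith
  then have "(1 + norm x) ^ (2 * CARD('n)) \<le> (2 * (1 + norm (x + y))) ^ (2 * CARD('n))"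
    by (intro power_mono) auto
  then have "(1 + norm x) ^ (2 * CARD('n)) \<le> 2 ^ (2 * CARD('n)) * (1 + norm (x + y)) ^ (2 * CARD('n))"
    by (simp only: power_mult_distrib)
  moreover have "0 < (1 + norm x) ^ (2 * CARD('n))" "0 < (1 + norm (x + y)) ^ (2 * CARD('n))"
    by (intro zero_less_power add_pos_nonneg; simp)+
  ultimately show ?thesis
    unfolding weight_def by (simp add: field_simps)
qed

lemma has_vector_derivative_seq:
  fixes f :: "real \<Rightarrow> complex"
  assumes f: "(f has_vector_derivative D) (at x)" and h: "h \<longlonglongrightarrow> 0" "\<And>k. h k \<noteq> 0"
  shows "(\<lambda>k. (f (x + h k) - f x) / of_real (h k)) \<longlonglongrightarrow> D"
proof -
  have "((\<lambda>t. norm (f (x + t) - f x - t *\<^sub>R D) / norm t) \<longlongrightarrow> 0) (at 0)"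
    using f unfolding has_vector_derivative_def has_derivative_at by blast
  moreover have "filterlim h (at 0) sequentially"
    using h by (simp add: filterlim_at)
  ultimately have lim: "(\<lambda>k. norm (f (x + h k) - f x - h k *\<^sub>R D) / norm (h k)) \<longlonglongrightarrow> 0"
    by (rule filterlim_compose)
  have eq: "norm (f (x + h k) - f x - h k *\<^sub>R D) / norm (h k) = norm ((f (x + h k) - f x) / of_real (h k) - D)" for k
  proof -
    have "(f (x + h k) - f x) / of_real (h k) - D = (f (x + h k) - f x - h k *\<^sub>R D) / of_real (h k)"
      using h(2)[of k] by (simp add: field_simps scaleR_conv_of_real)
    then show ?thesis by (simp add: norm_divide)
  qed
  show ?thesis
    by (rule LIM_zero_cancel, rule tendsto_norm_zero_cancel, rule lim[unfolded eq])
qed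

text \<open>In place of integration by parts: by translation invariance the transform of the
  difference quotient is (exp(i h xi_j) - 1) / h times the transform of \<open>f\<close>. Letting h
  tend to 0 on both sides gives the formula, by dominated convergence on the left.\<close>

lemma fourier_partial_deriv:
  fixes f :: "real ^ 'n \<Rightarrow> complex"
  assumes f: "f \<in> schwartz"
  shows "fourier (partial_deriv j f) \<xi> = \<i> * of_real (\<xi> $ j) * fourier f \<xi>"
proof -
  let ?e = "axis j 1 :: real ^ 'n"
  define h where "h k = 1 / real (Suc k)" for k
  have h: "h k \<noteq> 0" "0 < h k" "h k \<le> 1" for k by (auto simp: h_def)
  have h0: "h \<longlonglongrightarrow> 0" unfolding h_def by (rule LIMSEQ_Suc[OF lim_inverse_n'])
  have [measurable]: "f \<in> borel_measurable borel" by (rule schwartz_measurable[OF f])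
  have [measurable]: "partial_deriv j f \<in> borel_measurable borel"
    by (intro schwartz_measurable schwartz_partial_deriv f)
  obtain B where B: "0 \<le> B" "\<And>x. norm (partial_deriv j f x) \<le> B * weight x"
    using rapid_le_weight[OF schwartz_rapid[OF schwartz_partial_deriv[OF f]]] by metis
  have vd: "((\<lambda>\<theta>. f (x + \<theta> *\<^sub>R ?e)) has_vector_derivative partial_deriv j f (x + \<theta> *\<^sub>R ?e)) (at \<theta>)" for x \<theta>
  proof -
    have "((\<lambda>\<theta>. f (x + \<theta> *\<^sub>R ?e)) has_derivative
        (\<lambda>t. \<Sum>i\<in>UNIV. of_real ((t *\<^sub>R ?e) $ i) * partial_deriv i f (x + \<theta> *\<^sub>R ?e))) (at \<theta>)"
      by (rule has_derivative_compose[OF _ schwartz_has_derivative[OF f]])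
        (auto intro!: derivative_eq_intros)
    moreover have "(\<Sum>i\<in>UNIV. of_real ((t *\<^sub>R ?e) $ i) * partial_deriv i f (x + \<theta> *\<^sub>R ?e)) =
        t *\<^sub>R partial_deriv j f (x + \<theta> *\<^sub>R ?e)" for t
    proof -
      have "of_real ((t *\<^sub>R ?e) $ i) * partial_deriv i f (x + \<theta> *\<^sub>R ?e) =
          (if i = j then t *\<^sub>R partial_deriv j f (x + \<theta> *\<^sub>R ?e) else 0)" for i
        by (simp only: vector_scaleR_component axis_def vec_lambda_beta)
          (simp add: scaleR_conv_of_real)
      then show ?thesis by (simp only: sum.delta finite) simp
    qed
    ultimately show ?thesis
      unfolding has_vector_derivative_def by simp
  qed
  let ?q = "\<lambda>k x. (f (x + h k *\<^sub>R ?e) - f x) / of_real (h k)"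
  \<comment> \<open>Mean value inequality on the segment from x to x + h_k e_j, whose length is at
    most 1 as \<open>weight_shift_le\<close> requires.\<close>
  have bound: "norm (?q k x) \<le> B * 2 ^ (2 * CARD('n)) * weight x" for k x
  proof -
    have "norm (f (x + h k *\<^sub>R ?e) - f (x + 0 *\<^sub>R ?e)) \<le> (B * 2 ^ (2 * CARD('n)) * weight x) * norm (h k - 0)"
    proof (rule differentiable_bound[where S = "{0..1}"])
      fix \<theta> :: real assume \<theta>: "\<theta> \<in> {0..1}"
      show "((\<lambda>\<theta>. f (x + \<theta> *\<^sub>R ?e)) has_derivative (\<lambda>t. t *\<^sub>R partial_deriv j f (x + \<theta> *\<^sub>R ?e))) (at \<theta> within {0..1})"
        using vd[of x \<theta>] unfolding has_vector_derivative_def by (rule has_derivative_at_withinI)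
      show "onorm (\<lambda>t. t *\<^sub>R partial_deriv j f (x + \<theta> *\<^sub>R ?e)) \<le> B * 2 ^ (2 * CARD('n)) * weight x"
      proof (rule onorm_le)
        fix t :: real
        have "norm (partial_deriv j f (x + \<theta> *\<^sub>R ?e)) \<le> B * weight (x + \<theta> *\<^sub>R ?e)" by (rule B)
        also have "\<dots> \<le> B * (2 ^ (2 * CARD('n)) * weight x)"
          using \<theta> by (intro mult_left_mono weight_shift_le B(1)) simp
        finally have "norm t * norm (partial_deriv j f (x + \<theta> *\<^sub>R ?e)) \<le> norm t * (B * (2 ^ (2 * CARD('n)) * weight x))"
          by (rule mult_left_mono) simp
        then show "norm (t *\<^sub>R partial_deriv j f (x + \<theta> *\<^sub>R ?e)) \<le> B * 2 ^ (2 * CARD('n)) * weight x * norm t"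
          by (simp only: norm_scaleR real_norm_def mult_ac)
      qed
    qed (use h[of k] in auto)
    then show ?thesis using h[of k] by (simp add: norm_divide field_simps)
  qed
  have lim1: "(\<lambda>k. LINT x|lborel. cis (- (x \<bullet> \<xi>)) * ?q k x) \<longlonglongrightarrow> (LINT x|lborel. cis (- (x \<bullet> \<xi>)) * partial_deriv j f x)"
  proof (rule integral_dominated_convergence[where w = "\<lambda>x. B * 2 ^ (2 * CARD('n)) * weight x"])
    show "integrable lborel (\<lambda>x :: real ^ 'n. B * 2 ^ (2 * CARD('n)) * weight x)"
      by (intro integrable_mult_right integrable_weight)
    show "AE x in lborel. (\<lambda>k. cis (- (x \<bullet> \<xi>)) * ?q k x) \<longlonglongrightarrow> cis (- (x \<bullet> \<xi>)) * partial_deriv j f x"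
    proof (intro AE_I2 tendsto_mult tendsto_const)
      fix x
      show "(\<lambda>k. ?q k x) \<longlonglongrightarrow> partial_deriv j f x"
        using has_vector_derivative_seq[OF vd[of x 0] h0 h(1)] by simp
    qed
    show "AE x in lborel. norm (cis (- (x \<bullet> \<xi>)) * ?q k x) \<le> B * 2 ^ (2 * CARD('n)) * weight x" for k
      using bound by (intro AE_I2) (simp only: norm_mult norm_cis mult_1)
  qed auto
  have eq: "(LINT x|lborel. cis (- (x \<bullet> \<xi>)) * ?q k x) = (cis (h k * \<xi> $ j) - 1) / of_real (h k) * fourier f \<xi>" for k
  proof -
    have i1: "integrable lborel (\<lambda>x. cis (- (x \<bullet> \<xi>)) * f x)"
      by (intro integrable_cis_mult schwartz_integrable f) auto
    let ?s = "h k *\<^sub>R ?e"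
    have s: "cis (- (x \<bullet> \<xi>)) * f (?s + x) = cis (h k * \<xi> $ j) * (cis (- ((?s + x) \<bullet> \<xi>)) * f (?s + x))" for x
      by (simp add: inner_add_left inner_axis' cis_mult[symmetric] cis_mult mult.assoc[symmetric])
    have "(LINT x|lborel. cis (- (x \<bullet> \<xi>)) * f (?s + x)) = cis (h k * \<xi> $ j) * fourier f \<xi>"
      unfolding s fourier_def
      using integral_lborel_translate[of "\<lambda>x. cis (- (x \<bullet> \<xi>)) * f x" ?s] by simp
    moreover have "integrable lborel (\<lambda>x. cis (- (x \<bullet> \<xi>)) * f (?s + x))"
      unfolding s by (intro integrable_mult_right integrable_lborel_translate[OF i1])
    ultimately have "(LINT x|lborel. (cis (- (x \<bullet> \<xi>)) * f (?s + x) - cis (- (x \<bullet> \<xi>)) * f x) / of_real (h k)) =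
        (cis (h k * \<xi> $ j) * fourier f \<xi> - fourier f \<xi>) / of_real (h k)"
      using i1 by (simp add: Bochner_Integration.integral_diff fourier_def)
    then show ?thesis by (simp add: algebra_simps diff_divide_distrib)
  qed
  have lim2: "(\<lambda>k. (cis (h k * \<xi> $ j) - 1) / of_real (h k) * fourier f \<xi>) \<longlonglongrightarrow> \<i> * of_real (\<xi> $ j) * fourier f \<xi>"
  proof (intro tendsto_mult tendsto_const)
    have "((\<lambda>t. cis (t * \<xi> $ j)) has_vector_derivative \<i> * of_real (\<xi> $ j)) (at 0)"
      unfolding has_vector_derivative_def
      by (auto intro!: derivative_eq_intros simp: scaleR_conv_of_real)
    from has_vector_derivative_seq[OF this h0 h(1)]
    show "(\<lambda>k. (cis (h k * \<xi> $ j) - 1) / of_real (h k)) \<longlonglongrightarrow> \<i> * of_real (\<xi> $ j)"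
      by simp
  qed
  show ?thesis
    unfolding fourier_def[of "partial_deriv j f"] by (rule LIMSEQ_unique[OF lim1[unfolded eq] lim2])
qed


text \<open>Induction on the power: |xi| is at most the sum of the |xi_j|, and xi_j times the
  transform is, up to a unimodular factor, the transform of the Schwartz function
  \<open>partial_deriv j f\<close>, to which the hypothesis for \<open>m\<close> applies.\<close>

lemma rapid_fourier:
  fixes f :: "real ^ 'n \<Rightarrow> complex"
  assumes "f \<in> schwartz"
  shows "rapid (fourier f)"
  unfolding rapid_def
proof
  fix m
  show "\<exists>B. \<forall>\<xi>. (1 + norm \<xi>) ^ m * norm (fourier f \<xi>) \<le> B"
    using assms
  proof (induction m arbitrary: f)
    case 0
    then show ?case using norm_fourier_le[OF schwartz_integrable] by fastforce
  next
    case (Suc m)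
    obtain B0 where B0: "\<And>\<xi>. (1 + norm \<xi>) ^ m * norm (fourier f \<xi>) \<le> B0"
      using Suc by meson
    have "\<forall>j. \<exists>B. \<forall>\<xi>. (1 + norm \<xi>) ^ m * norm (fourier (partial_deriv j f) \<xi>) \<le> B"
      using Suc schwartz_partial_deriv by blast
    then obtain B where B: "\<And>j \<xi>. (1 + norm \<xi>) ^ m * norm (fourier (partial_deriv j f) \<xi>) \<le> B j"
      by metis
    have "(1 + norm \<xi>) ^ Suc m * norm (fourier f \<xi>) \<le> B0 + (\<Sum>j\<in>UNIV. B j)" for \<xi>
    proof -
      let ?w = "(1 + norm \<xi>) ^ m * norm (fourier f \<xi>)"
      have "(1 + norm \<xi>) ^ Suc m * norm (fourier f \<xi>) = ?w + norm \<xi> * ?w"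
        by (simp add: algebra_simps)
      also have "\<dots> \<le> ?w + (\<Sum>j\<in>UNIV. \<bar>\<xi> $ j\<bar>) * ?w"
        by (intro add_left_mono mult_right_mono norm_le_l1_cart) auto
      also have "(\<Sum>j\<in>UNIV. \<bar>\<xi> $ j\<bar>) * ?w = (\<Sum>j\<in>UNIV. (1 + norm \<xi>) ^ m * norm (fourier (partial_deriv j f) \<xi>))"
        unfolding sum_distrib_right
        by (intro sum.cong refl) (simp add: fourier_partial_deriv[OF Suc.prems] norm_mult)
      also have "?w + \<dots> \<le> B0 + (\<Sum>j\<in>UNIV. B j)"
        by (intro add_mono B0 sum_mono B)
      finally show ?thesis .
    qed
    then show ?case by blast
  qed
qed

lemma schwartz_fourier:
  assumes "f \<in> schwartz"
  shows "fourier f \<in> schwartz"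
\<comment> \<open>The range of the transform is itself a stable family: differentiating a transform
  multiplies the original function by -i x_j.\<close>
proof (rule schwartzI[where C = "fourier ` schwartz"])
  fix g :: "real ^ 'a \<Rightarrow> complex" assume "g \<in> fourier ` schwartz"
  then obtain h where h: "g = fourier h" "h \<in> schwartz" by blast
  show "g differentiable (at x)" for x
    unfolding h(1) differentiable_def using fourier_has_derivative[OF h(2)] by blast
  show "partial_deriv i g \<in> fourier ` schwartz" for i
    unfolding h(1) fourier_coord[OF h(2)]
    by (intro imageI schwartz_cmult schwartz_coord h(2))
  show "rapid g" unfolding h(1) by (rule rapid_fourier[OF h(2)])
qed (use assms in simp)

lemma schwartz_inv_fourier:
  assumes "f \<in> schwartz"
  shows "inv_fourier f \<in> schwartz"
proof -
  have "inv_fourier f = (\<lambda>x. of_real (1 / (2 * pi) ^ CARD('a)) * fourier f (- x))"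
    by (rule ext) (rule inv_fourier_fourier_uminus)
  then show ?thesis
    using schwartz_cmult[OF schwartz_uminus[OF schwartz_fourier[OF assms]]] by (simp only:)
qed

section \<open>Gaussian integrals and transforms\<close>

lemma nn_integral_gauss_real:
  fixes a :: real
  assumes "0 < a"
  shows "(\<integral>\<^sup>+x. ennreal (exp (- a * x\<^sup>2)) \<partial>lborel) = ennreal ((pi / a) powr (1 / 2))"
proof -
  define \<sigma> where "\<sigma> = sqrt (1 / (2 * a))"
  have \<sigma>: "0 < \<sigma>" "2 * \<sigma>\<^sup>2 = 1 / a" using assms by (auto simp: \<sigma>_def)
  have "2 * pi * \<sigma>\<^sup>2 = pi / a" using \<sigma>(2) by (simp add: field_simps)
  then have nd: "exp (- a * x\<^sup>2) = sqrt (pi / a) * normal_density 0 \<sigma> x" for x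
  proof -
    have "x\<^sup>2 / (2 * \<sigma>\<^sup>2) = a * x\<^sup>2" unfolding \<sigma>(2) using assms by (simp add: field_simps)
    then show ?thesis
      unfolding normal_density_def \<open>2 * pi * \<sigma>\<^sup>2 = pi / a\<close> using assms by simp
  qed
  have "(\<integral>\<^sup>+x. ennreal (exp (- a * x\<^sup>2)) \<partial>lborel) = ennreal (LINT x|lborel. sqrt (pi / a) * normal_density 0 \<sigma> x)"
    unfolding nd using \<sigma>(1) assms by (intro nn_integral_eq_integral) auto
  also have "\<dots> = ennreal ((pi / a) powr (1 / 2))"
    using \<sigma>(1) assms by (simp add: powr_half_sqrt)
  finally show ?thesis .
qed

lemma integral_gauss:
  assumes "0 < a"
  shows "(LINT x|lborel. gauss a (x :: real ^ 'n)) = of_real ((pi / a) powr (CARD('n) / 2))"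
proof -
  have e: "exp (- a * (norm x)\<^sup>2) = (\<Prod>i\<in>UNIV. exp (- a * (x $ i)\<^sup>2))" for x :: "real ^ 'n"
  proof -
    have "(norm x)\<^sup>2 = (\<Sum>i\<in>UNIV. (x $ i)\<^sup>2)"
      unfolding power2_norm_eq_inner inner_vec_def by (simp add: power2_eq_square)
    then show ?thesis by (simp add: exp_sum[symmetric] sum_distrib_left sum_negf)
  qed
  have "(\<integral>\<^sup>+x. ennreal (exp (- a * (norm x)\<^sup>2)) \<partial>(lborel :: (real ^ 'n) measure)) = ennreal ((pi / a) powr (1 / 2)) ^ CARD('n)"
    unfolding e nn_integral_gauss_real[OF assms, symmetric] by (intro nn_integral_prod_vec) auto
  also have "\<dots> = ennreal ((pi / a) powr (CARD('n) / 2))"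
    using assms by (simp add: ennreal_power powr_power)
  finally have "(LINT x|lborel. exp (- a * (norm (x :: real ^ 'n))\<^sup>2)) = (pi / a) powr (CARD('n) / 2)"
    by (intro integral_eq_nn_integral[THEN trans]) auto
  then show ?thesis by (simp add: gauss_def)
qed

text \<open>The Gaussian solves a first order equation, so its transform \<open>?F\<close> has
  gradient -(xi / (2 a)) \<open>?F\<close>. Multiplied by \<open>gauss (- (1 / (4 * a)))\<close>,
  which is the growing exponential exp(|xi|^2 / (4 a)), it has derivative 0 and is constant; the
  value at 0 is the Gaussian integral.\<close>

lemma fourier_gauss:
  fixes \<xi> :: "real ^ 'n"
  assumes a: "0 < a"
  shows "fourier (gauss a) \<xi> = of_real ((pi / a) powr (CARD('n) / 2)) * gauss (1 / (4 * a)) \<xi>"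
proof -
  let ?F = "fourier (gauss a) :: real ^ 'n \<Rightarrow> complex"
  have co: "fourier (\<lambda>x. - \<i> * (of_real (x $ j) * gauss a x)) \<xi> = of_real (- (\<xi> $ j) / (2 * a)) * ?F \<xi>" for j \<xi>
  proof -
    have "partial_deriv j (gauss a) = (\<lambda>x :: real ^ 'n. of_real (- 2 * a) * (of_real (x $ j) * gauss a x))"
      by (intro ext partial_deriv_gauss)
    then have "of_real (- 2 * a) * fourier (\<lambda>x. of_real (x $ j) * gauss a x) \<xi> = \<i> * of_real (\<xi> $ j) * ?F \<xi>"
      using fourier_partial_deriv[OF schwartz_gauss[OF a], of j \<xi>] by (simp only: fourier_cmult)
    moreover have "of_real (2 * a) * (- \<i> * X) = \<i> * (of_real (- 2 * a) * X)" for X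
      by simp
    ultimately have "of_real (2 * a) * (- \<i> * fourier (\<lambda>x. of_real (x $ j) * gauss a x) \<xi>) = \<i> * (\<i> * of_real (\<xi> $ j) * ?F \<xi>)"
      by (simp only:)
    then have "of_real (2 * a) * fourier (\<lambda>x. - \<i> * (of_real (x $ j) * gauss a x)) \<xi> = - (of_real (\<xi> $ j) * ?F \<xi>)"
      by (simp only: fourier_cmult) (simp add: mult.assoc[symmetric])
    then show ?thesis using a by (simp add: field_simps)
  qed
  have D: "(?F has_derivative (\<lambda>h. of_real (- (\<xi> \<bullet> h) / (2 * a)) * ?F \<xi>)) (at \<xi>)" for \<xi>
  proof -
    have "(\<Sum>j\<in>UNIV. of_real (h $ j) * (of_real (- (\<xi> $ j) / (2 * a)) * ?F \<xi>)) = of_real (- (\<xi> \<bullet> h) / (2 * a)) * ?F \<xi>" for h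
      by (simp add: inner_vec_def sum_divide_distrib sum_negf sum_distrib_left sum_distrib_right mult_ac)
    then show ?thesis using fourier_has_derivative[OF schwartz_gauss[OF a], of \<xi>] by (simp only: co)
  qed
  have "((\<lambda>\<xi>. ?F \<xi> * gauss (- (1 / (4 * a))) \<xi>) has_derivative (\<lambda>h. 0)) (at \<xi> within UNIV)" for \<xi>
  proof -
    have "?F \<xi> * (of_real (- 2 * (- (1 / (4 * a))) * (\<xi> \<bullet> h)) * gauss (- (1 / (4 * a))) \<xi>) +
        (of_real (- (\<xi> \<bullet> h) / (2 * a)) * ?F \<xi>) * gauss (- (1 / (4 * a))) \<xi> = 0" for h
      using a by (simp add: field_simps)
    then show ?thesis
      using has_derivative_mult[OF D[of \<xi>] has_derivative_gauss[of "- (1 / (4 * a))" \<xi>]] by (simp only:)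
  qed
  from has_derivative_zero_constant[OF convex_UNIV this]
  obtain c where c: "\<And>\<xi>. ?F \<xi> * gauss (- (1 / (4 * a))) \<xi> = c"
    by blast
  have "?F 0 * gauss (- (1 / (4 * a))) 0 = of_real ((pi / a) powr (CARD('n) / 2))"
    using integral_gauss[OF a, where 'n = 'n] by (simp add: fourier_def gauss_def)
  from trans[OF trans[OF c[of \<xi>] sym[OF c[of 0]]] this]
  have "?F \<xi> * gauss (- (1 / (4 * a))) \<xi> * gauss (1 / (4 * a)) \<xi> = of_real ((pi / a) powr (CARD('n) / 2)) * gauss (1 / (4 * a)) \<xi>"
    by (simp only:)
  moreover have "gauss (- (1 / (4 * a))) \<xi> * gauss (1 / (4 * a)) \<xi> = 1"
    by (simp add: gauss_def exp_add[symmetric] flip: of_real_mult)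
  ultimately show ?thesis by (simp add: mult.assoc)
qed

section \<open>Fubini for kernels bounded by 1, and Fourier inversion\<close>

lemma borel_measurable_lborel_pair:
  fixes k :: "'a::euclidean_space \<Rightarrow> 'b::euclidean_space \<Rightarrow> 'c::topological_space"
  assumes "continuous_on UNIV (\<lambda>(x, y). k x y)"
  shows "(\<lambda>(x, y). k x y) \<in> borel_measurable (lborel \<Otimes>\<^sub>M lborel)"
  unfolding lborel_prod using assms by (simp add: borel_measurable_continuous_onI)

lemma integrable_kernel_product:
  fixes f :: "'a::euclidean_space \<Rightarrow> complex" and g :: "'b::euclidean_space \<Rightarrow> complex"
  assumes f: "integrable lborel f" and g: "integrable lborel g"
    and k: "(\<lambda>(x, y). k x y :: complex) \<in> borel_measurable (lborel \<Otimes>\<^sub>M lborel)" "\<And>x y. norm (k x y) \<le> 1"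
  shows "integrable (lborel \<Otimes>\<^sub>M lborel) (\<lambda>(x, y). k x y * (f x * g y))"
proof -
  have [measurable]: "f \<in> borel_measurable borel" "g \<in> borel_measurable borel" using f g by auto
  have base: "integrable (lborel \<Otimes>\<^sub>M lborel) (\<lambda>(x, y). f x * g y)"
  proof (rule lborel_pair.Fubini_integrable)
    show "integrable lborel (\<lambda>x. LINT y|lborel. norm (case (x, y) of (x, y) \<Rightarrow> f x * g y))"
      using f g by (simp add: norm_mult)
    show "AE x in lborel. integrable lborel (\<lambda>y. case (x, y) of (x, y) \<Rightarrow> f x * g y)"
      using g by auto
  qed measurable
  have bound: "norm (k x y * (f x * g y)) \<le> norm (f x * g y)" for x y
    unfolding norm_mult by (intro mult_left_le_one_le k(2)) auto
  have meas: "(\<lambda>(x, y). k x y * (f x * g y)) \<in> borel_measurable (lborel \<Otimes>\<^sub>M lborel)"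
  proof -
    have [measurable]: "(\<lambda>z. k (fst z) (snd z)) \<in> borel_measurable (lborel \<Otimes>\<^sub>M lborel)"
      using k(1) by (simp add: split_def)
    show ?thesis unfolding split_def by measurable
  qed
  show ?thesis
    by (rule Bochner_Integration.integrable_bound[OF base meas])
      (intro AE_I2, simp only: split_def bound)
qed

text \<open>Common source of the multiplication formulas for both transforms, of the convolution
  theorem and of the smoothing argument in \<open>schwartz_zero_imp_AE_zero\<close>.\<close>

lemma integral_kernel_swap:
  fixes f :: "'a::euclidean_space \<Rightarrow> complex" and g :: "'b::euclidean_space \<Rightarrow> complex"
  assumes f: "integrable lborel f" and g: "integrable lborel g"
    and k: "(\<lambda>(x, y). k x y :: complex) \<in> borel_measurable (lborel \<Otimes>\<^sub>M lborel)" "\<And>x y. norm (k x y) \<le> 1"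
  shows "(LINT y|lborel. (LINT x|lborel. k x y * f x) * g y) = (LINT x|lborel. f x * (LINT y|lborel. k x y * g y))"
proof -
  have "(LINT y|lborel. (LINT x|lborel. k x y * f x) * g y) = (LINT y|lborel. (LINT x|lborel. k x y * (f x * g y)))"
    by (simp flip: integral_mult_left_zero add: mult.assoc)
  also have "\<dots> = (LINT x|lborel. (LINT y|lborel. k x y * (f x * g y)))"
    by (rule lborel_pair.Fubini_integral[OF integrable_kernel_product[OF assms]])
  also have "\<dots> = (LINT x|lborel. f x * (LINT y|lborel. k x y * g y))"
    by (simp flip: integral_mult_right_zero add: mult_ac)
  finally show ?thesis .
qed

lemma fourier_swap:
  fixes f g :: "real ^ 'n \<Rightarrow> complex"
  assumes "integrable lborel f" "integrable lborel g"
  shows "(LINT \<xi>|lborel. fourier f \<xi> * g \<xi>) = (LINT x|lborel. f x * fourier g x)"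
proof -
  have "(LINT y|lborel. (LINT x|lborel. cis (- (x \<bullet> y)) * f x) * g y) = (LINT x|lborel. f x * (LINT y|lborel. cis (- (x \<bullet> y)) * g y))"
    by (rule integral_kernel_swap[OF assms borel_measurable_lborel_pair])
      (auto simp: split_def intro!: continuous_intros)
  then show ?thesis by (simp only: fourier_def inner_commute)
qed

lemma inv_fourier_swap:
  fixes f g :: "real ^ 'n \<Rightarrow> complex"
  assumes "integrable lborel f" "integrable lborel g"
  shows "(LINT \<xi>|lborel. inv_fourier f \<xi> * g \<xi>) = (LINT x|lborel. f x * inv_fourier g x)"
proof -
  have "(LINT y|lborel. (LINT x|lborel. cis (x \<bullet> y) * f x) * g y) = (LINT x|lborel. f x * (LINT y|lborel. cis (x \<bullet> y) * g y))"
    by (rule integral_kernel_swap[OF assms borel_measurable_lborel_pair])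
      (auto simp: split_def intro!: continuous_intros)
  moreover have "inv_fourier f y * g y = of_real (1 / (2 * pi) ^ CARD('n)) * ((LINT x|lborel. cis (x \<bullet> y) * f x) * g y)" for y
    unfolding inv_fourier_def inner_commute[of y] by (simp only: mult.assoc)
  moreover have "f x * inv_fourier g x = of_real (1 / (2 * pi) ^ CARD('n)) * (f x * (LINT y|lborel. cis (x \<bullet> y) * g y))" for x
    unfolding inv_fourier_def by (simp only: mult.left_commute)
  ultimately show ?thesis by (simp only: integral_mult_right_zero)
qed

lemma gauss_measurable[measurable]: "gauss a \<in> borel_measurable borel"
  unfolding gauss_def[abs_def] by measurable

text \<open>The substitution y = x + d w is already carried out: the Gaussian stays fixed and
  supplies the majorant, and only the argument of \<open>f\<close> moves. The Gaussian is not
  normalised, hence the factor pi^(n/2).\<close>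

lemma gauss_approximate_identity:
  fixes f :: "real ^ 'n \<Rightarrow> complex"
  assumes [measurable]: "f \<in> borel_measurable borel" and "isCont f x" and B: "\<And>y. norm (f y) \<le> B"
    and d: "d \<longlonglongrightarrow> 0"
  shows "(\<lambda>k. LINT w|lborel. gauss 1 w * f (x + d k *\<^sub>R w)) \<longlonglongrightarrow> of_real (pi powr (CARD('n) / 2)) * f x"
proof -
  have i: "integrable lborel (gauss 1 :: real ^ 'n \<Rightarrow> complex)"
    by (intro schwartz_integrable schwartz_gauss) simp
  have "(\<lambda>k. LINT w|lborel. gauss 1 w * f (x + d k *\<^sub>R w)) \<longlonglongrightarrow> (LINT w|lborel. gauss 1 (w :: real ^ 'n) * f x)"
  proof (rule integral_dominated_convergence[where w = "\<lambda>w :: real ^ 'n. norm (gauss 1 w) * B"])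
    show "integrable lborel (\<lambda>w :: real ^ 'n. norm (gauss 1 w) * B)"
      using i by simp
    show "AE w in lborel. (\<lambda>k. gauss 1 w * f (x + d k *\<^sub>R w)) \<longlonglongrightarrow> gauss 1 w * f x"
    proof (intro AE_I2 tendsto_mult tendsto_const)
      fix w
      have "(\<lambda>k. x + d k *\<^sub>R w) \<longlonglongrightarrow> x + 0 *\<^sub>R w"
        by (intro tendsto_intros d)
      then show "(\<lambda>k. f (x + d k *\<^sub>R w)) \<longlonglongrightarrow> f x"
        by (intro isCont_tendsto_compose[OF assms(2)]) simp
    qed
    show "AE w in lborel. norm (gauss 1 w * f (x + d k *\<^sub>R w)) \<le> norm (gauss 1 w) * B" for k
      using B by (auto simp: norm_mult intro!: mult_left_mono)
  qed auto
  then show ?thesis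
    using integral_gauss[of 1, where 'n = 'n] by simp
qed

lemma gauss_scaled_convolution:
  fixes f :: "real ^ 'n \<Rightarrow> complex"
  assumes [measurable]: "f \<in> borel_measurable borel" and d: "0 < d"
  shows "(LINT y|lborel. gauss (1 / d\<^sup>2) (y - x) * f y) = of_real (d ^ CARD('n)) * (LINT w|lborel. gauss 1 w * f (x + d *\<^sub>R w))"
proof -
  have "gauss (1 / d\<^sup>2) (d *\<^sub>R w) = gauss 1 w" for w :: "real ^ 'n"
    using d by (simp add: gauss_def power_mult_distrib)
  then show ?thesis
    using integral_lborel_affine[of "\<lambda>y. gauss (1 / d\<^sup>2) (y - x) * f y" d x] d
    by (simp add: scaleR_conv_of_real)
qed

lemma square_powr_half:
  fixes x :: real
  assumes "0 < x"
  shows "(x\<^sup>2) powr (real n / 2) = x ^ n"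
proof -
  have "(x powr 2) powr (real n / 2) = x ^ n"
    using assms by (simp only: powr_powr) (simp add: powr_realpow)
  then show ?thesis using assms by simp
qed

text \<open>The inversion integral is damped by a Gaussian. By the multiplication formula the damped
  integral is a Gaussian average of \<open>f\<close> around \<open>x\<close>, and both expressions
  have a limit as the damping vanishes.\<close>

lemma inv_fourier_fourier:
  fixes f :: "real ^ 'n \<Rightarrow> complex"
  assumes f: "f \<in> schwartz"
  shows "inv_fourier (fourier f) = f"
proof
  fix x
  define d where "d k = 1 / real (Suc k)" for k
  have d: "0 < d k" for k by (simp add: d_def)
  have d0: "d \<longlonglongrightarrow> 0" unfolding d_def by (rule LIMSEQ_Suc[OF lim_inverse_n'])
  have [measurable]: "f \<in> borel_measurable borel" by (rule schwartz_measurable[OF f])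
  have [measurable]: "fourier f \<in> borel_measurable borel" by (intro schwartz_measurable schwartz_fourier f)
  \<comment> \<open>The factor 1/4 makes the transform of \<open>gauss (?\<epsilon> k)\<close> a
    multiple of \<open>gauss (1 / (d k)\<^sup>2)\<close>, the shape that
    \<open>gauss_scaled_convolution\<close> expects.\<close>
  let ?\<epsilon> = "\<lambda>k. (d k)\<^sup>2 / 4"
  let ?I = "\<lambda>k. LINT \<xi>|lborel. cis (x \<bullet> \<xi>) * (gauss (?\<epsilon> k) \<xi> * fourier f \<xi>)"
  have lim1: "?I \<longlonglongrightarrow> (LINT \<xi>|lborel. cis (x \<bullet> \<xi>) * fourier f \<xi>)"
  proof (rule integral_dominated_convergence[where w = "\<lambda>\<xi>. norm (fourier f \<xi>)"])
    show "integrable lborel (\<lambda>\<xi>. norm (fourier f \<xi>))"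
      by (intro integrable_norm schwartz_integrable schwartz_fourier f)
    show "AE \<xi> in lborel. (\<lambda>k. cis (x \<bullet> \<xi>) * (gauss (?\<epsilon> k) \<xi> * fourier f \<xi>)) \<longlonglongrightarrow> cis (x \<bullet> \<xi>) * fourier f \<xi>"
    proof (intro AE_I2 tendsto_mult_left)
      fix \<xi> :: "real ^ 'n"
      have "(\<lambda>k. complex_of_real (exp (- ((d k)\<^sup>2 / 4) * (norm \<xi>)\<^sup>2))) \<longlonglongrightarrow> of_real (exp (- (0\<^sup>2 / 4) * (norm \<xi>)\<^sup>2))"
        by (intro tendsto_intros d0) auto
      then have "(\<lambda>k. gauss (?\<epsilon> k) \<xi> * fourier f \<xi>) \<longlonglongrightarrow> of_real (exp (- (0\<^sup>2 / 4) * (norm \<xi>)\<^sup>2)) * fourier f \<xi>"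
        unfolding gauss_def by (intro tendsto_mult_right)
      then show "(\<lambda>k. gauss (?\<epsilon> k) \<xi> * fourier f \<xi>) \<longlonglongrightarrow> fourier f \<xi>" by simp
    qed
    show "AE \<xi> in lborel. norm (cis (x \<bullet> \<xi>) * (gauss (?\<epsilon> k) \<xi> * fourier f \<xi>)) \<le> norm (fourier f \<xi>)" for k
      by (auto simp: norm_mult gauss_def intro!: mult_left_le_one_le)
  qed auto
  have I: "?I k = of_real ((4 * pi) powr (CARD('n) / 2)) * (LINT w|lborel. gauss 1 w * f (x + d k *\<^sub>R w))" for k
  proof -
    have e: "0 < ?\<epsilon> k" using d[of k] by simp
    have ig: "integrable lborel (gauss (?\<epsilon> k) :: real ^ 'n \<Rightarrow> complex)"
      by (intro schwartz_integrable schwartz_gauss e)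
    have "?I k = (LINT \<xi>|lborel. fourier f \<xi> * (cis (x \<bullet> \<xi>) * gauss (?\<epsilon> k) \<xi>))"
      by (simp add: mult_ac)
    also have "\<dots> = (LINT y|lborel. f y * fourier (\<lambda>\<xi>. cis (x \<bullet> \<xi>) * gauss (?\<epsilon> k) \<xi>) y)"
      by (intro fourier_swap schwartz_integrable f integrable_cis_mult schwartz_gauss e) auto
    also have "\<dots> = (LINT y|lborel. f y * fourier (gauss (?\<epsilon> k)) (y - x))"
    proof -
      have "fourier (\<lambda>\<xi>. cis (x \<bullet> \<xi>) * gauss (?\<epsilon> k) \<xi>) y = fourier (gauss (?\<epsilon> k)) (y - x)" for y
        unfolding fourier_def mult.assoc[symmetric] cis_mult
        by (simp add: inner_diff_right inner_commute)
      then show ?thesis by simp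
    qed
    also have "\<dots> = of_real ((pi / ?\<epsilon> k) powr (CARD('n) / 2)) * (LINT y|lborel. gauss (1 / (d k)\<^sup>2) (y - x) * f y)"
    proof -
      have "f y * fourier (gauss (?\<epsilon> k)) (y - x) =
          of_real ((pi / ?\<epsilon> k) powr (CARD('n) / 2)) * (gauss (1 / (d k)\<^sup>2) (y - x) * f y)" for y
        unfolding fourier_gauss[OF e] by (simp add: mult_ac)
      then show ?thesis by (simp only: integral_mult_right_zero)
    qed
    also have "\<dots> = of_real ((pi / ?\<epsilon> k) powr (CARD('n) / 2) * d k ^ CARD('n)) * (LINT w|lborel. gauss 1 w * f (x + d k *\<^sub>R w))"
      by (subst gauss_scaled_convolution) (use d in simp_all)
    also have "(pi / ?\<epsilon> k) powr (CARD('n) / 2) * d k ^ CARD('n) = (4 * pi) powr (CARD('n) / 2)"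
    proof -
      have "d k ^ CARD('n) = ((d k)\<^sup>2) powr (CARD('n) / 2)"
        using d[of k] by (simp only: square_powr_half)
      then show ?thesis using d[of k] by (simp add: powr_mult[symmetric] mult.commute)
    qed
    finally show ?thesis .
  qed
  have lim2: "(\<lambda>k. LINT w|lborel. gauss 1 w * f (x + d k *\<^sub>R w)) \<longlonglongrightarrow> of_real (pi powr (CARD('n) / 2)) * f x"
  proof -
    obtain B where "0 \<le> B" "\<And>y. norm (f y) \<le> B * weight y" using rapid_le_weight[OF schwartz_rapid[OF f]] by metis
    then have "norm (f y) \<le> B" for y using weight_le_1[of y] by (meson mult_left_le order_trans)
    then show ?thesis
      by (intro gauss_approximate_identity d0)
        (auto intro: differentiable_imp_continuous_within schwartz_differentiable f)
  qed
  have "(LINT \<xi>|lborel. cis (x \<bullet> \<xi>) * fourier f \<xi>) = of_real ((4 * pi) powr (CARD('n) / 2)) * (of_real (pi powr (CARD('n) / 2)) * f x)"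
    by (rule LIMSEQ_unique[OF lim1[unfolded I] tendsto_mult_left[OF lim2]])
  \<comment> \<open>The constants from the transform of the Gaussian and from its integral combine
    to (2 pi)^n, which cancels the normalisation of \<open>inv_fourier\<close>.\<close>
  moreover have "(4 * pi) powr (CARD('n) / 2) * pi powr (CARD('n) / 2) = (2 * pi) ^ CARD('n)"
  proof -
    have "(4 * pi) powr (CARD('n) / 2) * pi powr (CARD('n) / 2) = ((2 * pi)\<^sup>2) powr (CARD('n) / 2)"
      by (simp add: powr_mult[symmetric] power2_eq_square mult.assoc)
    also have "\<dots> = (2 * pi) ^ CARD('n)" by (rule square_powr_half) simp
    finally show ?thesis .
  qed
  ultimately show "inv_fourier (fourier f) x = f x"
    unfolding inv_fourier_def by (simp flip: of_real_mult mult.assoc)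
qed

lemma fourier_inv_fourier:
  fixes f :: "real ^ 'n \<Rightarrow> complex"
  assumes f: "f \<in> schwartz"
  shows "fourier (inv_fourier f) = f"
proof
  fix \<xi>
  have "fourier (inv_fourier f) \<xi> = of_real (1 / (2 * pi) ^ CARD('n)) * fourier (\<lambda>x. fourier f (- x)) \<xi>"
    unfolding fourier_cmult[symmetric] inv_fourier_fourier_uminus ..
  also have "fourier (\<lambda>x. fourier f (- x)) \<xi> = fourier (fourier f) (- \<xi>)"
    by (intro fourier_uminus schwartz_measurable schwartz_fourier f)
  finally show "fourier (inv_fourier f) \<xi> = f \<xi>"
    using inv_fourier_fourier[OF f] inv_fourier_fourier_uminus by metis
qed

subsection \<open>The modular of \<open>L\<^sup>p\<close>\<close>

text \<open>The p-th power of the norm, valued in \<open>ennreal\<close>: Tonelli and Fatou apply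
  directly, and estimates can be stated before finiteness is known. The triangle inequality is
  replaced by the factor \<open>2 powr p\<close> of \<open>Lp_mod_add_le\<close>.\<close>

definition Lp_mod :: "real \<Rightarrow> (real ^ 'n \<Rightarrow> complex) \<Rightarrow> ennreal" where
  "Lp_mod p f = (\<integral>\<^sup>+x. ennreal (norm (f x) powr p) \<partial>lborel)"

lemma Lp_space_iff: "f \<in> Lp_space p \<longleftrightarrow> f \<in> borel_measurable borel \<and> Lp_mod p f < \<infinity>"
  unfolding Lp_space_def Lp_mod_def by (auto simp: integrable_iff_bounded)

lemma Lp_mod_eq_Lp_norm:
  assumes "f \<in> Lp_space p" "0 < p"
  shows "Lp_mod p f = ennreal (Lp_norm p f powr p)"
proof -
  have i: "integrable lborel (\<lambda>x. norm (f x) powr p)" using assms by (simp add: Lp_space_def)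
  then have "Lp_mod p f = ennreal (LINT x|lborel. norm (f x) powr p)"
    unfolding Lp_mod_def by (intro nn_integral_eq_integral) auto
  moreover have "0 \<le> (LINT x|lborel. norm (f x) powr p)" by simp
  ultimately show ?thesis
    using assms(2) by (simp add: Lp_norm_def powr_powr)
qed

lemma Lp_mod_cong_AE: "(AE x in lborel. f x = g x) \<Longrightarrow> Lp_mod p f = Lp_mod p g"
  unfolding Lp_mod_def by (intro nn_integral_cong_AE) auto

lemma Lp_mod_minus_commute: "Lp_mod p (\<lambda>x. f x - g x) = Lp_mod p (\<lambda>x. g x - f x)"
  unfolding Lp_mod_def by (simp add: norm_minus_commute)

lemma norm_add_powr_le:
  fixes a b :: "'a::real_normed_vector"
  assumes "0 \<le> p"
  shows "norm (a + b) powr p \<le> 2 powr p * (norm a powr p + norm b powr p)"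
proof -
  let ?m = "max (norm a) (norm b)"
  have "norm (a + b) powr p \<le> (2 * ?m) powr p"
    by (intro powr_mono2 assms order_trans[OF norm_triangle_ineq]) auto
  also have "\<dots> = 2 powr p * ?m powr p" by (simp add: powr_mult)
  also have "?m powr p \<le> norm a powr p + norm b powr p"
    by (cases "norm a \<le> norm b") (auto simp: max_def)
  finally show ?thesis by simp
qed

lemma Lp_mod_add_le:
  assumes [measurable]: "f \<in> borel_measurable borel" "g \<in> borel_measurable borel" and "0 \<le> p"
  shows "Lp_mod p (\<lambda>x. f x + g x) \<le> ennreal (2 powr p) * (Lp_mod p f + Lp_mod p g)"
proof -
  have "Lp_mod p (\<lambda>x. f x + g x) \<le>
      (\<integral>\<^sup>+x. ennreal (2 powr p) * (ennreal (norm (f x) powr p) + ennreal (norm (g x) powr p)) \<partial>lborel)"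
    unfolding Lp_mod_def using norm_add_powr_le[OF assms(3)]
    by (intro nn_integral_mono) (simp flip: ennreal_plus ennreal_mult)
  also have "\<dots> = ennreal (2 powr p) * (Lp_mod p f + Lp_mod p g)"
    unfolding Lp_mod_def by (simp add: nn_integral_cmult nn_integral_add)
  finally show ?thesis .
qed

lemma Lp_mod_cmult:
  assumes [measurable]: "f \<in> borel_measurable borel"
  shows "Lp_mod p (\<lambda>x. c * f x) = ennreal (norm c powr p) * Lp_mod p f"
  unfolding Lp_mod_def by (simp add: norm_mult powr_mult ennreal_mult nn_integral_cmult)

lemma Lp_mod_triangle:
  assumes "f \<in> borel_measurable borel" "g \<in> borel_measurable borel" "h \<in> borel_measurable borel" "0 \<le> p"
  shows "Lp_mod p (\<lambda>x. f x - h x) \<le> ennreal (2 powr p) * (Lp_mod p (\<lambda>x. f x - g x) + Lp_mod p (\<lambda>x. g x - h x))"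
  using Lp_mod_add_le[of "\<lambda>x. f x - g x" "\<lambda>x. g x - h x" p] assms by simp

lemma Lp_mod_rapid:
  fixes f :: "real ^ 'n \<Rightarrow> complex"
  assumes "f \<in> borel_measurable borel" "rapid f" "1 \<le> p"
  shows "Lp_mod p f < \<infinity>"
proof -
  obtain B where B: "0 \<le> B" "\<And>x. norm (f x) \<le> B * weight x" using rapid_le_weight[OF assms(2)] by metis
  have le: "norm (f x) powr p \<le> B powr p * weight x" for x
  proof -
    have "norm (f x) powr p \<le> (B * weight x) powr p" using B assms(3) by (intro powr_mono2) auto
    also have "\<dots> = B powr p * weight x powr p" using B weight_pos[of x] by (simp add: powr_mult)
    also have "weight x powr p \<le> weight x powr 1"
      using weight_pos[of x] weight_le_1[of x] assms(3) by (intro powr_mono') auto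
    finally show ?thesis using weight_pos[of x] by (simp add: mult_left_mono)
  qed
  have "Lp_mod p f \<le> (\<integral>\<^sup>+x. ennreal (B powr p * weight (x :: real ^ 'n)) \<partial>lborel)"
    unfolding Lp_mod_def by (intro nn_integral_mono ennreal_leI le)
  also have "\<dots> = ennreal (LINT x|lborel. B powr p * weight (x :: real ^ 'n))"
    by (intro nn_integral_eq_integral integrable_mult_right integrable_weight) simp
  also have "\<dots> < \<infinity>" by simp
  finally show ?thesis .
qed

section \<open>Pairing L^p functions with rapidly decreasing ones\<close>

text \<open>A substitute for Hoelder's inequality: values up to the threshold \<open>d\<close> are
  counted by \<open>d\<close>, and for h > d one has h <= d^(1-p) h^p. Keeping \<open>d\<close> free
  lets the first part be made small.\<close>

lemma le_add_powr:
  fixes h d :: real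
  assumes "0 \<le> h" "0 < d" "1 \<le> p"
  shows "h \<le> d + d powr (1 - p) * h powr p"
proof (cases "h \<le> d")
  case False
  then have "0 < h" "d < h" using assms by auto
  then have "(h / d) powr 0 \<le> (h / d) powr (p - 1)" using assms by (intro powr_mono) auto
  then have "1 \<le> h powr (p - 1) * d powr (1 - p)"
    using \<open>0 < h\<close> assms by (simp add: powr_divide powr_diff field_simps)
  then have "h * 1 \<le> h * (h powr (p - 1) * d powr (1 - p))"
    using \<open>0 < h\<close> by (intro mult_left_mono) auto
  also have "\<dots> = d powr (1 - p) * h powr p" using \<open>0 < h\<close> by (simp add: powr_diff field_simps)
  finally show ?thesis using assms by simp
qed (simp add: add_increasing2)

definition weight_mass :: "'n::finite itself \<Rightarrow> real" where
  "weight_mass _ = (LINT x|lborel. weight (x :: real ^ 'n))"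

lemma nn_integral_mult_weight_le:
  fixes h \<psi> :: "real ^ 'n \<Rightarrow> complex"
  assumes [measurable]: "h \<in> borel_measurable borel" and "1 \<le> p" "0 < d"
    and B: "0 \<le> B" "\<And>x. norm (\<psi> x) \<le> B * weight x"
  shows "(\<integral>\<^sup>+x. ennreal (norm (h x * \<psi> x)) \<partial>lborel) \<le>
    ennreal B * (ennreal (d * weight_mass TYPE('n)) + ennreal (d powr (1 - p)) * Lp_mod p h)"
proof -
  have le: "norm (h x * \<psi> x) \<le> B * (d * weight x + d powr (1 - p) * norm (h x) powr p)" for x
  proof -
    have "norm (h x * \<psi> x) \<le> norm (h x) * (B * weight x)"
      unfolding norm_mult by (intro mult_left_mono B) auto
    also have "\<dots> \<le> (d + d powr (1 - p) * norm (h x) powr p) * (B * weight x)"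
      using B weight_pos[of x] assms by (intro mult_right_mono le_add_powr) auto
    also have "\<dots> = B * (d * weight x + d powr (1 - p) * norm (h x) powr p * weight x)"
      by (simp add: algebra_simps)
    also have "\<dots> \<le> B * (d * weight x + d powr (1 - p) * norm (h x) powr p)"
      using B weight_le_1[of x] by (intro mult_left_mono add_left_mono mult_right_le_one_le) (auto simp: weight_pos less_imp_le)
    finally show ?thesis .
  qed
  have "(\<integral>\<^sup>+x. ennreal (norm (h x * \<psi> x)) \<partial>lborel) \<le>
      (\<integral>\<^sup>+x. ennreal B * (ennreal d * ennreal (weight x) + ennreal (d powr (1 - p)) * ennreal (norm (h x) powr p)) \<partial>lborel)"
  proof (rule nn_integral_mono)
    fix x
    have "ennreal B * (ennreal d * ennreal (weight x) + ennreal (d powr (1 - p)) * ennreal (norm (h x) powr p)) =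
        ennreal (B * (d * weight x + d powr (1 - p) * norm (h x) powr p))"
      using B(1) assms(3) by (simp add: ennreal_mult ennreal_plus)
    then show "ennreal (norm (h x * \<psi> x)) \<le>
        ennreal B * (ennreal d * ennreal (weight x) + ennreal (d powr (1 - p)) * ennreal (norm (h x) powr p))"
      using ennreal_leI[OF le[of x]] by (simp only:)
  qed
  also have "\<dots> = ennreal B * (ennreal d * (\<integral>\<^sup>+x. ennreal (weight (x :: real ^ 'n)) \<partial>lborel) + ennreal (d powr (1 - p)) * Lp_mod p h)"
    unfolding Lp_mod_def by (simp add: nn_integral_cmult nn_integral_add)
  also have "(\<integral>\<^sup>+x. ennreal (weight (x :: real ^ 'n)) \<partial>lborel) = ennreal (weight_mass TYPE('n))"
    unfolding weight_mass_def by (intro nn_integral_eq_integral integrable_weight) simp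
  finally show ?thesis using assms by (simp add: ennreal_mult')
qed

lemma integrable_Lp_mult:
  fixes h \<psi> :: "real ^ 'n \<Rightarrow> complex"
  assumes [measurable]: "h \<in> borel_measurable borel" "\<psi> \<in> borel_measurable borel"
    and "1 \<le> p" "Lp_mod p h < \<infinity>" and B: "0 \<le> B" "\<And>x. norm (\<psi> x) \<le> B * weight x"
  shows "integrable lborel (\<lambda>x. h x * \<psi> x)"
proof (rule integrableI_bounded)
  show "(\<integral>\<^sup>+x. ennreal (norm (h x * \<psi> x)) \<partial>lborel) < \<infinity>"
    by (rule order_le_less_trans[OF nn_integral_mult_weight_le[OF assms(1,3) zero_less_one B]])
      (use assms(4) in \<open>simp add: ennreal_mult_less_top ennreal_add_eq_top less_top\<close>)
qed measurable

lemma integrable_Lp_schwartz: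
  assumes "h \<in> borel_measurable borel" "1 \<le> p" "Lp_mod p h < \<infinity>" "\<psi> \<in> schwartz"
  shows "integrable lborel (\<lambda>x. h x * \<psi> x)"
  using rapid_le_weight[OF schwartz_rapid[OF assms(4)]] integrable_Lp_mult[OF assms(1) _ assms(2,3)]
    schwartz_measurable[OF assms(4)] by metis

text \<open>The threshold \<open>d\<close> is chosen first and makes the part controlled by
  \<open>weight\<close> small uniformly in \<open>k\<close>; the modular, multiplied by the now
  fixed \<open>d powr (1 - p)\<close>, is small for large \<open>k\<close>.\<close>

lemma Lp_mod_tendsto_zero_weak:
  fixes h :: "nat \<Rightarrow> real ^ 'n \<Rightarrow> complex"
  assumes m: "\<And>k. h k \<in> borel_measurable borel" and p: "1 \<le> p"
    and lim: "(\<lambda>k. Lp_mod p (h k)) \<longlonglongrightarrow> 0" and \<psi>: "\<psi> \<in> schwartz"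
  shows "(\<lambda>k. LINT x|lborel. h k x * \<psi> x) \<longlonglongrightarrow> 0"
proof (rule tendsto_norm_zero_cancel, rule LIMSEQ_I)
  fix \<epsilon> :: real assume "0 < \<epsilon>"
  obtain B where B: "0 \<le> B" "\<And>x. norm (\<psi> x) \<le> B * weight x"
    using rapid_le_weight[OF schwartz_rapid[OF \<psi>]] by metis
  let ?W = "weight_mass TYPE('n)"
  have W: "0 \<le> ?W" unfolding weight_mass_def using weight_pos by (intro integral_nonneg_AE) (auto simp: less_imp_le)
  \<comment> \<open>\<open>d\<close> and \<open>\<eta>\<close> bound each of the two summands by
    epsilon / (4 (B + 1)), so that after multiplication by \<open>B\<close> at most epsilon / 2
    remains. The added ones prevent division by zero.\<close>
  define d where "d = \<epsilon> / (4 * (B + 1) * (?W + 1))"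
  have d: "0 < d" using \<open>0 < \<epsilon>\<close> B W by (simp add: d_def)
  define \<eta> where "\<eta> = \<epsilon> / (4 * (B + 1) * d powr (1 - p))"
  have \<eta>: "0 < \<eta>" using \<open>0 < \<epsilon>\<close> B d by (simp add: \<eta>_def)
  have "B * (d * ?W + d powr (1 - p) * \<eta>) < \<epsilon>"
  proof -
    have canc: "\<epsilon> / (k * c) * c = \<epsilon> / k" if "c \<noteq> 0" for k c :: real using that by simp
    have "d * ?W \<le> d * (?W + 1)" using d by simp
    also have "\<dots> = \<epsilon> / (4 * (B + 1))" unfolding d_def by (rule canc) (use W in simp)
    finally have 1: "d * ?W \<le> \<epsilon> / (4 * (B + 1))" .
    have "\<eta> * d powr (1 - p) = \<epsilon> / (4 * (B + 1))" unfolding \<eta>_def by (rule canc) (use d in simp)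
    then have 2: "d powr (1 - p) * \<eta> = \<epsilon> / (4 * (B + 1))" by (simp only: mult.commute)
    have q: "\<epsilon> / (4 * (B + 1)) * (B + 1) = \<epsilon> / 4" by (rule canc) (use B in simp)
    have q0: "0 \<le> \<epsilon> / (4 * (B + 1))" using B(1) \<open>0 < \<epsilon>\<close> by simp
    have "B * (d * ?W + d powr (1 - p) * \<eta>) \<le> B * (\<epsilon> / (4 * (B + 1)) + \<epsilon> / (4 * (B + 1)))"
      using 1 2 by (intro mult_left_mono[OF _ B(1)]) simp
    also have "\<dots> \<le> 2 * (\<epsilon> / (4 * (B + 1)) * (B + 1))"
    proof -
      have "B * (q + q) \<le> 2 * (q * (B + 1))" if "0 \<le> q" for q using that by (simp add: algebra_simps)
      then show ?thesis using q0 .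
    qed
    also have "\<dots> < \<epsilon>" unfolding q using \<open>0 < \<epsilon>\<close> by simp
    finally show ?thesis .
  qed
  have "\<forall>\<^sub>F k in sequentially. Lp_mod p (h k) < ennreal \<eta>"
    using order_tendstoD(2)[OF lim, of "ennreal \<eta>"] \<eta> by simp
  then obtain N where N: "\<And>k. N \<le> k \<Longrightarrow> Lp_mod p (h k) < ennreal \<eta>"
    unfolding eventually_sequentially by blast
  show "\<exists>no. \<forall>k\<ge>no. norm (norm (LINT x|lborel. h k x * \<psi> x) - 0) < \<epsilon>"
  proof (intro exI allI impI)
    fix k assume k: "N \<le> k"
    have "ennreal (norm (LINT x|lborel. h k x * \<psi> x)) \<le> (\<integral>\<^sup>+x. ennreal (norm (h k x * \<psi> x)) \<partial>lborel)"
      using N[OF k] by (intro integral_norm_bound_ennreal integrable_Lp_schwartz[OF m p _ \<psi>])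
        (metis ennreal_less_top infinity_ennreal_def order_less_trans)
    also have "\<dots> \<le> ennreal B * (ennreal (d * ?W) + ennreal (d powr (1 - p)) * Lp_mod p (h k))"
      by (rule nn_integral_mult_weight_le[OF m p d B])
    also have "\<dots> \<le> ennreal B * (ennreal (d * ?W) + ennreal (d powr (1 - p)) * ennreal \<eta>)"
      using N[OF k] by (intro mult_left_mono add_left_mono) (auto simp: less_imp_le)
    also have "\<dots> = ennreal (B * (d * ?W + d powr (1 - p) * \<eta>))"
      using B d W \<eta> by (simp flip: ennreal_plus ennreal_mult)
    finally have "norm (LINT x|lborel. h k x * \<psi> x) \<le> B * (d * ?W + d powr (1 - p) * \<eta>)"
      using B d W \<eta> by (subst (asm) ennreal_le_iff) auto
    then show "norm (norm (LINT x|lborel. h k x * \<psi> x) - 0) < \<epsilon>"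
      using \<open>B * (d * ?W + d powr (1 - p) * \<eta>) < \<epsilon>\<close> by simp
  qed
qed

text \<open>Riesz-Fischer with a fast subsequence. Summing 2^(p i) |D_i|^p instead of |D_i| gives
  almost everywhere convergence by exchanging a sum of nonnegative terms with the integral, without
  Minkowski's inequality; Fatou's lemma carries the Cauchy estimate to the limit.\<close>

lemma Lp_mod_complete:
  fixes f :: "nat \<Rightarrow> real ^ 'n \<Rightarrow> complex"
  assumes m[measurable]: "\<And>k. f k \<in> borel_measurable borel" and p: "1 \<le> p"
    and cauchy: "\<And>e::real. 0 < e \<Longrightarrow> \<exists>N. \<forall>j\<ge>N. \<forall>k\<ge>N. Lp_mod p (\<lambda>x. f j x - f k x) \<le> ennreal e"
  shows "\<exists>g. g \<in> borel_measurable borel \<and> (\<lambda>k. Lp_mod p (\<lambda>x. f k x - g x)) \<longlonglongrightarrow> 0"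
proof -
  \<comment> \<open>The factor \<open>2 powr (- (p * real i))\<close> pays for the weight 2^(p i)
    used below, and (1/2)^i leaves a convergent series.\<close>
  let ?e = "\<lambda>i::nat. (1 / 2) ^ i * 2 powr (- (p * real i))"
  have "\<exists>N. \<forall>j\<ge>N. \<forall>k\<ge>N. Lp_mod p (\<lambda>x. f j x - f k x) \<le> ennreal (?e i)" for i
    by (rule cauchy) simp
  then obtain N0 where N0: "\<And>i j k. N0 i \<le> j \<Longrightarrow> N0 i \<le> k \<Longrightarrow> Lp_mod p (\<lambda>x. f j x - f k x) \<le> ennreal (?e i)"
    by metis
  \<comment> \<open>The partial sums make \<open>N\<close> monotone and at least \<open>N0\<close>;
    the summand \<open>i\<close> makes it tend to infinity.\<close>
  define N where "N i = i + (\<Sum>l\<le>i. N0 l)" for i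
  have N: "N0 i \<le> N i" "N i \<le> N (Suc i)" "i \<le> N i" for i
    unfolding N_def by (auto intro: trans_le_add2 member_le_sum)
  have "N0 i \<le> N (Suc i)" for i using N order_trans by blast
  define D where "D i x = f (N (Suc i)) x - f (N i) x" for i x
  have [measurable]: "D i \<in> borel_measurable borel" for i unfolding D_def by measurable
  have D: "Lp_mod p (D i) \<le> ennreal (?e i)" for i
    unfolding D_def by (rule N0) fact+
  have "(\<integral>\<^sup>+x. (\<Sum>i. ennreal (2 powr (p * real i) * norm (D i x) powr p)) \<partial>lborel) =
      (\<Sum>i. ennreal (2 powr (p * real i)) * Lp_mod p (D i))"
    unfolding Lp_mod_def by (simp add: nn_integral_suminf nn_integral_cmult ennreal_mult)
  also have "\<dots> \<le> (\<Sum>i. ennreal ((1 / 2) ^ i))"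
  proof (intro suminf_le)
    fix i
    have "ennreal (2 powr (p * real i)) * Lp_mod p (D i) \<le> ennreal (2 powr (p * real i)) * ennreal (?e i)"
      by (intro mult_left_mono D) simp
    also have "\<dots> = ennreal ((1 / 2) ^ i)"
      by (subst ennreal_mult[symmetric]) (auto simp: powr_add[symmetric] mult.left_commute)
    finally show "ennreal (2 powr (p * real i)) * Lp_mod p (D i) \<le> ennreal ((1 / 2) ^ i)" .
  qed auto
  also have "\<dots> = ennreal (\<Sum>i. (1 / 2) ^ i)"
    by (intro suminf_ennreal2) (auto simp: summable_geometric)
  also have "\<dots> < \<infinity>" by simp
  finally have "AE x in lborel. (\<Sum>i. ennreal (2 powr (p * real i) * norm (D i x) powr p)) \<noteq> \<infinity>"
    by (intro nn_integral_noteq_infinite) auto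
  then have conv: "AE x in lborel. convergent (\<lambda>i. f (N i) x)"
  proof eventually_elim
    case (elim x)
    then have "summable (\<lambda>i. 2 powr (p * real i) * norm (D i x) powr p)"
      by (intro summable_suminf_not_top) auto
    then have "(\<lambda>i. 2 powr (p * real i) * norm (D i x) powr p) \<longlonglongrightarrow> 0" by (rule summable_LIMSEQ_zero)
    then have "\<forall>\<^sub>F i in sequentially. 2 powr (p * real i) * norm (D i x) powr p < 1"
      by (rule order_tendstoD) simp
    then have ev: "\<forall>\<^sub>F i in sequentially. norm (D i x) \<le> (1 / 2) ^ i"
    proof eventually_elim
      case (elim i)
      have "(2 powr real i * norm (D i x)) powr p = 2 powr (p * real i) * norm (D i x) powr p"
        by (simp add: powr_mult powr_powr mult.commute)
      then have "\<not> 1 \<le> 2 powr real i * norm (D i x)"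
        using elim p ge_one_powr_ge_zero[of "2 powr real i * norm (D i x)" p] by auto
      then show ?case by (simp add: powr_realpow power_one_over field_simps)
    qed
    have "summable (\<lambda>i. D i x)"
      by (rule summable_comparison_test_ev[OF ev]) (simp add: summable_geometric)
    then have "convergent (\<lambda>n. \<Sum>i<n. D i x)" by (simp add: summable_iff_convergent)
    then have "convergent (\<lambda>n. (\<Sum>i<n. D i x) + f (N 0) x)" by (simp add: convergent_add_const_right_iff)
    moreover have "(\<Sum>i<n. D i x) + f (N 0) x = f (N n) x" for n
      unfolding D_def using sum_lessThan_telescope[of "\<lambda>i. f (N i) x" n] by simp
    ultimately show ?case by simp
  qed
  define g where "g x = lim (\<lambda>i. f (N i) x)" for x
  have [measurable]: "g \<in> borel_measurable borel" unfolding g_def by measurable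
  have "(\<lambda>k. Lp_mod p (\<lambda>x. f k x - g x)) \<longlonglongrightarrow> 0"
  proof (rule tendsto_zero_ennreal)
    fix r :: real assume "0 < r"
    then obtain M where M: "\<And>j k. M \<le> j \<Longrightarrow> M \<le> k \<Longrightarrow> Lp_mod p (\<lambda>x. f j x - f k x) \<le> ennreal (r / 2)"
      using cauchy[of "r / 2"] by auto
    have "Lp_mod p (\<lambda>x. f k x - g x) < ennreal r" if k: "M \<le> k" for k
    proof -
      have "Lp_mod p (\<lambda>x. f k x - g x) \<le> (\<integral>\<^sup>+x. liminf (\<lambda>i. ennreal (norm (f k x - f (N i) x) powr p)) \<partial>lborel)"
        unfolding Lp_mod_def
      proof (rule nn_integral_mono_AE)
        show "AE x in lborel. ennreal (norm (f k x - g x) powr p) \<le> liminf (\<lambda>i. ennreal (norm (f k x - f (N i) x) powr p))"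
          using conv
        proof eventually_elim
          case (elim x)
          then have "(\<lambda>i. f (N i) x) \<longlonglongrightarrow> g x" unfolding g_def by (rule convergent_LIMSEQ_iff[THEN iffD1])
          then have "(\<lambda>i. ennreal (norm (f k x - f (N i) x) powr p)) \<longlonglongrightarrow> ennreal (norm (f k x - g x) powr p)"
            using p by (intro tendsto_ennrealI tendsto_powr' tendsto_norm tendsto_diff tendsto_const) auto
          from lim_imp_Liminf[OF sequentially_bot this] show ?case by simp
        qed
      qed
      also have "\<dots> \<le> liminf (\<lambda>i. Lp_mod p (\<lambda>x. f k x - f (N i) x))"
        unfolding Lp_mod_def by (rule nn_integral_liminf) measurable
      also have "\<dots> \<le> liminf (\<lambda>i :: nat. ennreal (r / 2))"
      proof (rule Liminf_mono)
        show "\<forall>\<^sub>F i in sequentially. Lp_mod p (\<lambda>x. f k x - f (N i) x) \<le> ennreal (r / 2)"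
          using eventually_ge_at_top[of M] by eventually_elim (rule M[OF k], use N(3) order_trans in blast)
      qed
      also have "\<dots> = ennreal (r / 2)" by (simp add: Liminf_const)
      also have "\<dots> < ennreal r" using \<open>0 < r\<close> by (simp add: ennreal_lessI)
      finally show ?thesis .
    qed
    then show "\<forall>\<^sub>F k in sequentially. Lp_mod p (\<lambda>x. f k x - g x) < ennreal r"
      unfolding eventually_sequentially by blast
  qed
  then show ?thesis using \<open>g \<in> borel_measurable borel\<close> by blast
qed

subsection \<open>Functions as tempered distributions\<close>

lemma schwartz_seminorm_bound:
  assumes "\<phi> \<in> schwartz"
  shows "(1 + norm x) ^ m * norm (iter_partial_deriv is \<phi> x) \<le> schwartz_seminorm m is \<phi>"
  unfolding schwartz_seminorm_def by (rule cSUP_upper[OF UNIV_I schwartz_bdd[OF assms]])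

lemma schwartz_seminorm_nonneg:
  assumes "\<phi> \<in> schwartz"
  shows "0 \<le> schwartz_seminorm m is \<phi>"
  by (rule order_trans[OF _ schwartz_seminorm_bound[OF assms, of 0]]) simp

text \<open>A distribution of order 0: a Schwartz function is at most \<open>weight\<close> times
  one of its seminorms without derivatives, so the integral of |h| times \<open>weight\<close>
  serves as continuity constant.\<close>

lemma tempered_distr_of:
  fixes h :: "real ^ 'n \<Rightarrow> complex"
  assumes h: "h \<in> Lp_space p" and p: "1 \<le> p"
  shows "distr_of h \<in> tempered"
proof -
  have m[measurable]: "h \<in> borel_measurable borel" and fin: "Lp_mod p h < \<infinity>" using h by (auto simp: Lp_space_iff)
  have i: "integrable lborel (\<lambda>x. h x * \<phi> x)" if "\<phi> \<in> schwartz" for \<phi>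
    by (rule integrable_Lp_schwartz[OF m p fin that])
  have iw: "integrable lborel (\<lambda>x. h x * complex_of_real (weight x))"
    by (rule integrable_Lp_mult[OF m _ p fin, where B = 1]) (auto simp: weight_pos less_imp_le)
  let ?C = "LINT x|lborel. norm (h x * complex_of_real (weight x))"
  let ?N = "2 * CARD('n)"
  have "norm (distr_of h \<phi>) \<le> ?C * (\<Sum>is | length is \<le> ?N. schwartz_seminorm ?N is \<phi>)"
    if \<phi>: "\<phi> \<in> schwartz" for \<phi>
  proof -
    let ?s = "schwartz_seminorm ?N [] \<phi>"
    have s: "norm (\<phi> x) \<le> weight x * ?s" for x
    proof -
      have "norm (\<phi> x) = weight x * ((1 + norm x) ^ ?N * norm (\<phi> x))"
        using weight_mult_power[of x] by (simp add: mult.assoc[symmetric])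
      also have "\<dots> \<le> weight x * ?s"
        using schwartz_seminorm_bound[OF \<phi>, of x ?N "[]"] weight_pos[of x]
        by (intro mult_left_mono) (simp_all add: iter_partial_deriv_simps)
      finally show ?thesis .
    qed
    have "norm (distr_of h \<phi>) \<le> (LINT x|lborel. norm (h x * \<phi> x))"
      using \<phi> by (simp add: distr_of_def on_schwartz_def)
    also have "\<dots> \<le> (LINT x|lborel. norm (h x * complex_of_real (weight x)) * ?s)"
    proof (rule integral_mono[OF integrable_norm[OF i[OF \<phi>]] integrable_mult_left[OF integrable_norm[OF iw]]])
      fix x
      show "norm (h x * \<phi> x) \<le> norm (h x * complex_of_real (weight x)) * ?s"
        using mult_left_mono[OF s[of x], of "norm (h x)"] by (simp add: norm_mult mult.assoc)
    qed
    also have "\<dots> = ?C * ?s" by simp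
    also have "\<dots> \<le> ?C * (\<Sum>is | length is \<le> ?N. schwartz_seminorm ?N is \<phi>)"
    proof (rule mult_left_mono)
      have "finite {is :: 'n list. length is \<le> ?N}"
        using finite_lists_length_le[of "UNIV :: 'n set"] by simp
      then show "?s \<le> (\<Sum>is | length is \<le> ?N. schwartz_seminorm ?N is \<phi>)"
        by (intro member_le_sum schwartz_seminorm_nonneg \<phi>) auto
    qed simp
    finally show ?thesis .
  qed
  then have "\<exists>C N. \<forall>\<phi>\<in>schwartz. norm (distr_of h \<phi>) \<le> C * (\<Sum>is | length is \<le> N. schwartz_seminorm N is \<phi>)"
    by blast
  moreover have "on_schwartz (distr_of h) = distr_of h" by (auto simp: distr_of_def on_schwartz_def)
  moreover have "distr_of h (\<lambda>x. \<phi> x + \<psi> x) = distr_of h \<phi> + distr_of h \<psi>"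
    if "\<phi> \<in> schwartz" "\<psi> \<in> schwartz" for \<phi> \<psi>
    using that i by (simp add: distr_of_def on_schwartz_def schwartz_add distrib_left)
  moreover have "distr_of h (\<lambda>x. c * \<phi> x) = c * distr_of h \<phi>" if "\<phi> \<in> schwartz" for c \<phi>
    using that by (simp add: distr_of_def on_schwartz_def schwartz_cmult mult.left_commute[of _ c])
  ultimately show ?thesis unfolding tempered_def by blast
qed

section \<open>Uniqueness of the representing function\<close>

text \<open>The positive and negative parts of \<open>g\<close> are densities of two finite measures
  that agree on open sets, an intersection-stable generator of the Borel sets; hence the densities
  agree almost everywhere.\<close>

lemma integral_open_zero_imp_AE_zero:
  fixes g :: "'a::euclidean_space \<Rightarrow> real"
  assumes g: "integrable lborel g" and zero: "\<And>U. open U \<Longrightarrow> (LINT x|lborel. indicator U x * g x) = 0"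
  shows "AE x in lborel. g x = 0"
proof -
  have m[measurable]: "g \<in> borel_measurable borel" using g by auto
  let ?M = "density lborel (\<lambda>x. ennreal (g x))" and ?N = "density lborel (\<lambda>x. ennreal (- g x))"
  have fin: "(\<integral>\<^sup>+x. ennreal (g x) \<partial>lborel) \<noteq> \<infinity>"
    using g by (auto simp: real_integrable_def)
  have eq: "emeasure ?M U = emeasure ?N U" if U: "open U" for U
  proof -
    have [measurable]: "U \<in> sets borel" using U by simp
    have i: "integrable lborel (\<lambda>x. indicator U x * g x)"
      by (rule Bochner_Integration.integrable_bound[OF g]) (auto simp: indicator_def)
    have 1: "emeasure ?M U = (\<integral>\<^sup>+x. ennreal (indicator U x * g x) \<partial>lborel)"
      by (subst emeasure_density) (auto intro!: nn_integral_cong simp: indicator_def)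
    have 2: "emeasure ?N U = (\<integral>\<^sup>+x. ennreal (- (indicator U x * g x)) \<partial>lborel)"
      by (subst emeasure_density) (auto intro!: nn_integral_cong simp: indicator_def)
    have "enn2real (emeasure ?M U) = enn2real (emeasure ?N U)"
      using zero[OF U] unfolding real_lebesgue_integral_def[OF i] 1 2 by simp
    moreover have "emeasure ?M U < \<top>" "emeasure ?N U < \<top>"
      using i unfolding 1 2 real_integrable_def by (auto simp: less_top)
    ultimately show ?thesis
      using ennreal_enn2real by metis
  qed
  have s: "sets borel = sigma_sets UNIV {S :: 'a set. open S}"
    unfolding borel_def by (simp add: sets_measure_of)
  have "?M = ?N"
    by (rule measure_eqI_generator_eq[where \<Omega> = UNIV and E = "{S. open S}" and A = "\<lambda>_. UNIV"])
      (use eq fin in \<open>auto simp: s Int_stable_def emeasure_density\<close>)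
  then have "AE x in lborel. ennreal (g x) = ennreal (- g x)"
    using fin by (subst (asm) finite_density_unique) auto
  then show ?thesis
  proof eventually_elim
    case (elim x)
    then show ?case by (cases "0 \<le> g x") (auto simp: ennreal_neg ennreal_eq_0_iff)
  qed
qed

lemma integral_continuous_zero_imp_AE_zero:
  fixes H :: "'a::euclidean_space \<Rightarrow> complex"
  assumes H: "integrable lborel H"
    and zero: "\<And>k :: 'a \<Rightarrow> real. continuous_on UNIV k \<Longrightarrow> (\<And>x. 0 \<le> k x) \<Longrightarrow> (\<And>x. k x \<le> 1) \<Longrightarrow>
      (LINT x|lborel. of_real (k x) * H x) = 0"
  shows "AE x in lborel. H x = 0"
proof -
  have [measurable]: "H \<in> borel_measurable borel" using H by auto
  have U: "(LINT x|lborel. indicator U x *\<^sub>R H x) = 0" if U: "open U" for U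
  \<comment> \<open>\<open>infdist\<close> to the empty set is 0, so the approximations
    \<open>k j\<close> of the indicator would vanish identically for the whole space.\<close>
  proof (cases "U = UNIV")
    case True
    then show ?thesis using zero[of "\<lambda>_. 1"] by simp
  next
    case False
    have [measurable]: "U \<in> sets borel" using U by simp
    define k where "k j x = min 1 (real j * infdist x (- U))" for j x
    have k: "continuous_on UNIV (k j)" "0 \<le> k j x" "k j x \<le> 1" for j x
      unfolding k_def by (auto intro!: continuous_intros simp: infdist_nonneg)
    have [measurable]: "k j \<in> borel_measurable borel" for j
      by (intro borel_measurable_continuous_onI k)
    have "(\<lambda>j. LINT x|lborel. of_real (k j x) * H x) \<longlonglongrightarrow> (LINT x|lborel. of_real (indicator U x) * H x)"
    proof (rule integral_dominated_convergence[where w = "\<lambda>x. norm (H x)"])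
      show "integrable lborel (\<lambda>x. norm (H x))" using H by simp
      show "AE x in lborel. (\<lambda>j. of_real (k j x) * H x) \<longlonglongrightarrow> of_real (indicator U x) * H x"
      proof (intro AE_I2 tendsto_mult tendsto_const tendsto_of_real)
        fix x
        show "(\<lambda>j. k j x) \<longlonglongrightarrow> indicator U x"
        proof (cases "x \<in> U")
          case True
          have "infdist x (- U) \<noteq> 0"
            using in_closed_iff_infdist_zero[of "- U" x] U False True by auto
          then have pos: "0 < infdist x (- U)" using infdist_nonneg[of x "- U"] by simp
          obtain j0 where j0: "1 \<le> real j0 * infdist x (- U)"
            using reals_Archimedean3[OF pos] less_imp_le by blast
          have "k j x = 1" if "j0 \<le> j" for j
          proof -
            have "real j0 * infdist x (- U) \<le> real j * infdist x (- U)"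
              using that pos by (intro mult_right_mono) auto
            then show ?thesis unfolding k_def using j0 by simp
          qed
          then have "\<forall>\<^sub>F j in sequentially. k j x = 1" unfolding eventually_sequentially by blast
          then show ?thesis using True by (simp add: tendsto_eventually)
        next
          case False
          then have "k j x = 0" for j unfolding k_def by simp
          then show ?thesis using False by simp
        qed
      qed
      show "AE x in lborel. norm (of_real (k j x) * H x) \<le> norm (H x)" for j
        using k by (intro AE_I2) (simp add: norm_mult mult_left_le_one_le)
    qed auto
    then have "(\<lambda>j. 0) \<longlonglongrightarrow> (LINT x|lborel. of_real (indicator U x) * H x)"
      using zero[OF k] by simp
    then show ?thesis by (simp add: LIMSEQ_const_iff scaleR_conv_of_real)
  qed
  have iU: "integrable lborel (\<lambda>x. indicator U x *\<^sub>R H x)" if U: "open U" for U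
    using U by (intro integrable_mult_indicator H) auto
  have "AE x in lborel. Re (H x) = 0"
  proof (rule integral_open_zero_imp_AE_zero)
    show "(LINT x|lborel. indicator U x * Re (H x)) = 0" if "open U" for U
      using integral_Re[OF iU[OF that]] U[OF that] by simp
  qed (use H in simp)
  moreover have "AE x in lborel. Im (H x) = 0"
  proof (rule integral_open_zero_imp_AE_zero)
    show "(LINT x|lborel. indicator U x * Im (H x)) = 0" if "open U" for U
      using integral_Im[OF iU[OF that]] U[OF that] by simp
  qed (use H in simp)
  ultimately show ?thesis by eventually_elim (simp add: complex_eq_iff)
qed

text \<open>The factor (1 + |x|^2)^(-n) makes \<open>h\<close> integrable and keeps test functions
  Schwartz, so \<open>?H\<close> annihilates all translated Gaussians. By Fubini it annihilates
  Gaussian smoothings of the continuous functions \<open>q\<close>, and shrinking the width it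
  annihilates \<open>q\<close> itself. Gaussians thereby take the place of bump functions.\<close>

lemma schwartz_zero_imp_AE_zero:
  fixes h :: "real ^ 'n \<Rightarrow> complex"
  assumes h: "h \<in> Lp_space p" and p: "1 \<le> p"
    and zero: "\<And>\<psi>. \<psi> \<in> schwartz \<Longrightarrow> (LINT x|lborel. h x * \<psi> x) = 0"
  shows "AE x in lborel. h x = 0"
proof -
  have m[measurable]: "h \<in> borel_measurable borel" and fin: "Lp_mod p h < \<infinity>" using h by (auto simp: Lp_space_iff)
  let ?n = "real CARD('n)"
  let ?v = "\<lambda>x :: real ^ 'n. complex_of_real ((1 + (norm x)\<^sup>2) powr (- ?n))"
  have pos: "0 < 1 + (norm x)\<^sup>2" for x :: "real ^ 'n" by (simp add: add_pos_nonneg)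
  have v: "norm (?v x) \<le> 2 ^ CARD('n) * weight x" for x
  proof -
    have "0 \<le> (1 - norm x)\<^sup>2" by simp
    then have "(1 + norm x)\<^sup>2 \<le> 2 * (1 + (norm x)\<^sup>2)" by (simp add: power2_eq_square algebra_simps)
    then have "((1 + norm x)\<^sup>2) ^ CARD('n) \<le> (2 * (1 + (norm x)\<^sup>2)) ^ CARD('n)"
      by (rule power_mono) simp
    then have 1: "(1 + norm x) ^ (2 * CARD('n)) \<le> 2 ^ CARD('n) * (1 + (norm x)\<^sup>2) ^ CARD('n)"
      by (simp only: power_mult power_mult_distrib)
    have 2: "0 < (1 + norm x) ^ (2 * CARD('n))" "0 < (1 + (norm x)\<^sup>2) ^ CARD('n)"
      by (intro zero_less_power add_pos_nonneg; simp)+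
    have 3: "norm (?v x) = inverse ((1 + (norm x)\<^sup>2) ^ CARD('n))"
      unfolding norm_of_real using pos[of x] by (simp add: powr_minus powr_realpow)
    have "inverse b \<le> k * inverse a" if "a \<le> k * b" "0 < a" "0 < b" for a b k :: real
      using that by (simp add: field_simps)
    from this[OF 1 2] show ?thesis unfolding 3 weight_def .
  qed
  let ?H = "\<lambda>x. h x * ?v x"
  have iH: "integrable lborel ?H"
    by (rule integrable_Lp_mult[OF m _ p fin _ v]) auto
  have gz: "(LINT x|lborel. gauss (1 / d\<^sup>2) (y - x) * ?H x) = 0" if "0 < d" for d y
  proof -
    have "(\<lambda>x. gauss (1 / d\<^sup>2) (- y + x)) \<in> schwartz"
      using that by (intro schwartz_translate schwartz_gauss) simp
    then have "(\<lambda>x. ?v x * gauss (1 / d\<^sup>2) (- y + x)) \<in> schwartz"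
      by (rule schwartz_one_plus_norm_square_powr)
    from zero[OF this] show ?thesis
      by (simp add: gauss_def norm_minus_commute mult_ac)
  qed
  have "AE x in lborel. ?H x * of_real (weight x) = 0"
  proof (rule integral_continuous_zero_imp_AE_zero)
    have *: "norm (?H x * of_real (weight x)) \<le> norm (?H x)" for x
      using weight_pos[of x] weight_le_1[of x] by (simp add: norm_mult mult_left_le less_imp_le)
    show "integrable lborel (\<lambda>x. ?H x * of_real (weight x))"
      by (rule Bochner_Integration.integrable_bound[OF iH]) (use * in auto)
    fix k :: "real ^ 'n \<Rightarrow> real" assume k: "continuous_on UNIV k" "\<And>x. 0 \<le> k x" "\<And>x. k x \<le> 1"
    \<comment> \<open>The factor \<open>weight\<close> makes \<open>q\<close> integrable, as Fubini
      requires; positivity removes it at the end.\<close>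
    define q where "q x = complex_of_real (k x * weight x)" for x
    have cw: "continuous_on UNIV (weight :: real ^ 'n \<Rightarrow> real)"
    proof -
      have "(1 + norm x) ^ (2 * CARD('n)) \<noteq> 0" for x :: "real ^ 'n"
        by (rule less_imp_neq[THEN not_sym], intro zero_less_power add_pos_nonneg) simp_all
      then show ?thesis unfolding weight_def[abs_def]
        by (intro continuous_on_inverse continuous_intros) auto
    qed
    have ck: "continuous_on UNIV q" unfolding q_def by (intro continuous_intros k cw)
    have qm[measurable]: "q \<in> borel_measurable borel" by (intro borel_measurable_continuous_onI ck)
    have kb: "norm (q x) \<le> weight x" for x
      unfolding q_def norm_of_real using k(2,3)[of x] by (simp add: abs_mult mult_left_le_one_le)
    have ik: "integrable lborel q"
      by (rule Bochner_Integration.integrable_bound[OF integrable_weight]) (use kb qm in auto)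
    define d where "d j = 1 / real (Suc j)" for j
    have d: "0 < d j" for j by (simp add: d_def)
    have d0: "d \<longlonglongrightarrow> 0" unfolding d_def by (rule LIMSEQ_Suc[OF lim_inverse_n'])
    let ?K = "\<lambda>j x. LINT w|lborel. gauss 1 w * q (x + d j *\<^sub>R w)"
    have ig: "integrable lborel (gauss 1 :: real ^ 'n \<Rightarrow> complex)"
      by (intro schwartz_integrable schwartz_gauss) simp
    have K0: "(LINT x|lborel. ?H x * ?K j x) = 0" for j
    proof -
      have "?K j x = of_real (1 / d j ^ CARD('n)) * (LINT y|lborel. gauss (1 / (d j)\<^sup>2) (y - x) * q y)" for x
        by (subst gauss_scaled_convolution) (use d[of j] in simp_all)
      then have "(LINT x|lborel. ?H x * ?K j x) = of_real (1 / d j ^ CARD('n)) * (LINT x|lborel. ?H x * (LINT y|lborel. gauss (1 / (d j)\<^sup>2) (y - x) * q y))"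
        by (simp only: mult.left_commute[of _ "of_real _"] integral_mult_right_zero)
      also have "(LINT x|lborel. ?H x * (LINT y|lborel. gauss (1 / (d j)\<^sup>2) (y - x) * q y)) =
          (LINT y|lborel. (LINT x|lborel. gauss (1 / (d j)\<^sup>2) (y - x) * ?H x) * q y)"
      proof (rule integral_kernel_swap[OF iH ik borel_measurable_lborel_pair, symmetric])
        show "continuous_on UNIV (\<lambda>(x, y :: real ^ 'n). gauss (1 / (d j)\<^sup>2) (y - x))"
          unfolding gauss_def split_def by (intro continuous_intros)
        show "norm (gauss (1 / (d j)\<^sup>2) (y - x)) \<le> 1" for x y :: "real ^ 'n"
          by (simp add: gauss_def)
      qed
      also have "\<dots> = 0" unfolding gz[OF d] by simp
      finally show ?thesis by simp
    qed
    have "(\<lambda>j. LINT x|lborel. ?H x * ?K j x) \<longlonglongrightarrow> (LINT x|lborel. ?H x * (of_real (pi powr (?n / 2)) * q x))"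
    proof (rule integral_dominated_convergence[where w = "\<lambda>x. norm (?H x) * (LINT w|lborel. norm (gauss 1 (w :: real ^ 'n)))"])
      show "integrable lborel (\<lambda>x. norm (?H x) * (LINT w|lborel. norm (gauss 1 (w :: real ^ 'n))))"
        by (intro integrable_mult_left integrable_norm iH)
      show "AE x in lborel. (\<lambda>j. ?H x * ?K j x) \<longlonglongrightarrow> ?H x * (of_real (pi powr (?n / 2)) * q x)"
      proof (intro AE_I2 tendsto_mult tendsto_const gauss_approximate_identity[where B = 1] d0)
        show "isCont q x" for x using ck by (simp add: continuous_on_eq_continuous_at)
        show "norm (q y) \<le> 1" for y using kb[of y] weight_le_1[of y] by linarith
      qed measurable
      show "AE x in lborel. norm (?H x * ?K j x) \<le> norm (?H x) * (LINT w|lborel. norm (gauss 1 (w :: real ^ 'n)))" for j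
      proof (intro AE_I2)
        fix x
        have "norm (?K j x) \<le> (LINT w|lborel. norm (gauss 1 w * q (x + d j *\<^sub>R w)))"
          by (rule integral_norm_bound)
        also have "\<dots> \<le> (LINT w|lborel. norm (gauss 1 (w :: real ^ 'n)))"
        proof (rule integral_mono')
          fix w
          have "norm (q (x + d j *\<^sub>R w)) \<le> 1" using kb[of "x + d j *\<^sub>R w"] weight_le_1[of "x + d j *\<^sub>R w"] by linarith
          then show "norm (gauss 1 w * q (x + d j *\<^sub>R w)) \<le> norm (gauss 1 w)"
            unfolding norm_mult by (intro mult_right_le_one_le) auto
        qed (use ig in auto)
        finally show "norm (?H x * ?K j x) \<le> norm (?H x) * (LINT w|lborel. norm (gauss 1 (w :: real ^ 'n)))"
          unfolding norm_mult by (intro mult_left_mono) auto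
      qed
    qed measurable
    then have "(\<lambda>j :: nat. 0) \<longlonglongrightarrow> (LINT x|lborel. ?H x * (of_real (pi powr (?n / 2)) * q x))"
      unfolding K0 .
    then have "(LINT x|lborel. of_real (pi powr (?n / 2)) * (?H x * q x)) = 0"
      by (simp only: LIMSEQ_const_iff mult.left_commute[of _ "of_real (pi powr _)"])
    then have "of_real (pi powr (?n / 2)) * (LINT x|lborel. ?H x * q x) = 0"
      by (simp only: integral_mult_right_zero)
    then have "(LINT x|lborel. ?H x * q x) = 0" by simp
    then show "(LINT x|lborel. of_real (k x) * (?H x * of_real (weight x))) = 0"
      by (simp add: q_def mult_ac)
  qed
  then show ?thesis
  proof eventually_elim
    case (elim x)
    then show ?case using pos[of x] weight_pos[of x] by simp
  qed
qed

lemma distr_of_eq_imp_AE_eq: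
  fixes f g :: "real ^ 'n \<Rightarrow> complex"
  assumes f: "f \<in> Lp_space p" and g: "g \<in> Lp_space p" and p: "1 \<le> p" and eq: "distr_of f = distr_of g"
  shows "AE x in lborel. f x = g x"
proof -
  have m[measurable]: "f \<in> borel_measurable borel" "g \<in> borel_measurable borel"
    and fin: "Lp_mod p f < \<infinity>" "Lp_mod p g < \<infinity>"
    using f g by (auto simp: Lp_space_iff)
  have "Lp_mod p (\<lambda>x. f x + - 1 * g x) \<le> ennreal (2 powr p) * (Lp_mod p f + Lp_mod p (\<lambda>x. - 1 * g x))"
    by (rule Lp_mod_add_le) (use p in auto)
  also have "\<dots> < \<infinity>" using fin by (subst Lp_mod_cmult) (auto simp: ennreal_mult_less_top)
  finally have "Lp_mod p (\<lambda>x. f x - g x) < \<infinity>" by simp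
  then have "(\<lambda>x. f x - g x) \<in> Lp_space p" by (simp add: Lp_space_iff)
  moreover have "(LINT x|lborel. (f x - g x) * \<psi> x) = 0" if "\<psi> \<in> schwartz" for \<psi>
    using fun_cong[OF eq, of \<psi>] that integrable_Lp_schwartz[OF m(1) p fin(1) that]
      integrable_Lp_schwartz[OF m(2) p fin(2) that]
    by (simp add: distr_of_def on_schwartz_def left_diff_distrib)
  ultimately have "AE x in lborel. f x - g x = 0" by (rule schwartz_zero_imp_AE_zero[OF _ p])
  then show ?thesis by simp
qed

lemma distr_Lp_norm_distr_of:
  assumes h: "h \<in> Lp_space p" and p: "1 \<le> p"
  shows "distr_Lp_norm p (distr_of h) = ennreal (Lp_norm p h)"
proof -
  have "Lp_norm p f = Lp_norm p h" if f: "f \<in> Lp_space p" "distr_of h = distr_of f" for f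
  proof -
    have "AE x in lborel. f x = h x" by (rule distr_of_eq_imp_AE_eq[OF f(1) h p f(2)[symmetric]])
    moreover have [measurable]: "f \<in> borel_measurable borel" "h \<in> borel_measurable borel"
      using f h by (auto simp: Lp_space_iff)
    ultimately show ?thesis unfolding Lp_norm_def
      by (intro arg_cong[where f = "\<lambda>x. x powr (1 / p)"] integral_cong_AE) auto
  qed
  then have eq: "ennreal (Lp_norm p h) \<le> ennreal (Lp_norm p f)"
    if "f \<in> {f \<in> Lp_space p. distr_of h = distr_of f}" for f
    using that by simp
  show ?thesis unfolding distr_Lp_norm_def
  proof (rule antisym)
    show "(INF f\<in>{f \<in> Lp_space p. distr_of h = distr_of f}. ennreal (Lp_norm p f)) \<le> ennreal (Lp_norm p h)"
      by (rule INF_lower) (use h in simp)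
    show "ennreal (Lp_norm p h) \<le> (INF f\<in>{f \<in> Lp_space p. distr_of h = distr_of f}. ennreal (Lp_norm p f))"
      by (rule INF_greatest) (rule eq)
  qed
qed

subsection \<open>Multipliers of \<open>L\<^sup>p\<close>\<close>

lemma inv_fourier_measurable:
  fixes H :: "real ^ 'n \<Rightarrow> complex"
  assumes [measurable]: "H \<in> borel_measurable borel"
  shows "inv_fourier H \<in> borel_measurable borel"
proof -
  have "(\<lambda>x. LINT \<xi>|lborel. cis (x \<bullet> \<xi>) * H \<xi>) \<in> borel_measurable (borel :: (real ^ 'n) measure)"
  proof (rule lborel.borel_measurable_lebesgue_integral)
    have "(\<lambda>z :: (real ^ 'n) \<times> (real ^ 'n). cis (fst z \<bullet> snd z)) \<in> borel_measurable borel"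
      by (intro borel_measurable_continuous_onI continuous_intros)
    then have [measurable]: "(\<lambda>z :: (real ^ 'n) \<times> (real ^ 'n). cis (fst z \<bullet> snd z)) \<in> borel_measurable (borel \<Otimes>\<^sub>M lborel)"
      by (simp add: borel_prod[symmetric] cong: measurable_cong_sets)
    show "(\<lambda>(x, \<xi>). cis (x \<bullet> \<xi>) * H \<xi>) \<in> borel_measurable (borel \<Otimes>\<^sub>M lborel)"
      unfolding split_def by measurable
  qed
  then show ?thesis unfolding inv_fourier_def[abs_def] by measurable
qed

lemma fourier_measurable:
  fixes H :: "real ^ 'n \<Rightarrow> complex"
  assumes [measurable]: "H \<in> borel_measurable borel"
  shows "fourier H \<in> borel_measurable borel"
proof -
  have [measurable]: "inv_fourier H \<in> borel_measurable borel" by (rule inv_fourier_measurable) measurable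
  have "fourier H = (\<lambda>\<xi>. of_real ((2 * pi) ^ CARD('n)) * inv_fourier H (- \<xi>))"
    by (rule ext) (simp add: inv_fourier_fourier_uminus)
  also have "\<dots> \<in> borel_measurable borel" by measurable
  finally show ?thesis .
qed

lemma norm_inv_fourier_le:
  fixes H :: "real ^ 'n \<Rightarrow> complex"
  assumes "integrable lborel H"
  shows "norm (inv_fourier H x) \<le> (1 / (2 * pi) ^ CARD('n)) * (LINT \<xi>|lborel. norm (H \<xi>))"
  unfolding inv_fourier_fourier_uminus norm_mult
  using norm_fourier_le[OF assms, of "- x"] by (intro mult_mono) (auto simp: norm_divide norm_power norm_mult)

lemma inv_fourier_add:
  assumes "integrable lborel f" "integrable lborel g"
  shows "inv_fourier (\<lambda>x. f x + g x) x = inv_fourier f x + inv_fourier g x"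
  using fourier_add[OF assms] by (simp add: inv_fourier_fourier_uminus distrib_left)

lemma inv_fourier_cmult: "inv_fourier (\<lambda>x. c * f x) x = c * inv_fourier f x"
  by (simp add: inv_fourier_fourier_uminus fourier_cmult)

lemma inv_fourier_cong_AE:
  assumes "AE \<xi> in lborel. f \<xi> = g \<xi>" "f \<in> borel_measurable borel" "g \<in> borel_measurable borel"
  shows "inv_fourier f = inv_fourier g"
proof
  fix x
  note [measurable] = assms(2,3)
  show "inv_fourier f x = inv_fourier g x" unfolding inv_fourier_def
  proof (intro arg_cong[where f = "\<lambda>y. _ * y"] integral_cong_AE)
    show "AE \<xi> in lborel. cis (x \<bullet> \<xi>) * f \<xi> = cis (x \<bullet> \<xi>) * g \<xi>"
      using assms(1) by eventually_elim simp
  qed measurable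
qed

section \<open>Convolution and Young's inequality\<close>

definition conv :: "(real ^ 'n \<Rightarrow> complex) \<Rightarrow> (real ^ 'n \<Rightarrow> complex) \<Rightarrow> real ^ 'n \<Rightarrow> complex" where
  "conv K h x = (LINT y|lborel. K y * h (x - y))"

text \<open>Stated for integrable \<open>H\<close>, not for transforms of Schwartz functions,
  because it will be applied with \<open>H\<close> containing the factor |xi|^t.\<close>

lemma inv_fourier_fourier_mult:
  fixes K H :: "real ^ 'n \<Rightarrow> complex"
  assumes K: "integrable lborel K" and H: "integrable lborel H"
  shows "inv_fourier (\<lambda>\<xi>. fourier K \<xi> * H \<xi>) = conv K (inv_fourier H)"
proof
  fix x
  have "(LINT \<xi>|lborel. (LINT y|lborel. cis (- (y \<bullet> \<xi>)) * K y) * (cis (x \<bullet> \<xi>) * H \<xi>)) =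
      (LINT y|lborel. K y * (LINT \<xi>|lborel. cis (- (y \<bullet> \<xi>)) * (cis (x \<bullet> \<xi>) * H \<xi>)))"
  proof (rule integral_kernel_swap[OF K _ borel_measurable_lborel_pair])
    show "integrable lborel (\<lambda>\<xi>. cis (x \<bullet> \<xi>) * H \<xi>)" by (intro integrable_cis_mult H) auto
    show "continuous_on UNIV (\<lambda>(y, \<xi> :: real ^ 'n). cis (- (y \<bullet> \<xi>)))"
      unfolding split_def by (intro continuous_intros)
  qed simp
  moreover have "cis (- (y \<bullet> \<xi>)) * (cis (x \<bullet> \<xi>) * H \<xi>) = cis ((x - y) \<bullet> \<xi>) * H \<xi>" for y \<xi>
    by (simp add: cis_mult inner_diff_left mult.assoc[symmetric])
  ultimately have "(LINT \<xi>|lborel. cis (x \<bullet> \<xi>) * (fourier K \<xi> * H \<xi>)) =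
      (LINT y|lborel. K y * (LINT \<xi>|lborel. cis ((x - y) \<bullet> \<xi>) * H \<xi>))"
    unfolding fourier_def by (simp only: mult.left_commute)
  moreover have "K y * inv_fourier H (x - y) = of_real (1 / (2 * pi) ^ CARD('n)) * (K y * (LINT \<xi>|lborel. cis ((x - y) \<bullet> \<xi>) * H \<xi>))" for y
    unfolding inv_fourier_def by (simp only: mult.left_commute)
  ultimately show "inv_fourier (\<lambda>\<xi>. fourier K \<xi> * H \<xi>) x = conv K (inv_fourier H) x"
    unfolding conv_def by (simp only: integral_mult_right_zero inv_fourier_def[of _ x])
qed

text \<open>The graph of the convex function x^p lies above its tangent at \<open>c\<close>.
  Convexity is used on the open half-line, so the endpoint a = 0 is computed directly.\<close>

lemma powr_tangent_le:
  fixes a c :: real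
  assumes "0 \<le> a" "0 < c" "1 \<le> p"
  shows "c powr p + p * c powr (p - 1) * (a - c) \<le> a powr p"
proof (cases "a = 0")
  case True
  have "c powr (p - 1) * c = c powr p" using assms by (simp add: powr_diff)
  then have "c powr p + p * c powr (p - 1) * (a - c) = (1 - p) * c powr p"
    using True by (simp add: algebra_simps)
  also have "\<dots> \<le> 0" using assms by (simp add: mult_nonpos_nonneg)
  finally show ?thesis using True assms by simp
next
  case False
  then have a: "0 < a" using assms by simp
  have "p * c powr (p - 1) * (a - c) \<le> a powr p - c powr p"
  proof (rule convex_on_imp_above_tangent[where A = "{0<..}"])
    show "convex_on {0<..} (\<lambda>x. x powr p)" by (rule powr_convex) fact
    show "((\<lambda>x. x powr p) has_real_derivative p * c powr (p - 1)) (at c within {0<..})"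
      using assms by (intro has_real_derivative_powr DERIV_subset[OF has_real_derivative_powr]) auto
  qed (use assms a in \<open>auto simp: interior_open\<close>)
  then show ?thesis by simp
qed

text \<open>Integrate the tangent inequality at the weighted mean c = I / kappa, where the linear
  term integrates to 0. The weight \<open>k\<close> has arbitrary mass kappa, hence the factor
  kappa^(p-1).\<close>

lemma Jensen_powr:
  fixes k a :: "'a \<Rightarrow> real"
  assumes k: "integrable M k" "\<And>y. 0 \<le> k y" and a: "\<And>y. 0 \<le> a y" "\<And>y. a y \<le> B" "a \<in> borel_measurable M"
    and p: "1 \<le> p"
  shows "(LINT y|M. k y * a y) powr p \<le> (LINT y|M. k y) powr (p - 1) * (LINT y|M. k y * a y powr p)"
proof -
  have [measurable]: "k \<in> borel_measurable M" "a \<in> borel_measurable M" using k a by auto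
  have ia: "integrable M (\<lambda>y. k y * a y)"
  proof (rule Bochner_Integration.integrable_bound[OF integrable_mult_left[OF k(1), of B]])
    show "AE y in M. norm (k y * a y) \<le> norm (k y * B)"
    proof (intro AE_I2)
      fix y
      have "\<bar>a y\<bar> \<le> \<bar>B\<bar>" using a(1,2)[of y] by linarith
      then show "norm (k y * a y) \<le> norm (k y * B)"
        unfolding real_norm_def abs_mult by (rule mult_left_mono) simp
    qed
  qed measurable
  have ip: "integrable M (\<lambda>y. k y * a y powr p)"
  proof (rule Bochner_Integration.integrable_bound[OF integrable_mult_left[OF k(1), of "B powr p"]])
    show "AE y in M. norm (k y * a y powr p) \<le> norm (k y * B powr p)"
      using a k p by (intro AE_I2) (auto simp: abs_mult intro!: mult_left_mono powr_mono2)
  qed measurable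
  let ?\<kappa> = "LINT y|M. k y" and ?I = "LINT y|M. k y * a y"
  have \<kappa>: "0 \<le> ?\<kappa>" using k by simp
  have I: "0 \<le> ?I" using k a by simp
  have P: "0 \<le> (LINT y|M. k y * a y powr p)" using k by simp
  show ?thesis
  proof (cases "?I = 0")
    case True
    then show ?thesis using p P by simp
  next
    case False
    then have I: "0 < ?I" using I by simp
    have \<kappa>0: "0 < ?\<kappa>"
    proof (rule ccontr)
      assume "\<not> 0 < ?\<kappa>"
      then have "?\<kappa> = 0" using \<kappa> by simp
      then have "AE y in M. k y = 0" using integral_nonneg_eq_0_iff_AE[OF k(1)] k(2) by simp
      then have "AE y in M. k y * a y = 0" by eventually_elim simp
      then have "?I = 0" by (rule integral_eq_zero_AE)
      then show False using False by simp
    qed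
    define c where "c = ?I / ?\<kappa>"
    have c: "0 < c" using I \<kappa>0 by (simp add: c_def)
    have eq: "k y * (c powr p + p * c powr (p - 1) * (a y - c)) =
        (c powr p - p * c powr (p - 1) * c) * k y + p * c powr (p - 1) * (k y * a y)" for y
      by (simp add: algebra_simps)
    have "(LINT y|M. k y * (c powr p + p * c powr (p - 1) * (a y - c))) \<le> (LINT y|M. k y * a y powr p)"
    proof (rule integral_mono[OF _ ip])
      show "integrable M (\<lambda>y. k y * (c powr p + p * c powr (p - 1) * (a y - c)))"
        unfolding eq by (intro Bochner_Integration.integrable_add integrable_mult_right k(1) ia)
      show "k y * (c powr p + p * c powr (p - 1) * (a y - c)) \<le> k y * a y powr p" for y
        by (intro mult_left_mono powr_tangent_le a k c p)
    qed
    also have "(LINT y|M. k y * (c powr p + p * c powr (p - 1) * (a y - c))) =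
        (LINT y|M. (c powr p - p * c powr (p - 1) * c) * k y + p * c powr (p - 1) * (k y * a y))"
      by (simp only: eq)
    also have "\<dots> = (c powr p - p * c powr (p - 1) * c) * ?\<kappa> + p * c powr (p - 1) * ?I"
      using k(1) ia by simp
    also have "\<dots> = c powr p * ?\<kappa>"
    proof -
      have "?I = c * ?\<kappa>" using \<kappa>0 by (simp add: c_def)
      then show ?thesis by (simp add: algebra_simps)
    qed
    finally have *: "c powr p * ?\<kappa> \<le> (LINT y|M. k y * a y powr p)" .
    have "?I powr p = c powr p * ?\<kappa> powr p" using I \<kappa>0 by (simp add: c_def powr_divide)
    also have "\<dots> = ?\<kappa> powr (p - 1) * (c powr p * ?\<kappa>)"
      using \<kappa>0 by (simp add: powr_diff)
    also have "\<dots> \<le> ?\<kappa> powr (p - 1) * (LINT y|M. k y * a y powr p)"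
      by (intro mult_left_mono *) simp
    finally show ?thesis .
  qed
qed

text \<open>Jensen's inequality with weight |K| at each point, then Tonelli and translation
  invariance. Boundedness of \<open>h\<close> supplies the integrability that Jensen
  requires.\<close>

lemma Lp_mod_conv_le:
  fixes K h :: "real ^ 'n \<Rightarrow> complex"
  assumes K: "integrable lborel K" and m[measurable]: "h \<in> borel_measurable borel"
    and B: "\<And>x. norm (h x) \<le> B" and p: "1 \<le> p"
  shows "Lp_mod p (conv K h) \<le> ennreal ((LINT y|lborel. norm (K y)) powr p) * Lp_mod p h"
proof -
  have [measurable]: "K \<in> borel_measurable borel" using K by auto
  let ?\<kappa> = "LINT y|lborel. norm (K y)"
  have \<kappa>: "0 \<le> ?\<kappa>" by simp
  have B0: "0 \<le> B" using order_trans[OF norm_ge_zero B[of 0]] .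
  have pt: "ennreal (norm (conv K h x) powr p) \<le>
      ennreal (?\<kappa> powr (p - 1)) * (\<integral>\<^sup>+y. ennreal (norm (K y)) * ennreal (norm (h (x - y)) powr p) \<partial>lborel)" for x
  proof -
    have i: "integrable lborel (\<lambda>y. norm (K y) * norm (h (x - y)) powr p)"
    proof (rule Bochner_Integration.integrable_bound[OF integrable_mult_left[OF integrable_norm[OF K], of "B powr p"]])
      show "AE y in lborel. norm (norm (K y) * norm (h (x - y)) powr p) \<le> norm (norm (K y) * B powr p)"
        using B p by (intro AE_I2) (auto simp: abs_mult intro!: mult_left_mono powr_mono2)
    qed measurable
    have "norm (conv K h x) \<le> (LINT y|lborel. norm (K y) * norm (h (x - y)))"
      unfolding conv_def by (rule order_trans[OF integral_norm_bound]) (simp add: norm_mult)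
    then have "norm (conv K h x) powr p \<le> (LINT y|lborel. norm (K y) * norm (h (x - y))) powr p"
      using p by (intro powr_mono2) auto
    also have "\<dots> \<le> ?\<kappa> powr (p - 1) * (LINT y|lborel. norm (K y) * norm (h (x - y)) powr p)"
      by (rule Jensen_powr[OF _ _ _ _ _ p, where B = B]) (use K B in auto)
    finally have "ennreal (norm (conv K h x) powr p) \<le> ennreal (?\<kappa> powr (p - 1)) * ennreal (LINT y|lborel. norm (K y) * norm (h (x - y)) powr p)"
      by (simp add: ennreal_leI flip: ennreal_mult)
    also have "ennreal (LINT y|lborel. norm (K y) * norm (h (x - y)) powr p) =
        (\<integral>\<^sup>+y. ennreal (norm (K y) * norm (h (x - y)) powr p) \<partial>lborel)"
      by (intro nn_integral_eq_integral[symmetric] i) simp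
    finally show ?thesis by (simp add: ennreal_mult)
  qed
  have "Lp_mod p (conv K h) \<le>
      (\<integral>\<^sup>+x. ennreal (?\<kappa> powr (p - 1)) * (\<integral>\<^sup>+y. ennreal (norm (K y)) * ennreal (norm (h (x - y)) powr p) \<partial>lborel) \<partial>lborel)"
    unfolding Lp_mod_def by (intro nn_integral_mono pt)
  also have "\<dots> = ennreal (?\<kappa> powr (p - 1)) * (\<integral>\<^sup>+x. (\<integral>\<^sup>+y. ennreal (norm (K y)) * ennreal (norm (h (x - y)) powr p) \<partial>lborel) \<partial>lborel)"
    by (intro nn_integral_cmult) measurable
  also have "(\<integral>\<^sup>+x. (\<integral>\<^sup>+y. ennreal (norm (K y)) * ennreal (norm (h (x - y)) powr p) \<partial>lborel) \<partial>lborel) =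
      (\<integral>\<^sup>+y. (\<integral>\<^sup>+x. ennreal (norm (K y)) * ennreal (norm (h (x - y)) powr p) \<partial>lborel) \<partial>lborel)"
    by (rule lborel_pair.Fubini') measurable
  also have "\<dots> = (\<integral>\<^sup>+y. ennreal (norm (K y)) * Lp_mod p h \<partial>lborel)"
  proof (rule nn_integral_cong)
    fix y
    have "(\<integral>\<^sup>+x. ennreal (norm (h (x - y)) powr p) \<partial>lborel) = Lp_mod p h"
      unfolding Lp_mod_def
      using nn_integral_lborel_affine[of "\<lambda>x. ennreal (norm (h x) powr p)" 1 "- y"] by simp
    then show "(\<integral>\<^sup>+x. ennreal (norm (K y)) * ennreal (norm (h (x - y)) powr p) \<partial>lborel) = ennreal (norm (K y)) * Lp_mod p h"
      by (subst nn_integral_cmult) auto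
  qed
  also have "\<dots> = (\<integral>\<^sup>+y. ennreal (norm (K y)) \<partial>lborel) * Lp_mod p h"
    by (rule nn_integral_multc) measurable
  also have "(\<integral>\<^sup>+y. ennreal (norm (K y)) \<partial>lborel) = ennreal ?\<kappa>"
    by (intro nn_integral_eq_integral integrable_norm K) simp
  also have "ennreal (?\<kappa> powr (p - 1)) * (ennreal ?\<kappa> * Lp_mod p h) = ennreal (?\<kappa> powr p) * Lp_mod p h"
  proof -
    have "?\<kappa> powr (p - 1) * ?\<kappa> = ?\<kappa> powr p"
      using \<kappa> by (cases "?\<kappa> = 0") (auto simp: powr_diff)
    then show ?thesis using \<kappa> by (simp add: mult.assoc[symmetric] flip: ennreal_mult)
  qed
  finally show ?thesis .
qed

section \<open>Multiplier calculus\<close>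

text \<open>Tested on inverse transforms of all integrable \<open>H\<close>, which includes |xi|^s
  times the transform of a Schwartz function. Boundedness of \<open>m\<close> is built in so that
  \<open>m \<xi> * H \<xi>\<close> is again integrable and multipliers can be composed.\<close>

definition Lp_multiplier :: "real \<Rightarrow> (real ^ 'n \<Rightarrow> complex) \<Rightarrow> bool" where
  "Lp_multiplier p m \<longleftrightarrow> m \<in> borel_measurable borel \<and>
    (\<exists>B C::real. (\<forall>\<xi>. norm (m \<xi>) \<le> B) \<and> 0 \<le> C \<and> (\<forall>H. integrable lborel H \<longrightarrow>
      Lp_mod p (inv_fourier (\<lambda>\<xi>. m \<xi> * H \<xi>)) \<le> ennreal C * Lp_mod p (inv_fourier H)))"

lemma Lp_multiplierI:
  assumes "m \<in> borel_measurable borel" "\<And>\<xi>. norm (m \<xi>) \<le> B" "0 \<le> C"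
    and "\<And>H. integrable lborel H \<Longrightarrow>
      Lp_mod p (inv_fourier (\<lambda>\<xi>. m \<xi> * H \<xi>)) \<le> ennreal C * Lp_mod p (inv_fourier H)"
  shows "Lp_multiplier p m"
  unfolding Lp_multiplier_def
  by (intro conjI exI[of _ B] exI[of _ C] allI impI assms)

lemma Lp_multiplierE:
  assumes "Lp_multiplier p m"
  obtains B C where "m \<in> borel_measurable borel" "\<And>\<xi>. norm (m \<xi>) \<le> B" "0 \<le> B" "0 \<le> C"
    "\<And>H. integrable lborel H \<Longrightarrow>
      Lp_mod p (inv_fourier (\<lambda>\<xi>. m \<xi> * H \<xi>)) \<le> ennreal C * Lp_mod p (inv_fourier H)"
proof -
  from assms obtain B C where m: "m \<in> borel_measurable borel" and B: "\<forall>\<xi>. norm (m \<xi>) \<le> B" and "0 \<le> C"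
    and C: "\<forall>H. integrable lborel H \<longrightarrow>
      Lp_mod p (inv_fourier (\<lambda>\<xi>. m \<xi> * H \<xi>)) \<le> ennreal C * Lp_mod p (inv_fourier H)"
    unfolding Lp_multiplier_def by (elim conjE exE)
  show ?thesis
    by (rule that[OF m spec[OF B] order_trans[OF norm_ge_zero spec[OF B]] \<open>0 \<le> C\<close> mp[OF spec[OF C]]])
qed

lemma Lp_multiplier_integrable:
  assumes "Lp_multiplier p m" "integrable lborel H"
  shows "integrable lborel (\<lambda>\<xi>. m \<xi> * H \<xi>)"
proof -
  obtain B C where [measurable]: "m \<in> borel_measurable borel" and B: "\<And>\<xi>. norm (m \<xi>) \<le> B" "0 \<le> B"
    and "0 \<le> C" "\<And>H. integrable lborel H \<Longrightarrow>
      Lp_mod p (inv_fourier (\<lambda>\<xi>. m \<xi> * H \<xi>)) \<le> ennreal C * Lp_mod p (inv_fourier H)"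
    using Lp_multiplierE[OF assms(1)] by blast
  have [measurable]: "H \<in> borel_measurable borel" using assms(2) by auto
  show ?thesis
  proof (rule Bochner_Integration.integrable_bound[OF integrable_mult_right[OF integrable_norm[OF assms(2)], of B]])
    show "AE \<xi> in lborel. norm (m \<xi> * H \<xi>) \<le> norm (B * norm (H \<xi>))"
    proof (intro AE_I2)
      fix \<xi>
      have "norm (m \<xi>) * norm (H \<xi>) \<le> B * norm (H \<xi>)" by (rule mult_right_mono[OF B(1)]) simp
      then show "norm (m \<xi> * H \<xi>) \<le> norm (B * norm (H \<xi>))"
        unfolding norm_mult using B(2) by simp
    qed
  qed measurable
qed

lemma Lp_multiplier_mult:
  assumes "Lp_multiplier p m" "Lp_multiplier p m'"
  shows "Lp_multiplier p (\<lambda>\<xi>. m \<xi> * m' \<xi>)"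
proof -
  obtain B C where [measurable]: "m \<in> borel_measurable borel" and B: "\<And>\<xi>. norm (m \<xi>) \<le> B" "0 \<le> B"
    and C: "0 \<le> C" "\<And>H. integrable lborel H \<Longrightarrow>
    Lp_mod p (inv_fourier (\<lambda>\<xi>. m \<xi> * H \<xi>)) \<le> ennreal C * Lp_mod p (inv_fourier H)"
    using Lp_multiplierE[OF assms(1)] by blast
  obtain B' C' where [measurable]: "m' \<in> borel_measurable borel" and B': "\<And>\<xi>. norm (m' \<xi>) \<le> B'" "0 \<le> B'"
    and C': "0 \<le> C'" "\<And>H. integrable lborel H \<Longrightarrow>
    Lp_mod p (inv_fourier (\<lambda>\<xi>. m' \<xi> * H \<xi>)) \<le> ennreal C' * Lp_mod p (inv_fourier H)"
    using Lp_multiplierE[OF assms(2)] by blast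
  show ?thesis
  proof (rule Lp_multiplierI[where B = "B * B'" and C = "C * C'"])
    show "norm (m \<xi> * m' \<xi>) \<le> B * B'" for \<xi>
      unfolding norm_mult by (intro mult_mono B B') simp
    show "0 \<le> C * C'" using C(1) C'(1) by simp
    fix H :: "real ^ 'a \<Rightarrow> complex" assume H: "integrable lborel H"
    have "Lp_mod p (inv_fourier (\<lambda>\<xi>. m \<xi> * (m' \<xi> * H \<xi>))) \<le> ennreal C * Lp_mod p (inv_fourier (\<lambda>\<xi>. m' \<xi> * H \<xi>))"
      by (intro C Lp_multiplier_integrable[OF assms(2)] H)
    also have "\<dots> \<le> ennreal C * (ennreal C' * Lp_mod p (inv_fourier H))"
      by (intro mult_left_mono C' H) simp
    finally show "Lp_mod p (inv_fourier (\<lambda>\<xi>. m \<xi> * m' \<xi> * H \<xi>)) \<le> ennreal (C * C') * Lp_mod p (inv_fourier H)"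
      using C(1) C'(1) by (simp add: mult.assoc ennreal_mult)
  qed measurable
qed

lemma Lp_multiplier_add:
  assumes "Lp_multiplier p m" "Lp_multiplier p m'" "0 \<le> p"
  shows "Lp_multiplier p (\<lambda>\<xi>. m \<xi> + m' \<xi>)"
proof -
  obtain B C where [measurable]: "m \<in> borel_measurable borel" and B: "\<And>\<xi>. norm (m \<xi>) \<le> B" "0 \<le> B"
    and C: "0 \<le> C" "\<And>H. integrable lborel H \<Longrightarrow>
    Lp_mod p (inv_fourier (\<lambda>\<xi>. m \<xi> * H \<xi>)) \<le> ennreal C * Lp_mod p (inv_fourier H)"
    using Lp_multiplierE[OF assms(1)] by blast
  obtain B' C' where [measurable]: "m' \<in> borel_measurable borel" and B': "\<And>\<xi>. norm (m' \<xi>) \<le> B'" "0 \<le> B'"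
    and C': "0 \<le> C'" "\<And>H. integrable lborel H \<Longrightarrow>
    Lp_mod p (inv_fourier (\<lambda>\<xi>. m' \<xi> * H \<xi>)) \<le> ennreal C' * Lp_mod p (inv_fourier H)"
    using Lp_multiplierE[OF assms(2)] by blast
  show ?thesis
  proof (rule Lp_multiplierI[where B = "B + B'" and C = "2 powr p * (C + C')"])
    show "norm (m \<xi> + m' \<xi>) \<le> B + B'" for \<xi>
      by (intro order_trans[OF norm_triangle_ineq] add_mono B B')
    show "0 \<le> 2 powr p * (C + C')" using C(1) C'(1) by simp
    fix H :: "real ^ 'a \<Rightarrow> complex" assume H: "integrable lborel H"
    note i = Lp_multiplier_integrable[OF assms(1) H] Lp_multiplier_integrable[OF assms(2) H]
    have "Lp_mod p (inv_fourier (\<lambda>\<xi>. (m \<xi> + m' \<xi>) * H \<xi>)) =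
        Lp_mod p (\<lambda>x. inv_fourier (\<lambda>\<xi>. m \<xi> * H \<xi>) x + inv_fourier (\<lambda>\<xi>. m' \<xi> * H \<xi>) x)"
      unfolding distrib_right by (intro arg_cong[where f = "Lp_mod p"] ext inv_fourier_add i)
    also have "\<dots> \<le> ennreal (2 powr p) * (Lp_mod p (inv_fourier (\<lambda>\<xi>. m \<xi> * H \<xi>)) + Lp_mod p (inv_fourier (\<lambda>\<xi>. m' \<xi> * H \<xi>)))"
      using i assms(3) by (intro Lp_mod_add_le inv_fourier_measurable) auto
    also have "\<dots> \<le> ennreal (2 powr p) * (ennreal C * Lp_mod p (inv_fourier H) + ennreal C' * Lp_mod p (inv_fourier H))"
      by (intro mult_left_mono add_mono C C' H) simp
    also have "\<dots> = ennreal (2 powr p * (C + C')) * Lp_mod p (inv_fourier H)"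
      using C(1) C'(1) by (simp add: ennreal_mult ennreal_plus distrib_right mult.assoc)
    finally show "Lp_mod p (inv_fourier (\<lambda>\<xi>. (m \<xi> + m' \<xi>) * H \<xi>)) \<le> ennreal (2 powr p * (C + C')) * Lp_mod p (inv_fourier H)" .
  qed measurable
qed

lemma Lp_multiplier_const: "Lp_multiplier p (\<lambda>_. c)"
proof (rule Lp_multiplierI[where B = "norm c" and C = "norm c powr p"])
  fix H :: "real ^ 'a \<Rightarrow> complex" assume H: "integrable lborel H"
  have "inv_fourier (\<lambda>\<xi>. c * H \<xi>) = (\<lambda>x. c * inv_fourier H x)"
    by (rule ext) (rule inv_fourier_cmult)
  moreover have "inv_fourier H \<in> borel_measurable borel"
    using H by (intro inv_fourier_measurable) auto
  ultimately show "Lp_mod p (inv_fourier (\<lambda>\<xi>. c * H \<xi>)) \<le> ennreal (norm c powr p) * Lp_mod p (inv_fourier H)"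
    by (simp add: Lp_mod_cmult)
qed auto

lemma Lp_multiplier_fourier:
  assumes K: "integrable lborel K" and p: "1 \<le> p"
  shows "Lp_multiplier p (fourier K)"
proof -
  have "Lp_mod p (inv_fourier (\<lambda>\<xi>. fourier K \<xi> * H \<xi>)) \<le> ennreal ((LINT y|lborel. norm (K y)) powr p) * Lp_mod p (inv_fourier H)"
    if "integrable lborel H" for H
    unfolding inv_fourier_fourier_mult[OF K that]
    by (rule Lp_mod_conv_le[OF K inv_fourier_measurable norm_inv_fourier_le[OF that] p]) (use that in auto)
  moreover have "fourier K \<in> borel_measurable borel" using K by (intro fourier_measurable) auto
  ultimately show ?thesis
    by (intro Lp_multiplierI[OF _ norm_fourier_le[OF K] powr_ge_zero])
qed

text \<open>Needed because the symbols (1 - b)^a are matched with transforms of kernels only for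
  \<open>\<xi> \<noteq> 0\<close>.\<close>

lemma Lp_multiplier_cong_AE:
  assumes m: "Lp_multiplier p m" and [measurable]: "m' \<in> borel_measurable borel"
    and B: "\<And>\<xi>. norm (m' \<xi>) \<le> B" and eq: "AE \<xi> in lborel. m \<xi> = m' \<xi>"
  shows "Lp_multiplier p m'"
proof -
  obtain B0 C where [measurable]: "m \<in> borel_measurable borel" and "\<And>\<xi>. norm (m \<xi>) \<le> B0" "0 \<le> B0"
    and C: "0 \<le> C" "\<And>H. integrable lborel H \<Longrightarrow>
    Lp_mod p (inv_fourier (\<lambda>\<xi>. m \<xi> * H \<xi>)) \<le> ennreal C * Lp_mod p (inv_fourier H)"
    using Lp_multiplierE[OF m] by blast
  show ?thesis
  proof (rule Lp_multiplierI[OF _ B C(1)])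
    fix H :: "real ^ 'a \<Rightarrow> complex" assume H: "integrable lborel H"
    then have [measurable]: "H \<in> borel_measurable borel" by auto
    have "AE \<xi> in lborel. m \<xi> * H \<xi> = m' \<xi> * H \<xi>" using eq by eventually_elim simp
    then have "inv_fourier (\<lambda>\<xi>. m \<xi> * H \<xi>) = inv_fourier (\<lambda>\<xi>. m' \<xi> * H \<xi>)"
      by (rule inv_fourier_cong_AE) measurable
    then show "Lp_mod p (inv_fourier (\<lambda>\<xi>. m' \<xi> * H \<xi>)) \<le> ennreal C * Lp_mod p (inv_fourier H)"
      using C(2)[OF H] by simp
  qed measurable
qed

subsection \<open>Bessel kernels\<close>

text \<open>Used with l = 1 + |xi|^2, where it produces \<open>bsym \<xi> powr a\<close>.\<close>

lemma has_bochner_integral_Gamma: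
  fixes a l :: real
  assumes a: "0 < a" and l: "0 < l"
  shows "has_bochner_integral lborel (\<lambda>u. indicator {0..} u * (u powr (a - 1) * exp (- (l * u)))) (Gamma a * l powr - a)"
proof (rule has_bochner_integral_nn_integral)
  let ?g = "\<lambda>u::real. indicator {0..} u * (u powr (a - 1) * exp (- u))"
  have g: "(\<integral>\<^sup>+u. ennreal (?g u) \<partial>lborel) = ennreal (Gamma a)"
  proof -
    have "(\<integral>\<^sup>+u. ennreal (indicator {0..} u * (u powr (a - 1) / exp u)) \<partial>lborel) = ennreal (Gamma a)"
      by (rule nn_integral_has_integral_lebesgue[OF _ Gamma_integral_real[OF a]]) simp
    then show ?thesis by (simp add: exp_minus divide_inverse)
  qed
  have "(\<integral>\<^sup>+u. ennreal (?g u) \<partial>lborel) = ennreal l * (\<integral>\<^sup>+u. ennreal (?g (0 + l * u)) \<partial>lborel)"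
    using l by (subst nn_integral_real_affine[of _ l 0]) auto
  also have "(\<integral>\<^sup>+u. ennreal (?g (0 + l * u)) \<partial>lborel) =
      (\<integral>\<^sup>+u. ennreal (l powr (a - 1)) * ennreal (indicator {0..} u * (u powr (a - 1) * exp (- (l * u)))) \<partial>lborel)"
  proof (rule nn_integral_cong)
    fix u :: real
    have "?g (0 + l * u) = l powr (a - 1) * (indicator {0..} u * (u powr (a - 1) * exp (- (l * u))))"
      using l by (auto simp: indicator_def powr_mult zero_le_mult_iff)
    then show "ennreal (?g (0 + l * u)) = ennreal (l powr (a - 1)) * ennreal (indicator {0..} u * (u powr (a - 1) * exp (- (l * u))))"
      by (simp only: ennreal_mult'[OF powr_ge_zero])
  qed
  also have "\<dots> = ennreal (l powr (a - 1)) * (\<integral>\<^sup>+u. ennreal (indicator {0..} u * (u powr (a - 1) * exp (- (l * u)))) \<partial>lborel)"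
    by (rule nn_integral_cmult) measurable
  finally have "ennreal (Gamma a) = ennreal l * (ennreal (l powr (a - 1)) * (\<integral>\<^sup>+u. ennreal (indicator {0..} u * (u powr (a - 1) * exp (- (l * u)))) \<partial>lborel))"
    unfolding g .
  moreover have "ennreal l * ennreal (l powr (a - 1)) = ennreal (l powr a)"
    using l by (simp add: powr_diff flip: ennreal_mult)
  ultimately have eq: "ennreal (Gamma a) = ennreal (l powr a) * (\<integral>\<^sup>+u. ennreal (indicator {0..} u * (u powr (a - 1) * exp (- (l * u)))) \<partial>lborel)" (is "_ = _ * ?I")
    by (simp only: mult.assoc[symmetric])
  have "ennreal (l powr - a) * (ennreal (l powr a) * ?I) = ?I"
    using l by (simp add: mult.assoc[symmetric] powr_minus flip: ennreal_mult)
  then show "?I = ennreal (Gamma a * l powr - a)"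
    unfolding eq[symmetric] using Gamma_real_pos[OF a] by (simp add: ennreal_mult mult.commute)
  show "0 \<le> Gamma a * l powr - a" using Gamma_real_pos[OF a] by simp
qed auto

definition bsym :: "real ^ 'n \<Rightarrow> real" where
  "bsym \<xi> = inverse (1 + (norm \<xi>)\<^sup>2)"

lemma bsym_pos: "0 < bsym \<xi>" and bsym_le_1: "bsym \<xi> \<le> 1"
  by (auto simp: bsym_def add_pos_nonneg inverse_le_1_iff)

lemma bsym_less_1: "\<xi> \<noteq> 0 \<Longrightarrow> bsym \<xi> < 1"
  by (simp add: bsym_def inverse_less_1_iff)

lemma bsym_measurable[measurable]: "bsym \<in> borel_measurable borel"
  unfolding bsym_def[abs_def] by measurable

definition heat :: "real \<Rightarrow> real ^ 'n \<Rightarrow> complex" where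
  "heat u x = of_real ((4 * pi * u) powr (- (CARD('n) / 2)) * exp (- (norm x)\<^sup>2 / (4 * u)))"

lemma heat_gauss: "heat u x = of_real ((4 * pi * u) powr (- (CARD('n) / 2))) * gauss (1 / (4 * u)) x" for x :: "real ^ 'n"
  by (simp add: heat_def gauss_def)

lemma fourier_heat:
  fixes \<xi> :: "real ^ 'n"
  assumes "0 < u"
  shows "fourier (heat u) \<xi> = of_real (exp (- (u * (norm \<xi>)\<^sup>2)))"
proof -
  have "fourier (heat u) \<xi> = of_real ((4 * pi * u) powr (- (CARD('n) / 2))) * fourier (gauss (1 / (4 * u))) \<xi>"
    unfolding heat_gauss fourier_cmult ..
  also have "\<dots> = of_real ((4 * pi * u) powr (- (CARD('n) / 2)) * (4 * pi * u) powr (CARD('n) / 2)) * gauss u \<xi>"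
    using assms by (subst fourier_gauss) (simp_all add: mult_ac)
  also have "(4 * pi * u) powr (- (CARD('n) / 2)) * (4 * pi * u) powr (CARD('n) / 2) = 1"
    using assms by (simp flip: powr_add)
  finally show ?thesis by (simp add: gauss_def)
qed

lemma integrable_heat: "0 < u \<Longrightarrow> integrable lborel (heat u)"
  unfolding heat_gauss[abs_def] by (intro integrable_mult_right schwartz_integrable schwartz_gauss) simp

lemma integral_norm_heat:
  assumes "0 < u"
  shows "(LINT x|lborel. norm (heat u (x :: real ^ 'n))) = 1"
proof -
  have "heat u x = of_real (norm (heat u x))" for x :: "real ^ 'n"
    unfolding heat_def norm_of_real by simp
  then have "(LINT x|lborel. complex_of_real (norm (heat u (x :: real ^ 'n)))) = (LINT x|lborel. heat u (x :: real ^ 'n))"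
    by (simp only:)
  then have "of_real (LINT x|lborel. norm (heat u (x :: real ^ 'n))) = fourier (heat u) (0 :: real ^ 'n)"
    unfolding fourier_def by simp
  also have "\<dots> = of_real 1" by (simp add: fourier_heat[OF assms])
  finally show ?thesis by (simp only: of_real_eq_iff)
qed

text \<open>The mixture of heat kernels with respect to the Gamma density. That density has total
  mass 1, which bounds the mass of \<open>G\<close> by 1 for every \<open>a\<close>; this uniformity
  lets infinitely many such kernels be summed.\<close>

lemma Bessel_kernel:
  fixes a :: real
  assumes a: "0 < a"
  obtains G :: "real ^ 'n \<Rightarrow> complex" where "integrable lborel G" "\<And>\<xi>. fourier G \<xi> = of_real (bsym \<xi> powr a)"
    "(LINT x|lborel. norm (G x)) \<le> 1"
proof -
  define g where "g u = inverse (Gamma a) * (indicator {0..} u * (u powr (a - 1) * exp (- u)))" for u :: real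
  define P where "P z = of_real (g (fst z)) * (heat (fst z) (snd z) :: complex)" for z :: "real \<times> (real ^ 'n)"
  have \<Gamma>: "0 < Gamma a" using Gamma_real_pos[OF a] .
  have g0: "0 \<le> g u" for u using \<Gamma> by (simp add: g_def)
  \<comment> \<open>At u = 0 this rests on the value \<open>0 powr (a - 1) = 0\<close>; the density
    thus sees only times u > 0, where \<open>heat u\<close> is a genuine heat kernel.\<close>
  have gz: "g u = 0" if "u \<le> 0" for u using that by (cases "u = 0") (auto simp: g_def indicator_def)
  have [measurable]: "g \<in> borel_measurable borel" unfolding g_def[abs_def] by measurable
  have gl: "has_bochner_integral lborel (\<lambda>u. g u * exp (- (u * r))) ((1 + r) powr - a)" if "0 \<le> r" for r
  proof -
    have "has_bochner_integral lborel (\<lambda>u. inverse (Gamma a) * (indicator {0..} u * (u powr (a - 1) * exp (- ((1 + r) * u)))))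
        (inverse (Gamma a) * (Gamma a * (1 + r) powr - a))"
      using that by (intro has_bochner_integral_mult_right has_bochner_integral_Gamma a) auto
    moreover have "inverse (Gamma a) * (indicator {0..} u * (u powr (a - 1) * exp (- ((1 + r) * u)))) = g u * exp (- (u * r))" for u
    proof -
      have e: "exp (- ((1 + r) * u)) = exp (- u) * exp (- (u * r))"
        by (simp add: exp_add[symmetric] algebra_simps)
      show ?thesis unfolding e g_def by (simp only: mult_ac)
    qed
    moreover have "inverse (Gamma a) * (Gamma a * X) = X" for X using \<Gamma> by simp
    ultimately show ?thesis by (simp only:)
  qed
  have gi: "integrable lborel g" "(LINT u|lborel. g u) = 1"
    using gl[of 0] by (auto simp: has_bochner_integral_iff)
  have Pm[measurable]: "P \<in> borel_measurable (lborel \<Otimes>\<^sub>M lborel)"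
    unfolding P_def heat_def by measurable
  have inner: "integrable lborel (\<lambda>x. P (u, x))" "(LINT x|lborel. norm (P (u, x))) = g u" for u
  proof -
    show "integrable lborel (\<lambda>x. P (u, x))"
      by (cases "0 < u") (auto simp: P_def gz integrable_heat)
    show "(LINT x|lborel. norm (P (u, x))) = g u"
      by (cases "0 < u") (auto simp: P_def gz norm_mult integral_norm_heat g0)
  qed
  have Pi: "integrable (lborel \<Otimes>\<^sub>M lborel) P"
    by (rule lborel_pair.Fubini_integrable[OF Pm]) (use gi inner in auto)
  define G where "G x = (LINT u|lborel. P (u, x))" for x
  have iG: "integrable lborel G"
    unfolding G_def[abs_def] by (rule lborel_pair.integrable_snd) (simp add: split_def Pi)
  show ?thesis
  proof
    show "integrable lborel G" by (rule iG)
    have Pn: "integrable (lborel \<Otimes>\<^sub>M lborel) (\<lambda>z. norm (P z))" using Pi by simp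
    have "(LINT x|lborel. norm (G x)) \<le> (LINT x|lborel. (LINT u|lborel. norm (P (u, x))))"
    proof (rule integral_mono)
      show "integrable lborel (\<lambda>x. norm (G x))" using iG by simp
      show "integrable lborel (\<lambda>x. LINT u|lborel. norm (P (u, x)))"
        by (rule lborel_pair.integrable_snd) (simp add: split_def Pn)
      show "norm (G x) \<le> (LINT u|lborel. norm (P (u, x)))" for x
        unfolding G_def by (rule integral_norm_bound)
    qed
    also have "\<dots> = (LINT u|lborel. (LINT x|lborel. norm (P (u, x))))"
      by (rule lborel_pair.Fubini_integral) (simp add: split_def Pn)
    also have "\<dots> = 1" by (simp add: inner gi)
    finally show "(LINT x|lborel. norm (G x)) \<le> 1" .
    fix \<xi> :: "real ^ 'n"
    have Pc: "integrable (lborel \<Otimes>\<^sub>M lborel) (\<lambda>z. cis (- (snd z \<bullet> \<xi>)) * P z)"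
      by (rule integrable_cis_mult[OF Pi]) measurable
    have "fourier G \<xi> = (LINT x|lborel. (LINT u|lborel. cis (- (x \<bullet> \<xi>)) * P (u, x)))"
      unfolding fourier_def G_def by (simp only: integral_mult_right_zero)
    also have "\<dots> = (LINT u|lborel. (LINT x|lborel. cis (- (x \<bullet> \<xi>)) * P (u, x)))"
      by (rule lborel_pair.Fubini_integral) (simp add: split_def Pc)
    also have "\<dots> = (LINT u|lborel. of_real (g u * exp (- (u * (norm \<xi>)\<^sup>2))))"
    proof (intro Bochner_Integration.integral_cong refl)
      fix u :: real
      have "(LINT x|lborel. cis (- (x \<bullet> \<xi>)) * P (u, x)) = of_real (g u) * fourier (heat u) \<xi>"
        unfolding P_def fourier_def fst_conv snd_conv mult.left_commute[of "cis _"] by (simp only: integral_mult_right_zero)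
      then show "(LINT x|lborel. cis (- (x \<bullet> \<xi>)) * P (u, x)) = of_real (g u * exp (- (u * (norm \<xi>)\<^sup>2)))"
        by (cases "0 < u") (simp_all add: fourier_heat gz)
    qed
    also have "\<dots> = of_real ((1 + (norm \<xi>)\<^sup>2) powr - a)"
      unfolding has_bochner_integral_integral_eq[OF gl[OF zero_le_power2], symmetric]
      by (rule integral_complex_of_real)
    also have "(1 + (norm \<xi>)\<^sup>2) powr - a = bsym \<xi> powr a"
      unfolding bsym_def by (simp add: inverse_powr powr_minus add_nonneg_nonneg)
    finally show "fourier G \<xi> = of_real (bsym \<xi> powr a)" .
  qed
qed

text \<open>The coefficients are O(n^(-a-1)), so for a > 0 the binomial series converges absolutely
  even on the boundary of its disc. The kernels of b^m are bounded in L^1 only by 1, which is why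
  the boundary case is the one required.\<close>

lemma summable_abs_gbinomial:
  fixes a :: real
  assumes a: "0 < a"
  shows "summable (\<lambda>m. \<bar>a gchoose m\<bar>)"
proof -
  have "Bseq (\<lambda>n. (a gchoose n) / ((-1) ^ n / exp ((a + 1) * of_real (ln (real n)))))"
    using gbinomial_asymptotic[of a] by (intro convergent_imp_Bseq) (auto simp: convergent_def)
  then obtain K where K: "\<And>n. norm ((a gchoose n) / ((-1) ^ n / exp ((a + 1) * of_real (ln (real n))))) \<le> K"
    unfolding Bseq_def by blast
  have "\<forall>\<^sub>F n in sequentially. norm \<bar>a gchoose n\<bar> \<le> K * real n powr (- (a + 1))"
    using eventually_gt_at_top[of 0]
  proof eventually_elim
    case (elim n)
    have "exp ((a + 1) * ln (real n)) = real n powr (a + 1)"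
      using elim by (simp add: powr_def)
    then have "\<bar>a gchoose n\<bar> * real n powr (a + 1) \<le> K"
      using K[of n] by (simp add: abs_mult abs_divide power_abs)
    then have "\<bar>a gchoose n\<bar> * real n powr (a + 1) * real n powr (- (a + 1)) \<le> K * real n powr (- (a + 1))"
      by (rule mult_right_mono) simp
    moreover have "real n powr (a + 1) * real n powr (- (a + 1)) = 1"
      using elim by (simp flip: powr_add)
    ultimately show ?case by (simp add: mult.assoc)
  qed
  then show ?thesis
    by (rule summable_comparison_test_ev) (use a in \<open>auto intro!: summable_mult simp: summable_real_powr_iff\<close>)
qed

text \<open>The constant term of the binomial series has no integrable kernel, so it stays outside
  as the 1, and \<open>K\<close> collects the powers from \<open>Suc m\<close> on. The origin is
  left out because b = 1 there, while the series is evaluated for |b| < 1.\<close>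

lemma one_minus_bsym_powr_kernel:
  fixes a :: real
  assumes a: "0 < a"
  obtains K :: "real ^ 'n \<Rightarrow> complex" where "integrable lborel K"
    "\<And>\<xi>. \<xi> \<noteq> 0 \<Longrightarrow> fourier K \<xi> = 1 - of_real ((1 - bsym \<xi>) powr a)"
proof -
  have "\<exists>G. \<forall>m. integrable lborel (G m :: real ^ 'n \<Rightarrow> complex) \<and> (\<forall>\<xi>. fourier (G m) \<xi> = of_real (bsym \<xi> powr real (Suc m))) \<and>
      (LINT x|lborel. norm (G m x)) \<le> 1"
  proof (rule choice, rule allI)
    fix m :: nat
    have "0 < real (Suc m)" by simp
    then obtain G :: "real ^ 'n \<Rightarrow> complex" where "integrable lborel G" "\<And>\<xi>. fourier G \<xi> = of_real (bsym \<xi> powr real (Suc m))"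
      "(LINT x|lborel. norm (G x)) \<le> 1"
      using Bessel_kernel[of "real (Suc m)"] by blast
    then show "\<exists>G. integrable lborel (G :: real ^ 'n \<Rightarrow> complex) \<and> (\<forall>\<xi>. fourier G \<xi> = of_real (bsym \<xi> powr real (Suc m))) \<and>
      (LINT x|lborel. norm (G x)) \<le> 1"
      by (intro exI[of _ G] conjI allI)
  qed
  then obtain G :: "nat \<Rightarrow> real ^ 'n \<Rightarrow> complex" where G: "\<And>m. integrable lborel (G m)"
    "\<And>m \<xi>. fourier (G m) \<xi> = of_real (bsym \<xi> powr real (Suc m))" "\<And>m. (LINT x|lborel. norm (G m x)) \<le> 1"
    by blast
  \<comment> \<open>The sign in front turns the tail of the series for (1 - b)^a into 1 - (1 -
    b)^a.\<close>
  define c where "c m = - ((a gchoose Suc m) * (-1) ^ Suc m)" for m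
  have sc: "summable (\<lambda>m. \<bar>c m\<bar>)"
    using summable_abs_gbinomial[OF a] unfolding c_def by (subst (asm) summable_Suc_iff[symmetric]) (simp add: abs_mult power_abs)
  let ?f = "\<lambda>m x. of_real (c m) * G m x"
  have [measurable]: "G m \<in> borel_measurable borel" for m using G(1)[of m] by auto
  have fi: "integrable lborel (?f m)" for m by (intro integrable_mult_right G)
  have fn: "(LINT x|lborel. norm (?f m x)) \<le> \<bar>c m\<bar>" for m
    using mult_left_mono[OF G(3)[of m], of "\<bar>c m\<bar>"] by (simp add: norm_mult)
  have sn: "summable (\<lambda>m. LINT x|lborel. norm (?f m x))"
    by (rule summable_comparison_test'[OF sc, of 0]) (use fn in simp)
  have AEs: "AE x in lborel. summable (\<lambda>m. norm (?f m x))"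
  proof -
    have "(\<integral>\<^sup>+x. (\<Sum>m. ennreal (norm (?f m x))) \<partial>lborel) = (\<Sum>m. (\<integral>\<^sup>+x. ennreal (norm (?f m x)) \<partial>lborel))"
      by (rule nn_integral_suminf) measurable
    also have "\<dots> = (\<Sum>m. ennreal (LINT x|lborel. norm (?f m x)))"
      by (intro arg_cong[where f = suminf] ext nn_integral_eq_integral integrable_norm fi) simp
    also have "\<dots> = ennreal (\<Sum>m. LINT x|lborel. norm (?f m x))"
      by (intro suminf_ennreal2 sn) simp
    also have "\<dots> < \<infinity>" by simp
    finally have "AE x in lborel. (\<Sum>m. ennreal (norm (?f m x))) \<noteq> \<infinity>"
      by (intro nn_integral_noteq_infinite) auto
    then show ?thesis
      by eventually_elim (auto intro: summable_suminf_not_top)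
  qed
  define K where "K x = (\<Sum>m. ?f m x)" for x
  have iK: "integrable lborel K" unfolding K_def[abs_def] by (rule integrable_suminf[OF fi AEs sn])
  show ?thesis
  proof
    show "integrable lborel K" by (rule iK)
    fix \<xi> :: "real ^ 'n" assume \<xi>: "\<xi> \<noteq> 0"
    let ?h = "\<lambda>m x. cis (- (x \<bullet> \<xi>)) * ?f m x"
    have hi: "integrable lborel (?h m)" for m by (intro integrable_cis_mult fi) auto
    have hn: "norm (?h m x) = norm (?f m x)" for m x by (simp add: norm_mult)
    have h: "(\<lambda>m. LINT x|lborel. ?h m x) sums (LINT x|lborel. (\<Sum>m. ?h m x))"
      by (rule sums_integral[OF hi]) (unfold hn, fact+)
    have hm: "(LINT x|lborel. ?h m x) = of_real (c m * bsym \<xi> ^ Suc m)" for m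
    proof -
      have "(LINT x|lborel. ?h m x) = of_real (c m) * fourier (G m) \<xi>"
        unfolding fourier_cmult[symmetric] by (simp only: fourier_def)
      then show ?thesis using bsym_pos[of \<xi>] by (simp only: G(2) of_real_mult powr_realpow)
    qed
    have "(LINT x|lborel. (\<Sum>m. ?h m x)) = fourier K \<xi>"
      unfolding fourier_def
    proof (rule integral_cong_AE)
      have [measurable]: "K \<in> borel_measurable borel" using iK by auto
      show "(\<lambda>x. cis (- (x \<bullet> \<xi>)) * K x) \<in> borel_measurable lborel" by measurable
      show "(\<lambda>x. \<Sum>m. ?h m x) \<in> borel_measurable lborel" by measurable
      show "AE x in lborel. (\<Sum>m. ?h m x) = cis (- (x \<bullet> \<xi>)) * K x"
        using AEs
      proof eventually_elim
        case (elim x)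
        show ?case unfolding K_def by (rule suminf_mult[OF summable_norm_cancel[OF elim]])
      qed
    qed
    with h have s1: "(\<lambda>m. of_real (c m * bsym \<xi> ^ Suc m)) sums fourier K \<xi>"
      unfolding hm by simp
    have "(\<lambda>n. (a gchoose n) * (- bsym \<xi>) ^ n) sums (1 + - bsym \<xi>) powr a"
      using bsym_pos[of \<xi>] bsym_less_1[OF \<xi>] by (intro gen_binomial_real) auto
    then have "(\<lambda>n. (a gchoose Suc n) * (- bsym \<xi>) ^ Suc n) sums ((1 - bsym \<xi>) powr a - 1)"
      by (subst sums_Suc_iff) simp
    then have "(\<lambda>n. - ((a gchoose Suc n) * (- bsym \<xi>) ^ Suc n)) sums - ((1 - bsym \<xi>) powr a - 1)"
      by (rule sums_minus)
    moreover have "- ((a gchoose Suc n) * (- bsym \<xi>) ^ Suc n) = c n * bsym \<xi> ^ Suc n" for n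
      unfolding c_def power_minus[of "bsym \<xi>"] by (simp only: mult_minus_left mult.assoc)
    ultimately have "(\<lambda>n. c n * bsym \<xi> ^ Suc n) sums (1 - (1 - bsym \<xi>) powr a)"
      by (simp only: minus_diff_eq)
    then have "(\<lambda>n. complex_of_real (c n * bsym \<xi> ^ Suc n)) sums of_real (1 - (1 - bsym \<xi>) powr a)"
      by (rule sums_of_real)
    from sums_unique2[OF s1 this] show "fourier K \<xi> = 1 - of_real ((1 - bsym \<xi>) powr a)" by simp
  qed
qed

lemma AE_nonzero: "AE \<xi> in lborel. \<xi> \<noteq> (0 :: real ^ 'n)"
  by (rule AE_lborel_singleton)

lemma Lp_multiplier_bsym_powr:
  assumes "0 \<le> a" "1 \<le> p"
  shows "Lp_multiplier p (\<lambda>\<xi>. of_real (bsym \<xi> powr a))"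
proof (cases "a = 0")
  case True
  have "complex_of_real (bsym \<xi> powr a) = 1" for \<xi> :: "real ^ 'a"
    using bsym_pos[of \<xi>] True by simp
  then show ?thesis using Lp_multiplier_const[of p 1] by (simp only:)
next
  case False
  then have "0 < a" using assms by simp
  then obtain G :: "real ^ 'a \<Rightarrow> complex" where G: "integrable lborel G" "\<And>\<xi>. fourier G \<xi> = of_real (bsym \<xi> powr a)"
    using Bessel_kernel by blast
  have "fourier G = (\<lambda>\<xi>. of_real (bsym \<xi> powr a))" by (rule ext) (rule G(2))
  then show ?thesis using Lp_multiplier_fourier[OF G(1) assms(2)] by simp
qed

lemma Lp_multiplier_one_minus_bsym_powr:
  assumes "0 \<le> a" "1 \<le> p"
  shows "Lp_multiplier p (\<lambda>\<xi>. of_real ((1 - bsym \<xi>) powr a))"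
proof -
  have b: "norm (complex_of_real ((1 - bsym \<xi>) powr a)) \<le> 1" for \<xi> :: "real ^ 'a"
    unfolding norm_of_real using bsym_pos[of \<xi>] bsym_le_1[of \<xi>] assms(1) by (simp add: powr_le1)
  show ?thesis
  proof (cases "a = 0")
    \<comment> \<open>At the origin the symbol is \<open>0 powr 0\<close>, which is 0, so it equals
      1 only almost everywhere.\<close>
    case True
    show ?thesis
    proof (rule Lp_multiplier_cong_AE[OF Lp_multiplier_const[of p 1] _ b])
      show "AE \<xi> in lborel. 1 = complex_of_real ((1 - bsym \<xi>) powr a)"
        using AE_nonzero by eventually_elim (use True bsym_less_1 in fastforce)
    qed measurable
  next
    case False
    then have "0 < a" using assms by simp
    then obtain K :: "real ^ 'a \<Rightarrow> complex" where K: "integrable lborel K"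
      "\<And>\<xi>. \<xi> \<noteq> 0 \<Longrightarrow> fourier K \<xi> = 1 - of_real ((1 - bsym \<xi>) powr a)"
      using one_minus_bsym_powr_kernel by blast
    have "Lp_multiplier p (\<lambda>\<xi>. 1 + (- 1) * fourier K \<xi>)"
      using assms(2) by (intro Lp_multiplier_add Lp_multiplier_mult Lp_multiplier_const Lp_multiplier_fourier K) auto
    then show ?thesis
    proof (rule Lp_multiplier_cong_AE[OF _ _ b])
      show "AE \<xi> in lborel. 1 + (- 1) * fourier K \<xi> = complex_of_real ((1 - bsym \<xi>) powr a)"
        using AE_nonzero by eventually_elim (simp add: K(2))
    qed measurable
  qed
qed

subsection \<open>Estimates for Schwartz functions\<close>

text \<open>The operator (1 - Delta)^(r/2) on functions;
  \<open>bessel_potential_distr_of_schwartz\<close> matches it with \<open>bessel_potential\<close>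
  on distributions.\<close>

definition Bessel_schwartz :: "real \<Rightarrow> (real ^ 'n \<Rightarrow> complex) \<Rightarrow> real ^ 'n \<Rightarrow> complex" where
  "Bessel_schwartz r \<phi> = inv_fourier (\<lambda>\<xi>. of_real ((1 + (norm \<xi>)\<^sup>2) powr (r / 2)) * fourier \<phi> \<xi>)"

lemma integrable_Bessel_symbol:
  "\<phi> \<in> schwartz \<Longrightarrow> integrable lborel (\<lambda>\<xi>. of_real ((1 + (norm \<xi>)\<^sup>2) powr r) * fourier \<phi> \<xi>)"
  by (intro schwartz_integrable schwartz_one_plus_norm_square_powr schwartz_fourier)

lemma schwartz_Bessel: "\<phi> \<in> schwartz \<Longrightarrow> Bessel_schwartz r \<phi> \<in> schwartz"
  unfolding Bessel_schwartz_def
  by (intro schwartz_inv_fourier schwartz_one_plus_norm_square_powr schwartz_fourier)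

lemma norm_powr_le:
  fixes x :: "'a::real_normed_vector"
  assumes "0 \<le> s"
  shows "norm x powr s \<le> (1 + norm x) ^ nat \<lceil>s\<rceil>"
proof -
  have pos: "0 < 1 + norm x" by (simp add: add_pos_nonneg)
  have "norm x powr s \<le> (1 + norm x) powr s" using assms by (intro powr_mono2) auto
  also have "\<dots> \<le> (1 + norm x) powr real (nat \<lceil>s\<rceil>)" by (intro powr_mono) (auto simp: real_nat_ceiling_ge)
  also have "\<dots> = (1 + norm x) ^ nat \<lceil>s\<rceil>" by (rule powr_realpow[OF pos])
  finally show ?thesis .
qed

lemma rapid_norm_powr:
  "rapid f \<Longrightarrow> 0 \<le> s \<Longrightarrow> rapid (\<lambda>\<xi>. of_real (norm \<xi> powr s) * f \<xi>)"
  by (rule rapid_mult_polynomial_growth[where C = 1 and k = "nat \<lceil>s\<rceil>"]) (simp_all add: norm_powr_le)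

lemma integrable_norm_powr_fourier:
  assumes "\<phi> \<in> schwartz" "0 \<le> s"
  shows "integrable lborel (\<lambda>\<xi>. of_real (norm \<xi> powr s) * fourier \<phi> \<xi>)"
proof -
  have [measurable]: "fourier \<phi> \<in> borel_measurable borel" by (intro schwartz_measurable schwartz_fourier assms)
  show ?thesis
    by (intro rapid_integrable rapid_norm_powr schwartz_rapid schwartz_fourier assms) measurable
qed

lemma integrable_Bessel_norm_powr_fourier:
  assumes "\<phi> \<in> schwartz" "0 \<le> s"
  shows "integrable lborel (\<lambda>\<xi>. of_real ((1 + (norm \<xi>)\<^sup>2) powr r) * (of_real (norm \<xi> powr s) * fourier \<phi> \<xi>))"
proof -
  have [measurable]: "fourier \<phi> \<in> borel_measurable borel" by (intro schwartz_measurable schwartz_fourier assms)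
  show ?thesis
    by (intro rapid_integrable rapid_one_plus_norm_square_powr rapid_norm_powr schwartz_rapid schwartz_fourier assms) measurable
qed

text \<open>The form in which multipliers are applied: an identity between symbols has to be
  verified off the origin only, where no default values of \<open>powr\<close> interfere.\<close>

lemma Lp_multiplier_bound:
  assumes "Lp_multiplier p m"
  obtains C where "0 \<le> C" "\<And>G H. integrable lborel H \<Longrightarrow> G \<in> borel_measurable borel \<Longrightarrow>
    (\<And>\<xi>. \<xi> \<noteq> 0 \<Longrightarrow> G \<xi> = m \<xi> * H \<xi>) \<Longrightarrow> Lp_mod p (inv_fourier G) \<le> ennreal C * Lp_mod p (inv_fourier H)"
proof -
  obtain B C where [measurable]: "m \<in> borel_measurable borel" and "\<And>\<xi>. norm (m \<xi>) \<le> B" "0 \<le> B"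
    and C: "0 \<le> C" "\<And>H. integrable lborel H \<Longrightarrow>
      Lp_mod p (inv_fourier (\<lambda>\<xi>. m \<xi> * H \<xi>)) \<le> ennreal C * Lp_mod p (inv_fourier H)"
    using Lp_multiplierE[OF assms] by blast
  show ?thesis
  proof (rule that[OF C(1)])
    fix G H :: "real ^ 'a \<Rightarrow> complex"
    assume H: "integrable lborel H" and [measurable]: "G \<in> borel_measurable borel"
      and eq: "\<And>\<xi>. \<xi> \<noteq> 0 \<Longrightarrow> G \<xi> = m \<xi> * H \<xi>"
    have [measurable]: "H \<in> borel_measurable borel" using H by auto
    have "inv_fourier G = inv_fourier (\<lambda>\<xi>. m \<xi> * H \<xi>)"
    proof (rule inv_fourier_cong_AE)
      show "AE \<xi> in lborel. G \<xi> = m \<xi> * H \<xi>" using AE_nonzero by eventually_elim (rule eq)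
    qed measurable
    then show "Lp_mod p (inv_fourier G) \<le> ennreal C * Lp_mod p (inv_fourier H)" using C(2)[OF H] by simp
  qed
qed

lemma one_minus_bsym: "1 - bsym \<xi> = (norm \<xi>)\<^sup>2 * bsym \<xi>"
proof -
  have "1 + (norm \<xi>)\<^sup>2 \<noteq> 0" by (simp add: add_nonneg_eq_0_iff)
  then show ?thesis by (simp add: bsym_def field_simps)
qed

text \<open>With \<open>Bessel_symbol_bsym\<close> this translates the symbols in use into powers of
  b and 1 - b, the two families known to be multipliers.\<close>

lemma one_minus_bsym_powr: "(1 - bsym \<xi>) powr (a / 2) = norm \<xi> powr a * bsym \<xi> powr (a / 2)"
proof -
  have "((norm \<xi>)\<^sup>2) powr (a / 2) = norm \<xi> powr a"
  proof (cases "\<xi> = 0")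
    case False
    then have "(norm \<xi> powr 2) powr (a / 2) = norm \<xi> powr a" by (simp only: powr_powr) simp
    then show ?thesis using False by simp
  qed simp
  then show ?thesis
    unfolding one_minus_bsym using bsym_pos[of \<xi>] by (simp add: powr_mult)
qed

lemma Bessel_symbol_bsym: "(1 + (norm \<xi>)\<^sup>2) powr a = bsym \<xi> powr - a"
  unfolding bsym_def by (simp add: inverse_powr powr_minus add_nonneg_nonneg)

lemma scaled_kernel:
  fixes K :: "real ^ 'n \<Rightarrow> complex"
  assumes K: "integrable lborel K" and e: "0 < e"
  shows "integrable lborel (\<lambda>x. of_real (e ^ CARD('n)) * K (e *\<^sub>R x))"
    and "fourier (\<lambda>x. of_real (e ^ CARD('n)) * K (e *\<^sub>R x)) \<xi> = fourier K (\<xi> /\<^sub>R e)"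
proof -
  have [measurable]: "K \<in> borel_measurable borel" using K by auto
  show "integrable lborel (\<lambda>x. of_real (e ^ CARD('n)) * K (e *\<^sub>R x))"
    using integrable_lborel_affine[OF K, of e 0] e by (intro integrable_mult_right) simp
  have "fourier K (\<xi> /\<^sub>R e) = (e ^ CARD('n)) *\<^sub>R (LINT x|lborel. cis (- ((e *\<^sub>R x) \<bullet> (\<xi> /\<^sub>R e))) * K (e *\<^sub>R x))"
    unfolding fourier_def using integral_lborel_affine[of "\<lambda>x. cis (- (x \<bullet> (\<xi> /\<^sub>R e))) * K x" e 0] e by simp
  then show "fourier (\<lambda>x. of_real (e ^ CARD('n)) * K (e *\<^sub>R x)) \<xi> = fourier K (\<xi> /\<^sub>R e)"
  proof -
    have "(e *\<^sub>R x) \<bullet> (\<xi> /\<^sub>R e) = x \<bullet> \<xi>" for x using e by simp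
    with \<open>fourier K (\<xi> /\<^sub>R e) = _\<close> show ?thesis
      unfolding fourier_cmult fourier_def[of "\<lambda>x. K (e *\<^sub>R x)"]
      by (simp only: scaleR_conv_of_real[where 'a = complex])
  qed
qed

text \<open>The slabs shrink to the hyperplane orthogonal to \<open>v\<close>, which is a null set;
  |K| is the majorant.\<close>

lemma slab_mass_tendsto_zero:
  fixes K :: "real ^ 'n \<Rightarrow> complex"
  assumes K: "integrable lborel K" and v: "v \<noteq> 0"
  shows "(\<lambda>k. LINT w|lborel. norm (K w) * indicator {w. \<bar>w \<bullet> v\<bar> \<le> R * (1 / real (Suc k))} w) \<longlonglongrightarrow> 0"
proof -
  have [measurable]: "K \<in> borel_measurable borel" using K by auto
  have "(\<lambda>k. LINT w|lborel. norm (K w) * indicator {w. \<bar>w \<bullet> v\<bar> \<le> R * (1 / real (Suc k))} w) \<longlonglongrightarrow> (LINT w|(lborel :: (real ^ 'n) measure). 0)"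
  proof (rule integral_dominated_convergence[where w = "\<lambda>w. norm (K w)"])
    show "integrable lborel (\<lambda>w. norm (K w))" using K by simp
    have "negligible {w. v \<bullet> w = 0}" using v by (intro negligible_hyperplane) simp
    then have "AE w in lebesgue. w \<notin> {w. v \<bullet> w = 0}"
      by (intro AE_not_in) (simp add: negligible_iff_null_sets)
    then have "AE w in lborel. w \<notin> {w. v \<bullet> w = 0}"
      by (simp add: AE_completion_iff)
    then show "AE w in lborel. (\<lambda>k. norm (K w) * indicator {w. \<bar>w \<bullet> v\<bar> \<le> R * (1 / real (Suc k))} w) \<longlonglongrightarrow> 0"
    proof eventually_elim
      case (elim w)
      then have pos: "0 < \<bar>w \<bullet> v\<bar>" by (simp add: inner_commute)
      have "(\<lambda>k. R * (1 / real (Suc k))) \<longlonglongrightarrow> 0"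
        by (intro tendsto_mult_right_zero LIMSEQ_Suc[OF lim_inverse_n'])
      then have "\<forall>\<^sub>F k in sequentially. R * (1 / real (Suc k)) < \<bar>w \<bullet> v\<bar>"
        using pos by (rule order_tendstoD)
      then have "\<forall>\<^sub>F k in sequentially. norm (K w) * indicator {w. \<bar>w \<bullet> v\<bar> \<le> R * (1 / real (Suc k))} w = 0"
        by eventually_elim (simp add: indicator_def)
      then show ?case by (rule tendsto_eventually)
    qed
    show "AE w in lborel. norm (norm (K w) * indicator {w. \<bar>w \<bullet> v\<bar> \<le> R * (1 / real (Suc k))} w) \<le> norm (K w)" for k
      by (intro AE_I2) (simp add: indicator_def)
  qed measurable
  then show ?thesis by simp
qed

lemma Lp_mod_mono:
  assumes "\<And>x. norm (f x) \<le> norm (g x)" "0 \<le> p"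
  shows "Lp_mod p f \<le> Lp_mod p g"
  unfolding Lp_mod_def using assms by (intro nn_integral_mono ennreal_leI powr_mono2) auto

text \<open>A function supported in a slab only sees the part of a convolution kernel that lives in
  the doubled slab, so Young's inequality applies with the mass of that part.\<close>

lemma Lp_mod_conv_slab_le:
  fixes K h :: "real ^ 'n \<Rightarrow> complex"
  assumes K: "integrable lborel K" and m: "h \<in> borel_measurable borel" and B: "\<And>x. norm (h x) \<le> B" and p: "1 \<le> p"
    and slab: "\<And>x. h x \<noteq> 0 \<Longrightarrow> \<bar>x \<bullet> v - c\<bar> \<le> R"
  shows "Lp_mod p (\<lambda>x. indicator {x. \<bar>x \<bullet> v - c\<bar> \<le> R} x * conv K h x) \<le>
    ennreal ((LINT y|lborel. norm (K y) * indicator {y. \<bar>y \<bullet> v\<bar> \<le> 2 * R} y) powr p) * Lp_mod p h"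
proof -
  have [measurable]: "K \<in> borel_measurable borel" using K by auto
  define K' where "K' y = K y * indicator {y. \<bar>y \<bullet> v\<bar> \<le> 2 * R} y" for y
  have K': "integrable lborel K'"
    unfolding K'_def[abs_def]
    by (rule Bochner_Integration.integrable_bound[OF K]) (measurable, simp add: norm_mult indicator_def)
  have le: "norm (indicator {x. \<bar>x \<bullet> v - c\<bar> \<le> R} x * conv K h x) \<le> norm (conv K' h x)" for x
  proof (cases "\<bar>x \<bullet> v - c\<bar> \<le> R")
    case True
    have eq: "K y * h (x - y) = K' y * h (x - y)" for y
    proof (cases "h (x - y) = 0")
      case False
      from slab[OF this] True have "\<bar>y \<bullet> v\<bar> \<le> 2 * R" by (simp add: inner_diff_left)
      then show ?thesis by (simp add: K'_def)
    qed simp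
    have "conv K h x = conv K' h x" unfolding conv_def by (simp only: eq)
    then show ?thesis using True by simp
  qed simp
  have n: "norm (K' y) = norm (K y) * indicator {y. \<bar>y \<bullet> v\<bar> \<le> 2 * R} y" for y
    by (simp add: K'_def norm_mult indicator_def)
  have "Lp_mod p (\<lambda>x. indicator {x. \<bar>x \<bullet> v - c\<bar> \<le> R} x * conv K h x) \<le> Lp_mod p (conv K' h)"
    using p by (intro Lp_mod_mono le) simp
  also have "\<dots> \<le> ennreal ((LINT y|lborel. norm (K' y)) powr p) * Lp_mod p h"
    by (rule Lp_mod_conv_le[OF K' m B p])
  finally show ?thesis unfolding n .
qed

text \<open>Finiteness of \<open>X\<close> permits subtracting half of it. In the application it
  holds because Schwartz functions lie in L^p.\<close>

lemma ennreal_absorb: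
  fixes X Z :: ennreal
  assumes "X < \<top>" "X \<le> ennreal (1 / 2) * X + Z"
  shows "X \<le> 2 * Z"
proof (cases "Z = \<top>")
  case False
  then obtain z where z: "Z = ennreal z" "0 \<le> z" by (cases Z) auto
  obtain x where x: "X = ennreal x" "0 \<le> x" using assms(1) by (cases X) auto
  have "ennreal (1 / 2 * x) = ennreal (1 / 2) * ennreal x"
    by (rule ennreal_mult) (use x in simp_all)
  moreover have "ennreal (1 / 2 * x + z) = ennreal (1 / 2 * x) + ennreal z"
    by (rule ennreal_plus) (use x z in simp_all)
  ultimately have "ennreal x \<le> ennreal (1 / 2 * x + z)"
    using assms(2) by (simp only: x(1) z(1))
  then have "x \<le> 1 / 2 * x + z" using x(2) z(2) by (subst (asm) ennreal_le_iff) auto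
  then have "ennreal x \<le> ennreal (2 * z)" by (intro ennreal_leI) simp
  then show ?thesis using x z by (simp add: ennreal_mult)
qed (simp add: ennreal_mult_top)

lemma slab_Poincare:
  fixes v :: "real ^ 'n"
  assumes p: "1 \<le> p" and t: "0 < t" and v: "v \<noteq> 0"
  obtains C where "0 \<le> C" "\<And>\<phi>. \<phi> \<in> schwartz \<Longrightarrow> (\<And>x. \<phi> x \<noteq> 0 \<Longrightarrow> \<bar>x \<bullet> v - c\<bar> \<le> R) \<Longrightarrow>
    Lp_mod p \<phi> \<le> ennreal C * Lp_mod p (frac_laplacian_schwartz t \<phi>)"
proof -
  obtain K :: "real ^ 'n \<Rightarrow> complex" where K: "integrable lborel K"
    "\<And>\<xi>. \<xi> \<noteq> 0 \<Longrightarrow> fourier K \<xi> = 1 - of_real ((1 - bsym \<xi>) powr (t / 2))"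
    using one_minus_bsym_powr_kernel[of "t / 2"] t by auto
  obtain G :: "real ^ 'n \<Rightarrow> complex" where G: "integrable lborel G" "\<And>\<xi>. fourier G \<xi> = of_real (bsym \<xi> powr (t / 2))"
    using Bessel_kernel[of "t / 2"] t by auto
  have "\<forall>\<^sub>F k in sequentially. (LINT w|lborel. norm (K w) * indicator {w. \<bar>w \<bullet> v\<bar> \<le> (2 * R) * (1 / real (Suc k))} w) < 1 / 4"
    using slab_mass_tendsto_zero[OF K(1) v, of "2 * R"] by (rule order_tendstoD) simp
  \<comment> \<open>Mass 1/4 compensates the factor 2^p of the quasi-triangle inequality: 2^p
    (1/4)^p = (1/2)^p <= 1/2 for p >= 1.\<close>
  then obtain k where k: "(LINT w|lborel. norm (K w) * indicator {w. \<bar>w \<bullet> v\<bar> \<le> (2 * R) * (1 / real (Suc k))} w) < 1 / 4"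
    unfolding eventually_sequentially by blast
  define e where "e = 1 / real (Suc k)"
  have e: "0 < e" by (simp add: e_def)
  \<comment> \<open>The dilation keeps the mass: the part of \<open>Ke\<close> with |y . v| <= 2 R
    has the mass of the part of \<open>K\<close> with |w . v| <= 2 R e.\<close>
  define Ke where "Ke x = of_real (e ^ CARD('n)) * K (e *\<^sub>R x)" for x
  define Ge where "Ge x = of_real (e ^ CARD('n)) * G (e *\<^sub>R x)" for x
  have Ke: "integrable lborel Ke" "fourier Ke \<xi> = fourier K (\<xi> /\<^sub>R e)" for \<xi>
    unfolding Ke_def[abs_def] using scaled_kernel[OF K(1) e] by auto
  have Ge: "integrable lborel Ge" "fourier Ge \<xi> = fourier G (\<xi> /\<^sub>R e)" for \<xi>
    unfolding Ge_def[abs_def] using scaled_kernel[OF G(1) e] by auto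
  have mass: "(LINT y|lborel. norm (Ke y) * indicator {y. \<bar>y \<bullet> v\<bar> \<le> 2 * R} y) < 1 / 4"
  proof -
    have [measurable]: "K \<in> borel_measurable borel" using K(1) by auto
    have "(LINT w|lborel. norm (K w) * indicator {w. \<bar>w \<bullet> v\<bar> \<le> (2 * R) * e} w) =
        (e ^ CARD('n)) * (LINT y|lborel. norm (K (e *\<^sub>R y)) * indicator {w. \<bar>w \<bullet> v\<bar> \<le> (2 * R) * e} (e *\<^sub>R y))"
      using integral_lborel_affine[of "\<lambda>w. norm (K w) * indicator {w. \<bar>w \<bullet> v\<bar> \<le> (2 * R) * e} w" e 0] e by simp
    also have "\<dots> = (LINT y|lborel. (e ^ CARD('n)) * (norm (K (e *\<^sub>R y)) * indicator {w. \<bar>w \<bullet> v\<bar> \<le> (2 * R) * e} (e *\<^sub>R y)))"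
      by (rule integral_mult_right_zero[symmetric])
    also have "\<dots> = (LINT y|lborel. norm (Ke y) * indicator {y. \<bar>y \<bullet> v\<bar> \<le> 2 * R} y)"
    proof (intro Bochner_Integration.integral_cong refl)
      fix y :: "real ^ 'n"
      have "\<bar>(e *\<^sub>R y) \<bullet> v\<bar> \<le> (2 * R) * e \<longleftrightarrow> \<bar>y \<bullet> v\<bar> \<le> 2 * R"
        using e by (simp add: abs_mult mult.commute[of e])
      then show "(e ^ CARD('n)) * (norm (K (e *\<^sub>R y)) * indicator {w. \<bar>w \<bullet> v\<bar> \<le> (2 * R) * e} (e *\<^sub>R y)) =
          norm (Ke y) * indicator {y. \<bar>y \<bullet> v\<bar> \<le> 2 * R} y"
        using e by (simp add: Ke_def norm_mult norm_power indicator_def)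
    qed
    finally show ?thesis using k unfolding e_def[symmetric] by simp
  qed
  \<comment> \<open>Off the origin 1 - \<open>fourier Ke \<xi>\<close> is (1 - b(xi/e))^(t/2) =
    e^(-t) b(xi/e)^(t/2) |xi|^t, and b(xi/e)^(t/2) is the transform of \<open>Ge\<close>. The factor
    e^(-t) is the price of the dilation.\<close>
  have Ge_mult: "Lp_multiplier p (\<lambda>\<xi>. of_real (e powr - t) * fourier Ge \<xi>)"
    by (intro Lp_multiplier_mult Lp_multiplier_const Lp_multiplier_fourier Ge p)
  obtain C where C: "0 \<le> C" "\<And>F H. integrable lborel H \<Longrightarrow> F \<in> borel_measurable borel \<Longrightarrow>
    (\<And>\<xi>. \<xi> \<noteq> 0 \<Longrightarrow> F \<xi> = (of_real (e powr - t) * fourier Ge \<xi>) * H \<xi>) \<Longrightarrow>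
      Lp_mod p (inv_fourier F) \<le> ennreal C * Lp_mod p (inv_fourier H)"
    using Lp_multiplier_bound[OF Ge_mult] by blast
  show ?thesis
  proof (rule that[of "2 * (2 powr p * C)"])
    show "0 \<le> 2 * (2 powr p * C)" using C(1) by simp
    fix \<phi> :: "real ^ 'n \<Rightarrow> complex"
    assume \<phi>: "\<phi> \<in> schwartz" and supp: "\<And>x. \<phi> x \<noteq> 0 \<Longrightarrow> \<bar>x \<bullet> v - c\<bar> \<le> R"
    let ?\<Phi> = "fourier \<phi>"
    have i\<Phi>: "integrable lborel ?\<Phi>" by (intro schwartz_integrable schwartz_fourier \<phi>)
    have [measurable]: "\<phi> \<in> borel_measurable borel" "?\<Phi> \<in> borel_measurable borel"
      by (intro schwartz_measurable schwartz_fourier \<phi>)+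
    have "Ke \<in> borel_measurable borel" using Ke(1) by auto
    then have [measurable]: "fourier Ke \<in> borel_measurable borel" by (rule fourier_measurable)
    have Km: "Lp_multiplier p (fourier Ke)" by (rule Lp_multiplier_fourier[OF Ke(1) p])
    have iK: "integrable lborel (\<lambda>\<xi>. fourier Ke \<xi> * ?\<Phi> \<xi>)" by (rule Lp_multiplier_integrable[OF Km i\<Phi>])
    have iK': "integrable lborel (\<lambda>\<xi>. (1 - fourier Ke \<xi>) * ?\<Phi> \<xi>)"
      unfolding left_diff_distrib using i\<Phi> iK by simp
    let ?A = "conv Ke \<phi>" and ?B = "inv_fourier (\<lambda>\<xi>. (1 - fourier Ke \<xi>) * ?\<Phi> \<xi>)"
    have A: "?A = inv_fourier (\<lambda>\<xi>. fourier Ke \<xi> * ?\<Phi> \<xi>)"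
      unfolding inv_fourier_fourier_mult[OF Ke(1) i\<Phi>] inv_fourier_fourier[OF \<phi>] ..
    have AB: "?A \<in> borel_measurable borel" "?B \<in> borel_measurable borel"
      unfolding A by (intro inv_fourier_measurable; measurable)+
    have split: "\<phi> x = ?A x + ?B x" for x
    proof -
      have "?A x + ?B x = inv_fourier (\<lambda>\<xi>. fourier Ke \<xi> * ?\<Phi> \<xi> + (1 - fourier Ke \<xi>) * ?\<Phi> \<xi>) x"
        unfolding A by (rule inv_fourier_add[OF iK iK', symmetric])
      also have "\<dots> = inv_fourier ?\<Phi> x" by (simp add: algebra_simps)
      finally show ?thesis by (simp add: inv_fourier_fourier[OF \<phi>])
    qed
    let ?S = "{x :: real ^ 'n. \<bar>x \<bullet> v - c\<bar> \<le> R}"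
    obtain B0 where "\<forall>x. (1 + norm x) ^ 0 * norm (\<phi> x) \<le> B0"
      using schwartz_rapid[OF \<phi>] unfolding rapid_def by blast
    then have B0: "norm (\<phi> x) \<le> B0" for x by simp
    have LA: "Lp_mod p (\<lambda>x. indicator ?S x * ?A x) \<le> ennreal ((1 / 4) powr p) * Lp_mod p \<phi>"
    proof -
      have "Lp_mod p (\<lambda>x. indicator ?S x * ?A x) \<le>
          ennreal ((LINT y|lborel. norm (Ke y) * indicator {y. \<bar>y \<bullet> v\<bar> \<le> 2 * R} y) powr p) * Lp_mod p \<phi>"
        by (rule Lp_mod_conv_slab_le[OF Ke(1) _ B0 p supp]) measurable
      also have "\<dots> \<le> ennreal ((1 / 4) powr p) * Lp_mod p \<phi>"
        using mass p by (intro mult_right_mono ennreal_leI powr_mono2) (auto intro!: integral_nonneg_AE)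
      finally show ?thesis .
    qed
    have LB: "Lp_mod p ?B \<le> ennreal C * Lp_mod p (frac_laplacian_schwartz t \<phi>)"
      unfolding frac_laplacian_schwartz_def
    proof (rule C(2))
      show "integrable lborel (\<lambda>\<xi>. of_real (norm \<xi> powr t) * ?\<Phi> \<xi>)"
        using t by (intro integrable_norm_powr_fourier \<phi>) simp
      show "(\<lambda>\<xi>. (1 - fourier Ke \<xi>) * ?\<Phi> \<xi>) \<in> borel_measurable borel" by measurable
      fix \<xi> :: "real ^ 'n" assume "\<xi> \<noteq> 0"
      then have "\<xi> /\<^sub>R e \<noteq> 0" using e by simp
      then have "1 - fourier Ke \<xi> = of_real ((1 - bsym (\<xi> /\<^sub>R e)) powr (t / 2))"
        unfolding Ke(2) by (simp add: K(2))
      also have "(1 - bsym (\<xi> /\<^sub>R e)) powr (t / 2) = e powr - t * bsym (\<xi> /\<^sub>R e) powr (t / 2) * norm \<xi> powr t"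
        unfolding one_minus_bsym_powr using e by (simp add: powr_mult powr_minus inverse_powr)
      finally show "(1 - fourier Ke \<xi>) * ?\<Phi> \<xi> = (of_real (e powr - t) * fourier Ge \<xi>) * (of_real (norm \<xi> powr t) * ?\<Phi> \<xi>)"
        unfolding Ge(2) G(2) by (simp only: of_real_mult mult.assoc)
    qed
    \<comment> \<open>\<open>\<phi>\<close> vanishes off the slab, so cutting both pieces down to
      the slab loses nothing; the cut is what makes the convolution term small.\<close>
    have "Lp_mod p \<phi> \<le> Lp_mod p (\<lambda>x. indicator ?S x * ?A x + indicator ?S x * ?B x)"
    proof (rule Lp_mod_mono)
      fix x
      show "norm (\<phi> x) \<le> norm (indicator ?S x * ?A x + indicator ?S x * ?B x)"
        using supp[of x] split[of x] by (cases "\<phi> x = 0") (simp_all add: indicator_def)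
    qed (use p in simp)
    also have "\<dots> \<le> ennreal (2 powr p) * (Lp_mod p (\<lambda>x. indicator ?S x * ?A x) + Lp_mod p (\<lambda>x. indicator ?S x * ?B x))"
    proof (rule Lp_mod_add_le)
      have "closed ?S" by (intro closed_Collect_le continuous_intros)
      then have S: "?S \<in> sets borel" by (rule borel_closed)
      show "(\<lambda>x. indicator ?S x * ?A x) \<in> borel_measurable borel" "(\<lambda>x. indicator ?S x * ?B x) \<in> borel_measurable borel"
        by (intro borel_measurable_times borel_measurable_indicator S AB)+
    qed (use p in simp)
    also have "Lp_mod p (\<lambda>x. indicator ?S x * ?B x) \<le> Lp_mod p ?B"
      using p by (intro Lp_mod_mono) (simp_all add: indicator_def)
    also note LB
    also note LA
    finally have "Lp_mod p \<phi> \<le> ennreal (2 powr p) * (ennreal ((1 / 4) powr p) * Lp_mod p \<phi> + ennreal C * Lp_mod p (frac_laplacian_schwartz t \<phi>))"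
      by (simp add: add_mono mult_left_mono)
    also have "\<dots> = ennreal (2 powr p * (1 / 4) powr p) * Lp_mod p \<phi> + ennreal (2 powr p * C) * Lp_mod p (frac_laplacian_schwartz t \<phi>)"
      using C(1) by (simp add: distrib_left ennreal_mult mult.assoc)
    also have "\<dots> \<le> ennreal (1 / 2) * Lp_mod p \<phi> + ennreal (2 powr p * C) * Lp_mod p (frac_laplacian_schwartz t \<phi>)"
    proof (intro add_mono mult_right_mono ennreal_leI order_refl)
      have "2 powr p * (1 / 4) powr p = (1 / 2) powr p" by (simp flip: powr_mult)
      also have "\<dots> \<le> (1 / 2) powr 1" using p by (intro powr_mono') auto
      finally show "2 powr p * (1 / 4) powr p \<le> 1 / 2" by simp
    qed (use C(1) in simp_all)
    finally have "Lp_mod p \<phi> \<le> 2 * (ennreal (2 powr p * C) * Lp_mod p (frac_laplacian_schwartz t \<phi>))"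
      by (intro ennreal_absorb) (use Lp_mod_rapid[OF _ schwartz_rapid[OF \<phi>] p] in simp_all)
    then show "Lp_mod p \<phi> \<le> ennreal (2 * (2 powr p * C)) * Lp_mod p (frac_laplacian_schwartz t \<phi>)"
      using C(1) by (simp add: ennreal_mult mult.assoc)
  qed
qed

text \<open>The quotient of the symbols is |xi|^s (1 + |xi|^2)^(-t/2) = (1 - b)^(s/2) b^((t - s)/2),
  where both exponents are nonnegative because 0 <= s <= t.\<close>

lemma frac_laplacian_le_Bessel:
  assumes p: "1 \<le> p" and s: "0 \<le> s" "s \<le> t"
  obtains C where "0 \<le> C" "\<And>\<phi> :: real ^ 'n \<Rightarrow> complex. \<phi> \<in> schwartz \<Longrightarrow>
    Lp_mod p (frac_laplacian_schwartz s \<phi>) \<le> ennreal C * Lp_mod p (Bessel_schwartz t \<phi>)"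
proof -
  have "Lp_multiplier p (\<lambda>\<xi> :: real ^ 'n. of_real ((1 - bsym \<xi>) powr (s / 2)) * of_real (bsym \<xi> powr ((t - s) / 2)))"
    using assms by (intro Lp_multiplier_mult Lp_multiplier_one_minus_bsym_powr Lp_multiplier_bsym_powr) auto
  then obtain C where C: "0 \<le> C" "\<And>G H :: real ^ 'n \<Rightarrow> complex. integrable lborel H \<Longrightarrow> G \<in> borel_measurable borel \<Longrightarrow>
    (\<And>\<xi>. \<xi> \<noteq> 0 \<Longrightarrow> G \<xi> = (of_real ((1 - bsym \<xi>) powr (s / 2)) * of_real (bsym \<xi> powr ((t - s) / 2))) * H \<xi>) \<Longrightarrow>
      Lp_mod p (inv_fourier G) \<le> ennreal C * Lp_mod p (inv_fourier H)"
    using Lp_multiplier_bound by blast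
  show ?thesis
  proof (rule that[OF C(1)])
    fix \<phi> :: "real ^ 'n \<Rightarrow> complex" assume \<phi>: "\<phi> \<in> schwartz"
    have [measurable]: "fourier \<phi> \<in> borel_measurable borel" by (intro schwartz_measurable schwartz_fourier \<phi>)
    show "Lp_mod p (frac_laplacian_schwartz s \<phi>) \<le> ennreal C * Lp_mod p (Bessel_schwartz t \<phi>)"
      unfolding frac_laplacian_schwartz_def Bessel_schwartz_def
    proof (rule C(2)[OF integrable_Bessel_symbol[OF \<phi>]])
      fix \<xi> :: "real ^ 'n"
      have "norm \<xi> powr s = (1 - bsym \<xi>) powr (s / 2) * bsym \<xi> powr ((t - s) / 2) * bsym \<xi> powr - (t / 2)"
      proof -
        have "bsym \<xi> powr (s / 2) * bsym \<xi> powr ((t - s) / 2) * bsym \<xi> powr - (t / 2) = bsym \<xi> powr (s / 2 + (t - s) / 2 + - (t / 2))"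
          by (simp only: powr_add)
        also have "s / 2 + (t - s) / 2 + - (t / 2) = 0" by (simp add: field_simps)
        finally have "bsym \<xi> powr (s / 2) * bsym \<xi> powr ((t - s) / 2) * bsym \<xi> powr - (t / 2) = 1"
          using bsym_pos[of \<xi>] by simp
        then show ?thesis unfolding one_minus_bsym_powr by (simp add: mult.assoc)
      qed
      then show "of_real (norm \<xi> powr s) * fourier \<phi> \<xi> =
          (of_real ((1 - bsym \<xi>) powr (s / 2)) * of_real (bsym \<xi> powr ((t - s) / 2))) * (of_real ((1 + (norm \<xi>)\<^sup>2) powr (t / 2)) * fourier \<phi> \<xi>)"
        unfolding Bessel_symbol_bsym by (simp only: of_real_mult mult.assoc)
    qed measurable
  qed
qed

text \<open>Boundedness of the fractional Laplacian from order \<open>t\<close> to order t - s.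
  After cancelling Bessel symbols the quotient is (1 - b)^(s/2).\<close>

lemma Bessel_frac_laplacian_le_Bessel:
  assumes p: "1 \<le> p" and s: "0 \<le> s"
  obtains C where "0 \<le> C" "\<And>\<phi> :: real ^ 'n \<Rightarrow> complex. \<phi> \<in> schwartz \<Longrightarrow>
    Lp_mod p (inv_fourier (\<lambda>\<xi>. of_real ((1 + (norm \<xi>)\<^sup>2) powr ((t - s) / 2)) * (of_real (norm \<xi> powr s) * fourier \<phi> \<xi>)))
      \<le> ennreal C * Lp_mod p (Bessel_schwartz t \<phi>)"
proof -
  have "Lp_multiplier p (\<lambda>\<xi> :: real ^ 'n. of_real ((1 - bsym \<xi>) powr (s / 2)))"
    using assms by (intro Lp_multiplier_one_minus_bsym_powr) auto
  then obtain C where C: "0 \<le> C" "\<And>G H :: real ^ 'n \<Rightarrow> complex. integrable lborel H \<Longrightarrow> G \<in> borel_measurable borel \<Longrightarrow>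
    (\<And>\<xi>. \<xi> \<noteq> 0 \<Longrightarrow> G \<xi> = of_real ((1 - bsym \<xi>) powr (s / 2)) * H \<xi>) \<Longrightarrow>
      Lp_mod p (inv_fourier G) \<le> ennreal C * Lp_mod p (inv_fourier H)"
    using Lp_multiplier_bound by blast
  show ?thesis
  proof (rule that[OF C(1)])
    fix \<phi> :: "real ^ 'n \<Rightarrow> complex" assume \<phi>: "\<phi> \<in> schwartz"
    have [measurable]: "fourier \<phi> \<in> borel_measurable borel" by (intro schwartz_measurable schwartz_fourier \<phi>)
    show "Lp_mod p (inv_fourier (\<lambda>\<xi>. of_real ((1 + (norm \<xi>)\<^sup>2) powr ((t - s) / 2)) * (of_real (norm \<xi> powr s) * fourier \<phi> \<xi>)))
      \<le> ennreal C * Lp_mod p (Bessel_schwartz t \<phi>)"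
      unfolding Bessel_schwartz_def
    proof (rule C(2)[OF integrable_Bessel_symbol[OF \<phi>]])
      fix \<xi> :: "real ^ 'n"
      have "bsym \<xi> powr - ((t - s) / 2) * norm \<xi> powr s = (1 - bsym \<xi>) powr (s / 2) * bsym \<xi> powr - (t / 2)"
      proof -
        have "bsym \<xi> powr (s / 2) * bsym \<xi> powr - (t / 2) = bsym \<xi> powr (s / 2 + - (t / 2))"
          by (simp only: powr_add)
        also have "s / 2 + - (t / 2) = - ((t - s) / 2)" by (simp add: field_simps)
        finally show ?thesis unfolding one_minus_bsym_powr by (simp only: mult.assoc mult.commute[of "bsym \<xi> powr - ((t - s) / 2)"])
      qed
      then have "complex_of_real (bsym \<xi> powr - ((t - s) / 2)) * of_real (norm \<xi> powr s) = of_real ((1 - bsym \<xi>) powr (s / 2)) * of_real (bsym \<xi> powr - (t / 2))"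
        by (simp only: of_real_mult[symmetric])
      then show "of_real ((1 + (norm \<xi>)\<^sup>2) powr ((t - s) / 2)) * (of_real (norm \<xi> powr s) * fourier \<phi> \<xi>) =
          of_real ((1 - bsym \<xi>) powr (s / 2)) * (of_real ((1 + (norm \<xi>)\<^sup>2) powr (t / 2)) * fourier \<phi> \<xi>)"
        unfolding Bessel_symbol_bsym by (simp only: mult.assoc[symmetric])
    qed measurable
  qed
qed

text \<open>With \<open>b = (1 + |\<xi>|\<^sup>2)\<^sup>-\<^sup>1\<close>, multiplying \<open>b\<^bsup>-t/2\<^esup>\<close> by a high power of \<open>b\<close> leaves a multiplier,
  and multiplying it by a high power of \<open>1 - b\<close> leaves a multiplier times \<open>|\<xi>|\<^sup>t\<close>. Splitting
  \<open>1 = b + (1 - b)\<close> repeatedly reduces everything to these two cases.\<close>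

lemma Bessel_le_frac_laplacian:
  assumes p: "1 \<le> p" and t: "0 \<le> t"
  obtains C where "0 \<le> C" "\<And>\<phi> :: real ^ 'n \<Rightarrow> complex. \<phi> \<in> schwartz \<Longrightarrow>
    Lp_mod p (Bessel_schwartz t \<phi>) \<le> ennreal C * (Lp_mod p \<phi> + Lp_mod p (frac_laplacian_schwartz t \<phi>))"
proof -
  define N where "N = nat \<lceil>t / 2\<rceil>"
  have N: "t / 2 \<le> real N" unfolding N_def using t by (simp add: real_nat_ceiling_ge)
  \<comment> \<open>\<open>?s 0 0\<close> is the Bessel symbol of order \<open>t\<close>, and each
    splitting writes \<open>?s i j\<close> as \<open>?s (Suc i) j\<close> plus
    \<open>?s i (Suc j)\<close>.\<close>
  let ?s = "\<lambda>i j \<xi>. complex_of_real (bsym \<xi> powr - (t / 2) * bsym \<xi> ^ i * (1 - bsym \<xi>) ^ j)"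
  have sm: "(\<lambda>\<xi> :: real ^ 'n. ?s i j \<xi>) \<in> borel_measurable borel" for i j by measurable
  have int: "integrable lborel (\<lambda>\<xi>. ?s i j \<xi> * fourier \<phi> \<xi>)" if \<phi>: "\<phi> \<in> schwartz" for \<phi> :: "real ^ 'n \<Rightarrow> complex" and i j
  proof (rule Bochner_Integration.integrable_bound[OF integrable_Bessel_symbol[OF \<phi>, of "t / 2"]])
    have [measurable]: "fourier \<phi> \<in> borel_measurable borel" by (intro schwartz_measurable schwartz_fourier \<phi>)
    show "(\<lambda>\<xi>. ?s i j \<xi> * fourier \<phi> \<xi>) \<in> borel_measurable lborel" using sm[of i j] by measurable
    show "AE \<xi> in lborel. norm (?s i j \<xi> * fourier \<phi> \<xi>) \<le> norm (of_real ((1 + (norm \<xi>)\<^sup>2) powr (t / 2)) * fourier \<phi> \<xi>)"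
    proof (intro AE_I2)
      fix \<xi> :: "real ^ 'n"
      have "bsym \<xi> ^ i * (1 - bsym \<xi>) ^ j \<le> 1 * 1"
        using bsym_pos[of \<xi>] bsym_le_1[of \<xi>] by (intro mult_mono power_le_one) auto
      moreover have "0 \<le> bsym \<xi> ^ i * (1 - bsym \<xi>) ^ j"
        using bsym_pos[of \<xi>] bsym_le_1[of \<xi>] by simp
      ultimately have "\<bar>bsym \<xi> powr - (t / 2) * bsym \<xi> ^ i * (1 - bsym \<xi>) ^ j\<bar> \<le> \<bar>bsym \<xi> powr - (t / 2)\<bar>"
        by (simp add: abs_mult mult.assoc mult_left_le)
      then show "norm (?s i j \<xi> * fourier \<phi> \<xi>) \<le> norm (of_real ((1 + (norm \<xi>)\<^sup>2) powr (t / 2)) * fourier \<phi> \<xi>)"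
        unfolding Bessel_symbol_bsym norm_mult norm_of_real by (rule mult_right_mono) simp
    qed
  qed
  have ex: "\<exists>C\<ge>0. \<forall>\<phi> :: real ^ 'n \<Rightarrow> complex. \<phi> \<in> schwartz \<longrightarrow> Lp_mod p (inv_fourier (\<lambda>\<xi>. ?s i j \<xi> * fourier \<phi> \<xi>)) \<le>
      ennreal C * (Lp_mod p \<phi> + Lp_mod p (frac_laplacian_schwartz t \<phi>))" for i j
  \<comment> \<open>The truncated difference drops at each splitting, since splitting happens only
    while both i and j are below \<open>N\<close>.\<close>
  proof (induction "2 * N - (i + j)" arbitrary: i j rule: less_induct)
    case less
    consider "N \<le> i" | "N \<le> j" | "i < N" "j < N" by linarith
    then show ?case
    proof cases
      case 1
      have "Lp_multiplier p (\<lambda>\<xi> :: real ^ 'n. of_real (bsym \<xi> powr (real i - t / 2)) * of_real ((1 - bsym \<xi>) powr real j))"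
        using 1 N p by (intro Lp_multiplier_mult Lp_multiplier_one_minus_bsym_powr Lp_multiplier_bsym_powr) auto
      then obtain C where C: "0 \<le> C" "\<And>G H :: real ^ 'n \<Rightarrow> complex. integrable lborel H \<Longrightarrow> G \<in> borel_measurable borel \<Longrightarrow>
        (\<And>\<xi>. \<xi> \<noteq> 0 \<Longrightarrow> G \<xi> = (of_real (bsym \<xi> powr (real i - t / 2)) * of_real ((1 - bsym \<xi>) powr real j)) * H \<xi>) \<Longrightarrow>
          Lp_mod p (inv_fourier G) \<le> ennreal C * Lp_mod p (inv_fourier H)"
        using Lp_multiplier_bound by blast
      have "Lp_mod p (inv_fourier (\<lambda>\<xi>. ?s i j \<xi> * fourier \<phi> \<xi>)) \<le> ennreal C * (Lp_mod p \<phi> + Lp_mod p (frac_laplacian_schwartz t \<phi>))"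
        if \<phi>: "\<phi> \<in> schwartz" for \<phi> :: "real ^ 'n \<Rightarrow> complex"
      proof -
        have "Lp_mod p (inv_fourier (\<lambda>\<xi>. ?s i j \<xi> * fourier \<phi> \<xi>)) \<le> ennreal C * Lp_mod p (inv_fourier (fourier \<phi>))"
        proof (rule C(2))
          show "integrable lborel (fourier \<phi>)" by (intro schwartz_integrable schwartz_fourier \<phi>)
          show "(\<lambda>\<xi>. ?s i j \<xi> * fourier \<phi> \<xi>) \<in> borel_measurable borel" using int[OF \<phi>, of i j] by auto
          fix \<xi> :: "real ^ 'n" assume "\<xi> \<noteq> 0"
          then have b: "0 < bsym \<xi>" "0 < 1 - bsym \<xi>" using bsym_pos[of \<xi>] bsym_less_1[of \<xi>] by auto
          have "bsym \<xi> powr - (t / 2) * bsym \<xi> ^ i * (1 - bsym \<xi>) ^ j = bsym \<xi> powr (real i - t / 2) * (1 - bsym \<xi>) powr real j"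
          proof -
            have e: "real i - t / 2 = - (t / 2) + real i" by simp
            show ?thesis unfolding e powr_add powr_realpow[OF b(1)] powr_realpow[OF b(2)] ..
          qed
          then show "?s i j \<xi> * fourier \<phi> \<xi> = (of_real (bsym \<xi> powr (real i - t / 2)) * of_real ((1 - bsym \<xi>) powr real j)) * fourier \<phi> \<xi>"
            by (simp only: of_real_mult)
        qed
        also have "\<dots> \<le> ennreal C * (Lp_mod p \<phi> + Lp_mod p (frac_laplacian_schwartz t \<phi>))"
          unfolding inv_fourier_fourier[OF \<phi>] by (intro mult_left_mono) simp_all
        finally show ?thesis .
      qed
      then show ?thesis using C(1) by (intro exI[of _ C]) simp
    next
      case 2
      have "Lp_multiplier p (\<lambda>\<xi> :: real ^ 'n. of_real (bsym \<xi> powr real i) * of_real ((1 - bsym \<xi>) powr (real j - t / 2)))"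
        using 2 N p by (intro Lp_multiplier_mult Lp_multiplier_one_minus_bsym_powr Lp_multiplier_bsym_powr) auto
      then obtain C where C: "0 \<le> C" "\<And>G H :: real ^ 'n \<Rightarrow> complex. integrable lborel H \<Longrightarrow> G \<in> borel_measurable borel \<Longrightarrow>
        (\<And>\<xi>. \<xi> \<noteq> 0 \<Longrightarrow> G \<xi> = (of_real (bsym \<xi> powr real i) * of_real ((1 - bsym \<xi>) powr (real j - t / 2))) * H \<xi>) \<Longrightarrow>
          Lp_mod p (inv_fourier G) \<le> ennreal C * Lp_mod p (inv_fourier H)"
        using Lp_multiplier_bound by blast
      have "Lp_mod p (inv_fourier (\<lambda>\<xi>. ?s i j \<xi> * fourier \<phi> \<xi>)) \<le> ennreal C * (Lp_mod p \<phi> + Lp_mod p (frac_laplacian_schwartz t \<phi>))"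
        if \<phi>: "\<phi> \<in> schwartz" for \<phi> :: "real ^ 'n \<Rightarrow> complex"
      proof -
        have "Lp_mod p (inv_fourier (\<lambda>\<xi>. ?s i j \<xi> * fourier \<phi> \<xi>)) \<le> ennreal C * Lp_mod p (frac_laplacian_schwartz t \<phi>)"
          unfolding frac_laplacian_schwartz_def
        proof (rule C(2)[OF integrable_norm_powr_fourier[OF \<phi> t]])
          show "(\<lambda>\<xi>. ?s i j \<xi> * fourier \<phi> \<xi>) \<in> borel_measurable borel" using int[OF \<phi>, of i j] by auto
          fix \<xi> :: "real ^ 'n" assume "\<xi> \<noteq> 0"
          then have b: "0 < bsym \<xi>" "0 < 1 - bsym \<xi>" using bsym_pos[of \<xi>] bsym_less_1[of \<xi>] by auto
          have "(1 - bsym \<xi>) ^ j = (1 - bsym \<xi>) powr (real j - t / 2) * (1 - bsym \<xi>) powr (t / 2)"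
            unfolding powr_realpow[OF b(2), symmetric] powr_add[symmetric] by simp
          also have "\<dots> = (1 - bsym \<xi>) powr (real j - t / 2) * (norm \<xi> powr t * bsym \<xi> powr (t / 2))"
            by (simp only: one_minus_bsym_powr[of \<xi> t])
          finally have "bsym \<xi> powr - (t / 2) * bsym \<xi> ^ i * (1 - bsym \<xi>) ^ j =
              (bsym \<xi> powr - (t / 2) * bsym \<xi> powr (t / 2)) * (bsym \<xi> powr real i * (1 - bsym \<xi>) powr (real j - t / 2) * norm \<xi> powr t)"
            using b by (simp only: powr_realpow mult_ac)
          also have "bsym \<xi> powr - (t / 2) * bsym \<xi> powr (t / 2) = 1"
            unfolding powr_add[symmetric] using b by simp
          finally show "?s i j \<xi> * fourier \<phi> \<xi> = (of_real (bsym \<xi> powr real i) * of_real ((1 - bsym \<xi>) powr (real j - t / 2))) * (of_real (norm \<xi> powr t) * fourier \<phi> \<xi>)"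
            by (simp only: of_real_mult mult_1 mult.assoc)
        qed
        also have "\<dots> \<le> ennreal C * (Lp_mod p \<phi> + Lp_mod p (frac_laplacian_schwartz t \<phi>))"
          by (intro mult_left_mono) simp_all
        finally show ?thesis .
      qed
      then show ?thesis using C(1) by (intro exI[of _ C]) simp
    next
      case 3
      then have lt: "2 * N - (Suc i + j) < 2 * N - (i + j)" "2 * N - (i + Suc j) < 2 * N - (i + j)" by linarith+
      obtain C1 where C1: "0 \<le> C1" "\<And>\<phi> :: real ^ 'n \<Rightarrow> complex. \<phi> \<in> schwartz \<Longrightarrow> Lp_mod p (inv_fourier (\<lambda>\<xi>. ?s (Suc i) j \<xi> * fourier \<phi> \<xi>)) \<le>
          ennreal C1 * (Lp_mod p \<phi> + Lp_mod p (frac_laplacian_schwartz t \<phi>))"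
        using less[OF lt(1)] by blast
      obtain C2 where C2: "0 \<le> C2" "\<And>\<phi> :: real ^ 'n \<Rightarrow> complex. \<phi> \<in> schwartz \<Longrightarrow> Lp_mod p (inv_fourier (\<lambda>\<xi>. ?s i (Suc j) \<xi> * fourier \<phi> \<xi>)) \<le>
          ennreal C2 * (Lp_mod p \<phi> + Lp_mod p (frac_laplacian_schwartz t \<phi>))"
        using less[OF lt(2)] by blast
      have "Lp_mod p (inv_fourier (\<lambda>\<xi>. ?s i j \<xi> * fourier \<phi> \<xi>)) \<le> ennreal (2 powr p * (C1 + C2)) * (Lp_mod p \<phi> + Lp_mod p (frac_laplacian_schwartz t \<phi>))"
        if \<phi>: "\<phi> \<in> schwartz" for \<phi> :: "real ^ 'n \<Rightarrow> complex"
      proof -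
        let ?Y = "Lp_mod p \<phi> + Lp_mod p (frac_laplacian_schwartz t \<phi>)"
        have "complex_of_real (x * y * z) = of_real (x * (b * y) * z) + of_real (x * y * ((1 - b) * z))" for x y z b
          unfolding of_real_add[symmetric] by (simp only: of_real_eq_iff) (simp add: algebra_simps)
        then have "?s i j \<xi> * fourier \<phi> \<xi> = ?s (Suc i) j \<xi> * fourier \<phi> \<xi> + ?s i (Suc j) \<xi> * fourier \<phi> \<xi>" for \<xi>
          unfolding power_Suc distrib_right[symmetric] by (intro arg_cong[where f = "\<lambda>x. x * fourier \<phi> \<xi>"])
        then have eq: "inv_fourier (\<lambda>\<xi>. ?s i j \<xi> * fourier \<phi> \<xi>) =
            (\<lambda>x. inv_fourier (\<lambda>\<xi>. ?s (Suc i) j \<xi> * fourier \<phi> \<xi>) x + inv_fourier (\<lambda>\<xi>. ?s i (Suc j) \<xi> * fourier \<phi> \<xi>) x)"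
          using inv_fourier_add[OF int[OF \<phi>, of "Suc i" j] int[OF \<phi>, of i "Suc j"]] by presburger
        have "Lp_mod p (inv_fourier (\<lambda>\<xi>. ?s i j \<xi> * fourier \<phi> \<xi>)) \<le> ennreal (2 powr p) *
            (Lp_mod p (inv_fourier (\<lambda>\<xi>. ?s (Suc i) j \<xi> * fourier \<phi> \<xi>)) + Lp_mod p (inv_fourier (\<lambda>\<xi>. ?s i (Suc j) \<xi> * fourier \<phi> \<xi>)))"
          unfolding eq
          by (rule Lp_mod_add_le) (use int[OF \<phi>, of "Suc i" j] int[OF \<phi>, of i "Suc j"] p in \<open>auto intro!: inv_fourier_measurable\<close>)
        also have "\<dots> \<le> ennreal (2 powr p) * (ennreal C1 * ?Y + ennreal C2 * ?Y)"
          by (intro mult_left_mono add_mono C1 C2 \<phi>) simp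
        also have "\<dots> = ennreal (2 powr p) * ((ennreal C1 + ennreal C2) * ?Y)"
          by (simp only: distrib_right)
        also have "\<dots> = ennreal (2 powr p * (C1 + C2)) * ?Y"
          using C1(1) C2(1) by (simp add: ennreal_mult mult.assoc)
        finally show ?thesis .
      qed
      then show ?thesis using C1(1) C2(1) by (intro exI[of _ "2 powr p * (C1 + C2)"]) simp
    qed
  qed
  obtain C where C: "0 \<le> C" "\<And>\<phi> :: real ^ 'n \<Rightarrow> complex. \<phi> \<in> schwartz \<Longrightarrow> Lp_mod p (inv_fourier (\<lambda>\<xi>. ?s 0 0 \<xi> * fourier \<phi> \<xi>)) \<le>
      ennreal C * (Lp_mod p \<phi> + Lp_mod p (frac_laplacian_schwartz t \<phi>))"
    using ex[of 0 0] by blast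
  show ?thesis
  proof (rule that[OF C(1)])
    fix \<phi> :: "real ^ 'n \<Rightarrow> complex" assume "\<phi> \<in> schwartz"
    from C(2)[OF this] show "Lp_mod p (Bessel_schwartz t \<phi>) \<le> ennreal C * (Lp_mod p \<phi> + Lp_mod p (frac_laplacian_schwartz t \<phi>))"
      unfolding Bessel_schwartz_def Bessel_symbol_bsym by simp
  qed
qed

lemma slab_frac_Poincare:
  fixes v :: "real ^ 'n"
  assumes p: "1 \<le> p" and s: "0 \<le> s" "s \<le> t" and v: "v \<noteq> 0"
  obtains C where "0 \<le> C" "\<And>\<phi>. \<phi> \<in> schwartz \<Longrightarrow> (\<And>x. \<phi> x \<noteq> 0 \<Longrightarrow> \<bar>x \<bullet> v - c\<bar> \<le> R) \<Longrightarrow>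
    Lp_mod p (frac_laplacian_schwartz s \<phi>) \<le> ennreal C * Lp_mod p (frac_laplacian_schwartz t \<phi>)"
\<comment> \<open>\<open>slab_Poincare\<close> needs t > 0; for t = 0 the constraints leave s = t,
  where the constant 1 works.\<close>
proof (cases "t = 0")
  case True
  then have "s = t" using s by simp
  then show ?thesis using that[of 1] by simp
next
  case False
  then have t: "0 < t" "0 \<le> t" using s by auto
  obtain C1 where C1: "0 \<le> C1" "\<And>\<phi>. \<phi> \<in> schwartz \<Longrightarrow> (\<And>x. \<phi> x \<noteq> 0 \<Longrightarrow> \<bar>x \<bullet> v - c\<bar> \<le> R) \<Longrightarrow>
      Lp_mod p \<phi> \<le> ennreal C1 * Lp_mod p (frac_laplacian_schwartz t \<phi>)"
    using slab_Poincare[OF p t(1) v, of c R] by blast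
  obtain C2 where C2: "0 \<le> C2" "\<And>\<phi> :: real ^ 'n \<Rightarrow> complex. \<phi> \<in> schwartz \<Longrightarrow>
      Lp_mod p (Bessel_schwartz t \<phi>) \<le> ennreal C2 * (Lp_mod p \<phi> + Lp_mod p (frac_laplacian_schwartz t \<phi>))"
    using Bessel_le_frac_laplacian[OF p t(2), where 'n = 'n] by blast
  obtain C3 where C3: "0 \<le> C3" "\<And>\<phi> :: real ^ 'n \<Rightarrow> complex. \<phi> \<in> schwartz \<Longrightarrow>
      Lp_mod p (frac_laplacian_schwartz s \<phi>) \<le> ennreal C3 * Lp_mod p (Bessel_schwartz t \<phi>)"
    using frac_laplacian_le_Bessel[OF p s, where 'n = 'n] by blast
  show ?thesis
  proof (rule that[of "C3 * (C2 * (C1 + 1))"])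
    show "0 \<le> C3 * (C2 * (C1 + 1))" using C1(1) C2(1) C3(1) by simp
    fix \<phi> :: "real ^ 'n \<Rightarrow> complex" assume \<phi>: "\<phi> \<in> schwartz" and supp: "\<And>x. \<phi> x \<noteq> 0 \<Longrightarrow> \<bar>x \<bullet> v - c\<bar> \<le> R"
    let ?Y = "Lp_mod p (frac_laplacian_schwartz t \<phi>)"
    have "Lp_mod p (frac_laplacian_schwartz s \<phi>) \<le> ennreal C3 * Lp_mod p (Bessel_schwartz t \<phi>)"
      by (rule C3(2)[OF \<phi>])
    also have "\<dots> \<le> ennreal C3 * (ennreal C2 * (Lp_mod p \<phi> + ?Y))"
      by (intro mult_left_mono C2(2) \<phi>) simp
    also have "\<dots> \<le> ennreal C3 * (ennreal C2 * (ennreal C1 * ?Y + ?Y))"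
      by (intro mult_left_mono add_mono C1(2) \<phi> supp order_refl) simp_all
    also have "ennreal C1 * ?Y + ?Y = ennreal (C1 + 1) * ?Y"
      using C1(1) by (simp add: distrib_right)
    finally show "Lp_mod p (frac_laplacian_schwartz s \<phi>) \<le> ennreal (C3 * (C2 * (C1 + 1))) * ?Y"
      using C1(1) C2(1) C3(1) by (simp add: ennreal_mult mult.assoc)
  qed
qed

subsection \<open>Passage to Bessel potential spaces\<close>

text \<open>The transpose of (1 - Delta)^(r/2) for the bilinear pairing: the operator that
  \<open>bessel_potential\<close> moves onto the test function.\<close>

definition Bessel_dual :: "real \<Rightarrow> (real ^ 'n \<Rightarrow> complex) \<Rightarrow> real ^ 'n \<Rightarrow> complex" where
  "Bessel_dual r \<psi> = fourier (\<lambda>\<xi>. of_real ((1 + (norm \<xi>)\<^sup>2) powr (r / 2)) * inv_fourier \<psi> \<xi>)"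

lemma schwartz_Bessel_dual: "\<psi> \<in> schwartz \<Longrightarrow> Bessel_dual r \<psi> \<in> schwartz"
  unfolding Bessel_dual_def
  by (intro schwartz_fourier schwartz_one_plus_norm_square_powr schwartz_inv_fourier)

lemma inv_fourier_Bessel_dual:
  "\<psi> \<in> schwartz \<Longrightarrow> inv_fourier (Bessel_dual r \<psi>) = (\<lambda>\<xi>. of_real ((1 + (norm \<xi>)\<^sup>2) powr (r / 2)) * inv_fourier \<psi> \<xi>)"
  unfolding Bessel_dual_def
  by (intro inv_fourier_fourier schwartz_one_plus_norm_square_powr schwartz_inv_fourier)

text \<open>Every Schwartz function is \<open>Bessel_dual r\<close> of another one, so a tempered
  distribution can be recovered from its Bessel potential.\<close>

lemma Bessel_dual_inverse:
  assumes "\<psi> \<in> schwartz"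
  shows "Bessel_dual r (Bessel_dual (- r) \<psi>) = \<psi>"
proof -
  have "(1 + (norm \<xi>)\<^sup>2) powr (r / 2) * (1 + (norm \<xi>)\<^sup>2) powr (- r / 2) = 1" for \<xi> :: "real ^ 'a"
    unfolding powr_add[symmetric] using add_pos_nonneg[OF zero_less_one zero_le_power2[of "norm \<xi>"]] by simp
  then have "of_real ((1 + (norm \<xi>)\<^sup>2) powr (r / 2)) * (of_real ((1 + (norm \<xi>)\<^sup>2) powr (- r / 2)) * inv_fourier \<psi> \<xi>) = inv_fourier \<psi> \<xi>" for \<xi>
    by (simp only: mult.assoc[symmetric] of_real_mult[symmetric] of_real_1 mult_1)
  then show ?thesis
    unfolding Bessel_dual_def[of r] inv_fourier_Bessel_dual[OF assms]
    by (simp only: fourier_inv_fourier[OF assms])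
qed

lemma bessel_potential_schwartz:
  "\<psi> \<in> schwartz \<Longrightarrow> bessel_potential r u \<psi> = u (Bessel_dual r \<psi>)"
  unfolding bessel_potential_def inv_fourier_distr_def mult_distr_def fourier_distr_def on_schwartz_def
  by (simp add: schwartz_inv_fourier schwartz_one_plus_norm_square_powr Bessel_dual_def)

lemma bessel_potential_not_schwartz: "\<psi> \<notin> schwartz \<Longrightarrow> bessel_potential r u \<psi> = 0"
  unfolding bessel_potential_def inv_fourier_distr_def on_schwartz_def by simp

lemma bessel_potential_diff:
  "bessel_potential r (distr_diff T U) = distr_diff (bessel_potential r T) (bessel_potential r U)"
proof
  fix \<psi> :: "real ^ 'a \<Rightarrow> complex"
  show "bessel_potential r (distr_diff T U) \<psi> = distr_diff (bessel_potential r T) (bessel_potential r U) \<psi>"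
    by (cases "\<psi> \<in> schwartz")
      (simp_all add: bessel_potential_schwartz bessel_potential_not_schwartz distr_diff_def)
qed

lemma distr_of_schwartz: "\<psi> \<in> schwartz \<Longrightarrow> distr_of h \<psi> = (LINT x|lborel. h x * \<psi> x)"
  by (simp add: distr_of_def on_schwartz_def)

lemma distr_of_not_schwartz: "\<psi> \<notin> schwartz \<Longrightarrow> distr_of h \<psi> = 0"
  by (simp add: distr_of_def on_schwartz_def)

text \<open>Two uses of the multiplication formula for \<open>inv_fourier\<close>. Asking only
  integrability of \<open>H\<close> and of its product with the symbol covers |xi|^s times a
  transform, whose inverse transform need not be Schwartz.\<close>

lemma bessel_potential_inv_fourier:
  fixes H :: "real ^ 'n \<Rightarrow> complex"
  assumes H: "integrable lborel H"
    and mH: "integrable lborel (\<lambda>\<xi>. of_real ((1 + (norm \<xi>)\<^sup>2) powr (r / 2)) * H \<xi>)"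
  shows "bessel_potential r (distr_of (inv_fourier H)) =
    distr_of (inv_fourier (\<lambda>\<xi>. of_real ((1 + (norm \<xi>)\<^sup>2) powr (r / 2)) * H \<xi>))"
proof
  fix \<psi> :: "real ^ 'n \<Rightarrow> complex"
  show "bessel_potential r (distr_of (inv_fourier H)) \<psi> =
    distr_of (inv_fourier (\<lambda>\<xi>. of_real ((1 + (norm \<xi>)\<^sup>2) powr (r / 2)) * H \<xi>)) \<psi>"
  proof (cases "\<psi> \<in> schwartz")
    case True
    have "bessel_potential r (distr_of (inv_fourier H)) \<psi> = (LINT x|lborel. inv_fourier H x * Bessel_dual r \<psi> x)"
      by (simp only: bessel_potential_schwartz[OF True] distr_of_schwartz[OF schwartz_Bessel_dual[OF True]])
    also have "\<dots> = (LINT \<xi>|lborel. H \<xi> * inv_fourier (Bessel_dual r \<psi>) \<xi>)"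
      by (intro inv_fourier_swap H schwartz_integrable schwartz_Bessel_dual True)
    also have "\<dots> = (LINT \<xi>|lborel. (of_real ((1 + (norm \<xi>)\<^sup>2) powr (r / 2)) * H \<xi>) * inv_fourier \<psi> \<xi>)"
      unfolding inv_fourier_Bessel_dual[OF True] by (simp only: mult_ac)
    also have "\<dots> = (LINT x|lborel. inv_fourier (\<lambda>\<xi>. of_real ((1 + (norm \<xi>)\<^sup>2) powr (r / 2)) * H \<xi>) x * \<psi> x)"
      by (intro inv_fourier_swap[symmetric] mH schwartz_integrable True)
    finally show ?thesis by (simp only: distr_of_schwartz[OF True])
  qed (simp add: bessel_potential_not_schwartz distr_of_not_schwartz)
qed

lemma bessel_potential_distr_of_schwartz:
  assumes "\<phi> \<in> schwartz"
  shows "bessel_potential r (distr_of \<phi>) = distr_of (Bessel_schwartz r \<phi>)"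
  using bessel_potential_inv_fourier[OF schwartz_integrable[OF schwartz_fourier[OF assms]] integrable_Bessel_symbol[OF assms], of r]
  unfolding inv_fourier_fourier[OF assms] Bessel_schwartz_def .

text \<open>Represents the Bessel potential of order \<open>r\<close> of the fractional Laplacian of
  order \<open>s\<close>. For r = t - s its convergence in L^p is the convergence in H^{t-s,p} that
  \<open>frac_laplacian\<close> asks for.\<close>

definition Bessel_frac_laplacian :: "real \<Rightarrow> real \<Rightarrow> (real ^ 'n \<Rightarrow> complex) \<Rightarrow> real ^ 'n \<Rightarrow> complex" where
  "Bessel_frac_laplacian r s \<phi> =
    inv_fourier (\<lambda>\<xi>. of_real ((1 + (norm \<xi>)\<^sup>2) powr (r / 2)) * (of_real (norm \<xi> powr s) * fourier \<phi> \<xi>))"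

lemma bessel_potential_frac_laplacian_schwartz:
  assumes "\<phi> \<in> schwartz" "0 \<le> s"
  shows "bessel_potential r (distr_of (frac_laplacian_schwartz s \<phi>)) = distr_of (Bessel_frac_laplacian r s \<phi>)"
  unfolding frac_laplacian_schwartz_def Bessel_frac_laplacian_def
  by (rule bessel_potential_inv_fourier[OF integrable_norm_powr_fourier[OF assms] integrable_Bessel_norm_powr_fourier[OF assms]])

lemma inv_fourier_multiplier_diff:
  assumes "\<phi> \<in> schwartz" "\<psi> \<in> schwartz"
    and "integrable lborel (\<lambda>\<xi>. m \<xi> * fourier \<phi> \<xi>)" "integrable lborel (\<lambda>\<xi>. m \<xi> * fourier \<psi> \<xi>)"
  shows "inv_fourier (\<lambda>\<xi>. m \<xi> * fourier (\<lambda>x. \<phi> x - \<psi> x) \<xi>) =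
    (\<lambda>x. inv_fourier (\<lambda>\<xi>. m \<xi> * fourier \<phi> \<xi>) x - inv_fourier (\<lambda>\<xi>. m \<xi> * fourier \<psi> \<xi>) x)"
proof
  fix x
  have "fourier (\<lambda>x. \<phi> x - \<psi> x) \<xi> = fourier \<phi> \<xi> + - 1 * fourier \<psi> \<xi>" for \<xi>
    using fourier_add[OF schwartz_integrable[OF assms(1)] integrable_mult_right[OF schwartz_integrable[OF assms(2)], of "- 1"], of \<xi>]
    by (simp add: fourier_cmult[of "- 1", simplified])
  then have "m \<xi> * fourier (\<lambda>x. \<phi> x - \<psi> x) \<xi> = m \<xi> * fourier \<phi> \<xi> + - 1 * (m \<xi> * fourier \<psi> \<xi>)" for \<xi>
    by (simp add: right_diff_distrib)
  then have "inv_fourier (\<lambda>\<xi>. m \<xi> * fourier (\<lambda>x. \<phi> x - \<psi> x) \<xi>) x =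
      inv_fourier (\<lambda>\<xi>. m \<xi> * fourier \<phi> \<xi>) x + - 1 * inv_fourier (\<lambda>\<xi>. m \<xi> * fourier \<psi> \<xi>) x"
    using inv_fourier_add[OF assms(3) integrable_mult_right[OF assms(4), of "- 1"], of x]
    by (simp only: inv_fourier_cmult)
  then show "inv_fourier (\<lambda>\<xi>. m \<xi> * fourier (\<lambda>x. \<phi> x - \<psi> x) \<xi>) x =
      inv_fourier (\<lambda>\<xi>. m \<xi> * fourier \<phi> \<xi>) x - inv_fourier (\<lambda>\<xi>. m \<xi> * fourier \<psi> \<xi>) x"
    by simp
qed

lemma schwartz_op_diff:
  assumes "\<phi> \<in> schwartz" "\<psi> \<in> schwartz" "0 \<le> s"
  shows "Bessel_schwartz r (\<lambda>x. \<phi> x - \<psi> x) = (\<lambda>x. Bessel_schwartz r \<phi> x - Bessel_schwartz r \<psi> x)"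
    and "frac_laplacian_schwartz s (\<lambda>x. \<phi> x - \<psi> x) = (\<lambda>x. frac_laplacian_schwartz s \<phi> x - frac_laplacian_schwartz s \<psi> x)"
    and "Bessel_frac_laplacian r s (\<lambda>x. \<phi> x - \<psi> x) = (\<lambda>x. Bessel_frac_laplacian r s \<phi> x - Bessel_frac_laplacian r s \<psi> x)"
  unfolding Bessel_schwartz_def frac_laplacian_schwartz_def Bessel_frac_laplacian_def mult.assoc[symmetric]
  using assms
  by (intro inv_fourier_multiplier_diff; simp add: mult.assoc integrable_Bessel_symbol
      integrable_norm_powr_fourier integrable_Bessel_norm_powr_fourier)+

lemma Lp_space_diff:
  assumes f: "f \<in> Lp_space p" and g: "g \<in> Lp_space p" and p: "0 \<le> p"
  shows "(\<lambda>x. f x - g x) \<in> Lp_space p"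
proof -
  have m[measurable]: "f \<in> borel_measurable borel" "g \<in> borel_measurable borel"
    and fin: "Lp_mod p f < \<infinity>" "Lp_mod p g < \<infinity>"
    using f g by (auto simp: Lp_space_iff)
  have "Lp_mod p (\<lambda>x. f x + - 1 * g x) \<le> ennreal (2 powr p) * (Lp_mod p f + Lp_mod p (\<lambda>x. - 1 * g x))"
    by (rule Lp_mod_add_le) (use p in auto)
  also have "\<dots> < \<infinity>" using fin by (subst Lp_mod_cmult) (auto simp: ennreal_mult_less_top)
  finally show ?thesis by (simp add: Lp_space_iff)
qed

lemma distr_diff_distr_of:
  assumes f: "f \<in> Lp_space p" and g: "g \<in> Lp_space p" and p: "1 \<le> p"
  shows "distr_diff (distr_of f) (distr_of g) = distr_of (\<lambda>x. f x - g x)"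
proof
  fix \<psi> :: "real ^ 'a \<Rightarrow> complex"
  show "distr_diff (distr_of f) (distr_of g) \<psi> = distr_of (\<lambda>x. f x - g x) \<psi>"
  proof (cases "\<psi> \<in> schwartz")
    case True
    have "integrable lborel (\<lambda>x. f x * \<psi> x)" "integrable lborel (\<lambda>x. g x * \<psi> x)"
      using f g True p by (auto simp: Lp_space_iff intro!: integrable_Lp_schwartz)
    then show ?thesis
      by (simp add: distr_diff_def distr_of_schwartz[OF True] left_diff_distrib)
  qed (simp add: distr_diff_def distr_of_not_schwartz)
qed

lemma Lp_norm_nonneg[simp]: "0 \<le> Lp_norm p f"
  unfolding Lp_norm_def by simp

text \<open>Moves the convergence conditions in \<open>bessel_space_tilde\<close> and
  \<open>frac_laplacian\<close> from norms of distributions to \<open>Lp_mod\<close> of representing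
  functions.\<close>

lemma bessel_norm_tendsto_zero_iff:
  assumes T: "\<And>k. bessel_potential r (T k) = distr_of (f k)" and U: "bessel_potential r U = distr_of g"
    and f: "\<And>k. f k \<in> Lp_space p" and g: "g \<in> Lp_space p" and p: "1 \<le> p"
  shows "(\<lambda>k. bessel_norm r p (distr_diff (T k) U)) \<longlonglongrightarrow> 0 \<longleftrightarrow> (\<lambda>k. Lp_mod p (\<lambda>x. f k x - g x)) \<longlonglongrightarrow> 0"
proof -
  let ?a = "\<lambda>k. Lp_norm p (\<lambda>x. f k x - g x)"
  have d: "(\<lambda>x. f k x - g x) \<in> Lp_space p" for k using p by (intro Lp_space_diff f g) simp
  have "bessel_norm r p (distr_diff (T k) U) = ennreal (?a k)" for k
    unfolding bessel_norm_def bessel_potential_diff T U distr_diff_distr_of[OF f g p]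
    by (rule distr_Lp_norm_distr_of[OF d p])
  moreover have "Lp_mod p (\<lambda>x. f k x - g x) = ennreal (?a k powr p)" for k
    using p by (intro Lp_mod_eq_Lp_norm d) simp
  moreover have "?a \<longlonglongrightarrow> 0 \<longleftrightarrow> (\<lambda>k. ?a k powr p) \<longlonglongrightarrow> 0"
  proof
    assume "?a \<longlonglongrightarrow> 0"
    moreover have "0 < p" using p by simp
    moreover have "\<forall>\<^sub>F k in sequentially. 0 \<le> ?a k" by (intro always_eventually allI Lp_norm_nonneg)
    ultimately have "(\<lambda>k. ?a k powr p) \<longlonglongrightarrow> 0 powr p"
      by (intro tendsto_powr' tendsto_const disjI2 conjI)
    then show "(\<lambda>k. ?a k powr p) \<longlonglongrightarrow> 0" by simp
  next
    assume "(\<lambda>k. ?a k powr p) \<longlonglongrightarrow> 0"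
    moreover have "0 < 1 / p" using p by simp
    moreover have "\<forall>\<^sub>F k in sequentially. 0 \<le> ?a k powr p" by (intro always_eventually allI powr_ge_zero)
    ultimately have "(\<lambda>k. (?a k powr p) powr (1 / p)) \<longlonglongrightarrow> 0 powr (1 / p)"
      by (intro tendsto_powr' tendsto_const disjI2 conjI)
    then show "?a \<longlonglongrightarrow> 0" using p by (simp add: powr_powr)
  qed
  ultimately show ?thesis using Lp_norm_nonneg by (simp add: ennreal_tendsto_0_iff)
qed

lemma Lp_mod_tendsto_zero_add:
  assumes m: "\<And>k. f k \<in> borel_measurable borel" "\<And>k. g k \<in> borel_measurable borel" and p: "0 \<le> p"
    and f: "(\<lambda>k. Lp_mod p (f k)) \<longlonglongrightarrow> 0" and g: "(\<lambda>k. Lp_mod p (g k)) \<longlonglongrightarrow> 0"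
  shows "(\<lambda>k. Lp_mod p (\<lambda>x. f k x + g k x)) \<longlonglongrightarrow> 0"
proof (rule tendsto_sandwich[of "\<lambda>_. 0" _ _ "\<lambda>k. ennreal (2 powr p) * (Lp_mod p (f k) + Lp_mod p (g k))"])
  show "\<forall>\<^sub>F k in sequentially. Lp_mod p (\<lambda>x. f k x + g k x) \<le> ennreal (2 powr p) * (Lp_mod p (f k) + Lp_mod p (g k))"
    by (intro always_eventually allI Lp_mod_add_le m p)
  have "(\<lambda>k. ennreal (2 powr p) * (Lp_mod p (f k) + Lp_mod p (g k))) \<longlonglongrightarrow> ennreal (2 powr p) * (0 + 0)"
    by (intro ennreal_tendsto_cmult tendsto_add f g) simp
  then show "(\<lambda>k. ennreal (2 powr p) * (Lp_mod p (f k) + Lp_mod p (g k))) \<longlonglongrightarrow> 0" by simp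
qed simp_all

lemma tendsto_zero_le_cmult_ennreal:
  fixes f g :: "nat \<Rightarrow> ennreal"
  assumes "\<And>k. f k \<le> ennreal C * g k" "g \<longlonglongrightarrow> 0"
  shows "f \<longlonglongrightarrow> 0"
proof (rule tendsto_sandwich[of "\<lambda>_. 0" f _ "\<lambda>k. ennreal C * g k"])
  have "(\<lambda>k. ennreal C * g k) \<longlonglongrightarrow> ennreal C * 0"
    by (intro ennreal_tendsto_cmult assms(2)) simp
  then show "(\<lambda>k. ennreal C * g k) \<longlonglongrightarrow> 0" by simp
qed (use assms(1) in simp_all)

lemma Lp_mod_schwartz: "\<phi> \<in> schwartz \<Longrightarrow> 1 \<le> p \<Longrightarrow> \<phi> \<in> Lp_space p"
  unfolding Lp_space_iff by (intro conjI schwartz_measurable Lp_mod_rapid schwartz_rapid)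

lemma Lp_mod_limit_finite:
  assumes h: "h \<in> borel_measurable borel" and f: "\<And>k. f k \<in> Lp_space p" and p: "0 \<le> p"
    and lim: "(\<lambda>k. Lp_mod p (\<lambda>x. f k x - h x)) \<longlonglongrightarrow> 0"
  shows "h \<in> Lp_space p"
proof -
  have "\<forall>\<^sub>F k in sequentially. Lp_mod p (\<lambda>x. f k x - h x) < 1"
    using lim by (rule order_tendstoD) simp
  then obtain k where k: "Lp_mod p (\<lambda>x. f k x - h x) < 1"
    unfolding eventually_sequentially by blast
  have m: "f k \<in> borel_measurable borel" "Lp_mod p (f k) < \<infinity>" using f[of k] by (auto simp: Lp_space_iff)
  have "Lp_mod p (\<lambda>x. (h x - f k x) + f k x) \<le> ennreal (2 powr p) * (Lp_mod p (\<lambda>x. h x - f k x) + Lp_mod p (f k))"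
    using h m p by (intro Lp_mod_add_le) auto
  also have "\<dots> < \<infinity>"
    using k m(2) unfolding Lp_mod_minus_commute[of p h]
    by (auto simp: ennreal_mult_less_top less_top intro: order_less_trans)
  finally show ?thesis using h by (simp add: Lp_space_iff)
qed

text \<open>A bounded operator defined on Schwartz functions carries a sequence whose Bessel potentials
  converge in \<open>L\<^sup>p\<close> to a convergent sequence.\<close>

lemma schwartz_op_limit:
  fixes A :: "(real ^ 'n \<Rightarrow> complex) \<Rightarrow> real ^ 'n \<Rightarrow> complex"
  assumes p: "1 \<le> p"
    and A: "\<And>\<phi>. \<phi> \<in> schwartz \<Longrightarrow> A \<phi> \<in> borel_measurable borel"
    and Adiff: "\<And>\<phi> \<psi>. \<phi> \<in> schwartz \<Longrightarrow> \<psi> \<in> schwartz \<Longrightarrow> A (\<lambda>x. \<phi> x - \<psi> x) = (\<lambda>x. A \<phi> x - A \<psi> x)"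
    and C: "0 \<le> C" "\<And>\<phi>. \<phi> \<in> schwartz \<Longrightarrow> Lp_mod p (A \<phi>) \<le> ennreal C * Lp_mod p (Bessel_schwartz t \<phi>)"
    and \<phi>: "\<And>k::nat. \<phi> k \<in> schwartz" and f: "f \<in> Lp_space p"
    and lim: "(\<lambda>k. Lp_mod p (\<lambda>x. Bessel_schwartz t (\<phi> k) x - f x)) \<longlonglongrightarrow> 0"
  obtains h where "h \<in> Lp_space p" "(\<lambda>k. Lp_mod p (\<lambda>x. A (\<phi> k) x - h x)) \<longlonglongrightarrow> 0"
proof -
  have fm: "f \<in> borel_measurable borel" using f by (simp add: Lp_space_iff)
  have Jm: "Bessel_schwartz t (\<phi> k) \<in> borel_measurable borel" for k
    by (intro schwartz_measurable schwartz_Bessel \<phi>)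
  have Am: "A (\<phi> k) \<in> borel_measurable borel" for k by (intro A \<phi>)
  have ALp: "A (\<phi> k) \<in> Lp_space p" for k
  proof -
    have "Lp_mod p (Bessel_schwartz t (\<phi> k)) < \<infinity>"
      using Lp_mod_schwartz[OF schwartz_Bessel[OF \<phi>] p] by (simp add: Lp_space_iff)
    then have "ennreal C * Lp_mod p (Bessel_schwartz t (\<phi> k)) < \<infinity>"
      by (simp add: ennreal_mult_less_top)
    with C(2)[OF \<phi>, of k] show ?thesis using Am by (simp add: Lp_space_iff)
  qed
  have "\<exists>h. h \<in> borel_measurable borel \<and> (\<lambda>k. Lp_mod p (\<lambda>x. A (\<phi> k) x - h x)) \<longlonglongrightarrow> 0"
  proof (rule Lp_mod_complete[OF Am p])
    fix e :: real assume e: "0 < e"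
    \<comment> \<open>\<open>C\<close> comes from the operator bound and 2^p * 2 from comparing two
      terms through \<open>f\<close>; the added 1 keeps \<open>D\<close> positive for the division e
      / D.\<close>
    define D where "D = C * (2 powr p * 2) + 1"
    have D: "0 < D" using C(1) by (simp add: D_def add_nonneg_pos)
    have "\<forall>\<^sub>F k in sequentially. Lp_mod p (\<lambda>x. Bessel_schwartz t (\<phi> k) x - f x) < ennreal (e / D)"
      using lim by (rule order_tendstoD) (use e D in simp)
    then obtain N where N: "\<And>k. N \<le> k \<Longrightarrow> Lp_mod p (\<lambda>x. Bessel_schwartz t (\<phi> k) x - f x) < ennreal (e / D)"
      unfolding eventually_sequentially by blast
    have "Lp_mod p (\<lambda>x. A (\<phi> j) x - A (\<phi> k) x) \<le> ennreal e" if j: "N \<le> j" and k: "N \<le> k" for j k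
    proof -
      have "Lp_mod p (\<lambda>x. A (\<phi> j) x - A (\<phi> k) x) \<le> ennreal C * Lp_mod p (Bessel_schwartz t (\<lambda>x. \<phi> j x - \<phi> k x))"
        unfolding Adiff[OF \<phi> \<phi>, symmetric] by (intro C schwartz_diff \<phi>)
      also have "Bessel_schwartz t (\<lambda>x. \<phi> j x - \<phi> k x) = (\<lambda>x. Bessel_schwartz t (\<phi> j) x - Bessel_schwartz t (\<phi> k) x)"
        by (rule schwartz_op_diff(1)[OF \<phi> \<phi> order_refl])
      also have "Lp_mod p (\<lambda>x. Bessel_schwartz t (\<phi> j) x - Bessel_schwartz t (\<phi> k) x) \<le>
          ennreal (2 powr p) * (Lp_mod p (\<lambda>x. Bessel_schwartz t (\<phi> j) x - f x) + Lp_mod p (\<lambda>x. f x - Bessel_schwartz t (\<phi> k) x))"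
        using p by (intro Lp_mod_triangle Jm fm) simp
      also have "\<dots> \<le> ennreal (2 powr p) * (ennreal (e / D) + ennreal (e / D))"
        unfolding Lp_mod_minus_commute[of p f] using N[OF j] N[OF k]
        by (intro mult_left_mono add_mono) (simp_all add: less_imp_le)
      finally have "Lp_mod p (\<lambda>x. A (\<phi> j) x - A (\<phi> k) x) \<le> ennreal C * (ennreal (2 powr p) * (ennreal (e / D) + ennreal (e / D)))"
        by (simp add: mult_left_mono)
      also have "\<dots> = ennreal (C * (2 powr p * (e / D + e / D)))"
        using C(1) e D by (simp only: ennreal_plus[symmetric] ennreal_mult'[symmetric] powr_ge_zero divide_nonneg_pos less_imp_le)
      also have "\<dots> \<le> ennreal e"
      proof (rule ennreal_leI)
        have "C * (2 powr p * (e / D + e / D)) = (C * (2 powr p * 2)) * (e / D)" by simp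
        also have "\<dots> \<le> D * (e / D)" using e D by (intro mult_right_mono) (simp_all add: D_def)
        also have "\<dots> = e" using D by simp
        finally show "C * (2 powr p * (e / D + e / D)) \<le> e" .
      qed
      finally show ?thesis .
    qed
    then show "\<exists>N. \<forall>j\<ge>N. \<forall>k\<ge>N. Lp_mod p (\<lambda>x. A (\<phi> j) x - A (\<phi> k) x) \<le> ennreal e" by blast
  qed
  then obtain h where h: "h \<in> borel_measurable borel" "(\<lambda>k. Lp_mod p (\<lambda>x. A (\<phi> k) x - h x)) \<longlonglongrightarrow> 0"
    by blast
  then have "h \<in> Lp_space p" using p by (intro Lp_mod_limit_finite[OF h(1) ALp _ h(2)]) simp
  then show ?thesis using h(2) by (rule that)
qed

lemma distr_of_limit:
  assumes p: "1 \<le> p" and f: "\<And>k. f k \<in> Lp_space p" and h: "h \<in> Lp_space p"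
    and lim: "(\<lambda>k. Lp_mod p (\<lambda>x. f k x - h x)) \<longlonglongrightarrow> 0" and \<psi>: "\<psi> \<in> schwartz"
  shows "(\<lambda>k. distr_of (f k) \<psi>) \<longlonglongrightarrow> distr_of h \<psi>"
proof -
  have m: "f k \<in> borel_measurable borel" "h \<in> borel_measurable borel" "Lp_mod p (f k) < \<infinity>" "Lp_mod p h < \<infinity>" for k
    using f[of k] h by (auto simp: Lp_space_iff)
  have "(\<lambda>k. LINT x|lborel. (f k x - h x) * \<psi> x) \<longlonglongrightarrow> 0"
    using m by (intro Lp_mod_tendsto_zero_weak[OF _ p lim \<psi>]) auto
  moreover have "(LINT x|lborel. (f k x - h x) * \<psi> x) = distr_of (f k) \<psi> - distr_of h \<psi>" for k
    using integrable_Lp_schwartz[OF m(1) p m(3) \<psi>, of k] integrable_Lp_schwartz[OF m(2) p m(4) \<psi>]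
    by (simp add: distr_of_schwartz[OF \<psi>] left_diff_distrib)
  ultimately have "(\<lambda>k. distr_of (f k) \<psi> - distr_of h \<psi>) \<longlonglongrightarrow> 0" by (simp only:)
  then show ?thesis by (rule LIM_zero_cancel)
qed

section \<open>The fractional Laplacian as a limit in L^p\<close>

text \<open>Resolves the description operator and yields an L^p representative along the very
  sequence that is given. Existence needs two limits, \<open>h\<close> of the fractional Laplacians
  and \<open>g\<close> of their Bessel potentials, matched by testing. Uniqueness holds because two
  approximating sequences of \<open>u\<close> differ by a null sequence in H^{t,p}, so the
  potentials have the same limit.\<close>

lemma frac_laplacian_eq_distr_of:
  fixes u :: "('n::finite) distr"
  assumes p: "1 \<le> p" and s: "0 \<le> s" "s \<le> t" and u: "u \<in> bessel_space t p"
    and \<phi>: "\<And>k::nat. \<phi> k \<in> schwartz"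
    and lim: "(\<lambda>k. bessel_norm t p (distr_diff (distr_of (\<phi> k)) u)) \<longlonglongrightarrow> 0"
  obtains h where "h \<in> Lp_space p" "frac_laplacian s t p u = distr_of h"
    "(\<lambda>k. Lp_mod p (\<lambda>x. frac_laplacian_schwartz s (\<phi> k) x - h x)) \<longlonglongrightarrow> 0"
proof -
  let ?r = "t - s"
  let ?G = "Bessel_frac_laplacian ?r s :: (real ^ 'n \<Rightarrow> complex) \<Rightarrow> _"
  let ?F = "frac_laplacian_schwartz s :: (real ^ 'n \<Rightarrow> complex) \<Rightarrow> _"
  let ?J = "Bessel_schwartz t :: (real ^ 'n \<Rightarrow> complex) \<Rightarrow> _"
  obtain f where f: "f \<in> Lp_space p" "bessel_potential t u = distr_of f"
    using u unfolding bessel_space_def by blast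
  obtain CF where CF: "0 \<le> CF" "\<And>\<phi> :: real ^ 'n \<Rightarrow> complex. \<phi> \<in> schwartz \<Longrightarrow> Lp_mod p (?F \<phi>) \<le> ennreal CF * Lp_mod p (?J \<phi>)"
    using frac_laplacian_le_Bessel[OF p s, where 'n = 'n] by blast
  obtain CG where CG: "0 \<le> CG" "\<And>\<phi> :: real ^ 'n \<Rightarrow> complex. \<phi> \<in> schwartz \<Longrightarrow> Lp_mod p (?G \<phi>) \<le> ennreal CG * Lp_mod p (?J \<phi>)"
    using Bessel_frac_laplacian_le_Bessel[OF p s(1), where 'n = 'n and t = t] unfolding Bessel_frac_laplacian_def by blast
  have Fm: "?F \<psi> \<in> borel_measurable borel" if "\<psi> \<in> schwartz" for \<psi>
    unfolding frac_laplacian_schwartz_def using integrable_norm_powr_fourier[OF that s(1)]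
    by (intro inv_fourier_measurable) auto
  have Gm: "?G \<psi> \<in> borel_measurable borel" if "\<psi> \<in> schwartz" for \<psi>
    unfolding Bessel_frac_laplacian_def using integrable_Bessel_norm_powr_fourier[OF that s(1)]
    by (intro inv_fourier_measurable) auto
  have JLp: "?J \<psi> \<in> Lp_space p" if "\<psi> \<in> schwartz" for \<psi>
    by (intro Lp_mod_schwartz schwartz_Bessel that p)
  have fin: "A \<psi> \<in> Lp_space p" if "A \<psi> \<in> borel_measurable borel" "Lp_mod p (A \<psi>) \<le> ennreal C * Lp_mod p (?J \<psi>)" "\<psi> \<in> schwartz"
    for A :: "(real ^ 'n \<Rightarrow> complex) \<Rightarrow> real ^ 'n \<Rightarrow> complex" and \<psi> C
  proof -
    have "ennreal C * Lp_mod p (?J \<psi>) < \<infinity>"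
      using JLp[OF that(3)] by (simp add: Lp_space_iff ennreal_mult_less_top)
    then show ?thesis using that(1,2) by (simp add: Lp_space_iff)
  qed
  have FLp: "?F \<psi> \<in> Lp_space p" if "\<psi> \<in> schwartz" for \<psi> by (rule fin[where A = ?F, OF Fm[OF that] CF(2)[OF that] that])
  have GLp: "?G \<psi> \<in> Lp_space p" if "\<psi> \<in> schwartz" for \<psi> by (rule fin[where A = ?G, OF Gm[OF that] CG(2)[OF that] that])
  have limJ: "(\<lambda>k. Lp_mod p (\<lambda>x. ?J (\<phi> k) x - f x)) \<longlonglongrightarrow> 0"
    if "\<And>k::nat. \<phi> k \<in> schwartz" "(\<lambda>k. bessel_norm t p (distr_diff (distr_of (\<phi> k)) u)) \<longlonglongrightarrow> 0" for \<phi>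
    using that(2)
      bessel_norm_tendsto_zero_iff[of t "\<lambda>k. distr_of (\<phi> k)" "\<lambda>k. ?J (\<phi> k)", OF bessel_potential_distr_of_schwartz[OF that(1)] f(2) JLp[OF that(1)] f(1) p]
    by blast
  obtain h where h: "h \<in> Lp_space p" "(\<lambda>k. Lp_mod p (\<lambda>x. ?F (\<phi> k) x - h x)) \<longlonglongrightarrow> 0"
    by (rule schwartz_op_limit[OF p Fm schwartz_op_diff(2)[OF _ _ s(1)] CF \<phi> f(1) limJ[OF \<phi> lim]])
  obtain g where g: "g \<in> Lp_space p" "(\<lambda>k. Lp_mod p (\<lambda>x. ?G (\<phi> k) x - g x)) \<longlonglongrightarrow> 0"
    by (rule schwartz_op_limit[OF p Gm schwartz_op_diff(3)[OF _ _ s(1)] CG \<phi> f(1) limJ[OF \<phi> lim]])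
  have bF: "bessel_potential ?r (distr_of (?F \<psi>)) = distr_of (?G \<psi>)" if "\<psi> \<in> schwartz" for \<psi>
    by (rule bessel_potential_frac_laplacian_schwartz[OF that s(1)])
  \<comment> \<open>Convergence in L^p implies convergence after testing against a Schwartz
    function, so the identity \<open>bF\<close> survives the limit.\<close>
  have bh: "bessel_potential ?r (distr_of h) = distr_of g"
  proof
    fix \<psi> :: "real ^ 'n \<Rightarrow> complex"
    show "bessel_potential ?r (distr_of h) \<psi> = distr_of g \<psi>"
    proof (cases "\<psi> \<in> schwartz")
      case True
      have "(\<lambda>k. distr_of (?F (\<phi> k)) (Bessel_dual ?r \<psi>)) \<longlonglongrightarrow> distr_of h (Bessel_dual ?r \<psi>)"
        by (rule distr_of_limit[OF p FLp[OF \<phi>] h schwartz_Bessel_dual[OF True]])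
      moreover have "distr_of (?F (\<phi> k)) (Bessel_dual ?r \<psi>) = distr_of (?G (\<phi> k)) \<psi>" for k
        using fun_cong[OF bF[OF \<phi>], of k \<psi>] by (simp only: bessel_potential_schwartz[OF True])
      moreover have "(\<lambda>k. distr_of (?G (\<phi> k)) \<psi>) \<longlonglongrightarrow> distr_of g \<psi>"
        by (rule distr_of_limit[OF p GLp[OF \<phi>] g True])
      ultimately have "distr_of h (Bessel_dual ?r \<psi>) = distr_of g \<psi>"
        using LIMSEQ_unique by simp
      then show ?thesis by (simp only: bessel_potential_schwartz[OF True])
    qed (simp add: bessel_potential_not_schwartz distr_of_not_schwartz)
  qed
  have hs: "distr_of h \<in> bessel_space ?r p"
    unfolding bessel_space_def using tempered_distr_of[OF h(1) p] bh g(1) by blast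
  have "(\<lambda>k. bessel_norm ?r p (distr_diff (distr_of (?F (\<phi> k))) (distr_of h))) \<longlonglongrightarrow> 0"
    using g(2) bessel_norm_tendsto_zero_iff[of ?r "\<lambda>k. distr_of (?F (\<phi> k))" "\<lambda>k. ?G (\<phi> k)", OF bF[OF \<phi>] bh GLp[OF \<phi>] g(1) p] by blast
  note ex = this
  have "frac_laplacian s t p u = distr_of h"
    unfolding frac_laplacian_def
  proof (rule the_equality)
    show "distr_of h \<in> bessel_space ?r p \<and> (\<exists>\<phi>. (\<forall>k. \<phi> k \<in> schwartz) \<and>
        (\<lambda>k. bessel_norm t p (distr_diff (distr_of (\<phi> k)) u)) \<longlonglongrightarrow> 0 \<and>
        (\<lambda>k. bessel_norm ?r p (distr_diff (distr_of (?F (\<phi> k))) (distr_of h))) \<longlonglongrightarrow> 0)"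
      using hs by (intro conjI exI[of _ \<phi>] allI \<phi> lim ex)
    fix v
    assume "v \<in> bessel_space ?r p \<and> (\<exists>\<phi>. (\<forall>k. \<phi> k \<in> schwartz) \<and>
        (\<lambda>k. bessel_norm t p (distr_diff (distr_of (\<phi> k)) u)) \<longlonglongrightarrow> 0 \<and>
        (\<lambda>k. bessel_norm ?r p (distr_diff (distr_of (?F (\<phi> k))) v)) \<longlonglongrightarrow> 0)"
    then obtain \<phi>' where v: "v \<in> bessel_space ?r p" and \<phi>': "\<And>k. \<phi>' k \<in> schwartz"
      and lim': "(\<lambda>k. bessel_norm t p (distr_diff (distr_of (\<phi>' k)) u)) \<longlonglongrightarrow> 0"
      and limv: "(\<lambda>k. bessel_norm ?r p (distr_diff (distr_of (?F (\<phi>' k))) v)) \<longlonglongrightarrow> 0"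
      by blast
    obtain g' where g': "g' \<in> Lp_space p" "bessel_potential ?r v = distr_of g'"
      using v unfolding bessel_space_def by blast
    have limg': "(\<lambda>k. Lp_mod p (\<lambda>x. ?G (\<phi>' k) x - g' x)) \<longlonglongrightarrow> 0"
      using limv bessel_norm_tendsto_zero_iff[of ?r "\<lambda>k. distr_of (?F (\<phi>' k))" "\<lambda>k. ?G (\<phi>' k)", OF bF[OF \<phi>'] g'(2) GLp[OF \<phi>'] g'(1) p] by blast
    have Jd: "(\<lambda>k. Lp_mod p (\<lambda>x. ?J (\<phi>' k) x - ?J (\<phi> k) x)) \<longlonglongrightarrow> 0"
    proof -
      have m: "(\<lambda>x. ?J (\<phi>' k) x - f x) \<in> borel_measurable borel" "(\<lambda>x. f x - ?J (\<phi> k) x) \<in> borel_measurable borel" for k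
        using JLp[OF \<phi>, of k] JLp[OF \<phi>', of k] f(1) by (auto simp: Lp_space_iff)
      have "(\<lambda>k. Lp_mod p (\<lambda>x. f x - ?J (\<phi> k) x)) \<longlonglongrightarrow> 0"
        using limJ[OF \<phi> lim] by (simp only: Lp_mod_minus_commute[of p f])
      from Lp_mod_tendsto_zero_add[OF m _ limJ[OF \<phi>' lim'] this] p show ?thesis by simp
    qed
    have Gd: "(\<lambda>k. Lp_mod p (\<lambda>x. ?G (\<phi>' k) x - ?G (\<phi> k) x)) \<longlonglongrightarrow> 0"
    proof (rule tendsto_zero_le_cmult_ennreal[OF _ Jd])
      show "Lp_mod p (\<lambda>x. ?G (\<phi>' k) x - ?G (\<phi> k) x) \<le> ennreal CG * Lp_mod p (\<lambda>x. ?J (\<phi>' k) x - ?J (\<phi> k) x)" for k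
        using CG(2)[OF schwartz_diff[OF \<phi>' \<phi>], of k k]
        by (simp only: schwartz_op_diff(1)[OF \<phi>' \<phi> s(1)] schwartz_op_diff(3)[OF \<phi>' \<phi> s(1)])
    qed
    have gg: "distr_of g' \<psi> = distr_of g \<psi>" if \<psi>: "\<psi> \<in> schwartz" for \<psi>
    proof -
      have 1: "(\<lambda>k. distr_of (?G (\<phi>' k)) \<psi>) \<longlonglongrightarrow> distr_of g' \<psi>"
        by (rule distr_of_limit[OF p GLp[OF \<phi>'] g'(1) limg' \<psi>])
      have "(\<lambda>k. Lp_mod p (\<lambda>x. ?G (\<phi>' k) x - g x)) \<longlonglongrightarrow> 0"
      proof -
        have m: "(\<lambda>x. ?G (\<phi>' k) x - ?G (\<phi> k) x) \<in> borel_measurable borel" "(\<lambda>x. ?G (\<phi> k) x - g x) \<in> borel_measurable borel" for k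
          using GLp[OF \<phi>, of k] GLp[OF \<phi>', of k] g(1) by (auto simp: Lp_space_iff)
        from Lp_mod_tendsto_zero_add[OF m _ Gd g(2)] p show ?thesis by simp
      qed
      then have 2: "(\<lambda>k. distr_of (?G (\<phi>' k)) \<psi>) \<longlonglongrightarrow> distr_of g \<psi>"
        by (rule distr_of_limit[OF p GLp[OF \<phi>'] g(1) _ \<psi>])
      show ?thesis by (rule LIMSEQ_unique[OF 1 2])
    qed
    have vt: "v = on_schwartz v" using v by (simp add: bessel_space_def tempered_def)
    show "v = distr_of h"
    proof
      fix \<psi> :: "real ^ 'n \<Rightarrow> complex"
      show "v \<psi> = distr_of h \<psi>"
      proof (cases "\<psi> \<in> schwartz")
        case True
        \<comment> \<open>Testing at \<open>?\<chi>\<close> recovers \<open>v \<psi>\<close> from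
          the Bessel potential of \<open>v\<close>, whose representative is already
          identified.\<close>
        let ?\<chi> = "Bessel_dual (- ?r) \<psi>"
        have \<chi>: "?\<chi> \<in> schwartz" by (rule schwartz_Bessel_dual[OF True])
        have eq: "w \<psi> = bessel_potential ?r w ?\<chi>" for w :: "'n distr"
          by (simp only: bessel_potential_schwartz[OF \<chi>] Bessel_dual_inverse[OF True])
        show ?thesis unfolding eq[of v] eq[of "distr_of h"] g'(2) bh by (rule gg[OF \<chi>])
      next
        case False
        have "v \<psi> = on_schwartz v \<psi>" using vt by (rule fun_cong)
        then show ?thesis using False by (simp add: on_schwartz_def distr_of_not_schwartz)
      qed
    qed
  qed
  then show ?thesis using h by (intro that)
qed

section \<open>The slab and the limit argument\<close>

text \<open>The direction is the image under \<open>L\<close> of a coordinate axis from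
  \<open>K\<close>. The unbounded factor has coordinate 0 there and \<open>L\<close> preserves inner
  products, so x . v - x0 . v is a coordinate of a point of the bounded base.\<close>

lemma bounded_in_one_direction_slab:
  fixes \<Omega> :: "(real ^ 'n) set"
  assumes "bounded_in_one_direction \<Omega>"
  obtains v c R where "v \<noteq> 0" "\<And>x. x \<in> \<Omega> \<Longrightarrow> \<bar>x \<bullet> v - c\<bar> \<le> R"
proof -
  obtain S :: "(real ^ 'n) set" and L x0 where S: "cylindrical_domain S" and L: "orthogonal_transformation L" and \<Omega>: "\<Omega> \<subseteq> (\<lambda>x. L x + x0) ` S"
    using assms unfolding bounded_in_one_direction_def by blast
  obtain K \<omega> where K: "K \<noteq> {}" and \<omega>: "bounded \<omega>" and S_eq: "S = {y + z | y z. y \<in> coord_subspace (- K) \<and> z \<in> \<omega>}"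
    using S unfolding cylindrical_domain_def by blast
  obtain i where i: "i \<in> K" using K by blast
  obtain R where R: "\<And>z. z \<in> \<omega> \<Longrightarrow> norm z \<le> R" using \<omega> unfolding bounded_iff by blast
  let ?v = "L (axis i 1)"
  show ?thesis
  proof (rule that[of ?v "x0 \<bullet> ?v" R])
    have "norm ?v = 1" using orthogonal_transformation_norm[OF L, of "axis i 1"] by simp
    then show "?v \<noteq> 0" by auto
    fix x assume "x \<in> \<Omega>"
    then obtain y z where x: "x = L (y + z) + x0" and y: "y \<in> coord_subspace (- K)" and z: "z \<in> \<omega>"
      using \<Omega> unfolding S_eq by blast
    have "L (y + z) \<bullet> ?v = (y + z) \<bullet> axis i 1" using L unfolding orthogonal_transformation_def by blast
    also have "\<dots> = z $ i" using y i by (simp add: inner_axis coord_subspace_def)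
    finally have "x \<bullet> ?v - x0 \<bullet> ?v = z $ i" unfolding x by (simp add: inner_add_left)
    then show "\<bar>x \<bullet> ?v - x0 \<bullet> ?v\<bar> \<le> R"
      using component_le_norm_cart[of z i] R[OF z] by linarith
  qed
qed

lemma Lp_norm_le_of_Lp_mod_le:
  assumes f: "f \<in> Lp_space p" and g: "g \<in> Lp_space p" and p: "1 \<le> p" and D: "0 \<le> D"
    and le: "Lp_mod p f \<le> ennreal D * Lp_mod p g"
  shows "Lp_norm p f \<le> D powr (1 / p) * Lp_norm p g"
proof -
  have "ennreal (Lp_norm p f powr p) \<le> ennreal (D * Lp_norm p g powr p)"
    using le Lp_mod_eq_Lp_norm[OF f] Lp_mod_eq_Lp_norm[OF g] p D by (simp add: ennreal_mult')
  then have "Lp_norm p f powr p \<le> D * Lp_norm p g powr p"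
    using D by (subst (asm) ennreal_le_iff) auto
  then have "(Lp_norm p f powr p) powr (1 / p) \<le> (D * Lp_norm p g powr p) powr (1 / p)"
    using p by (intro powr_mono2) auto
  then show ?thesis using p D Lp_norm_nonneg[of p f] Lp_norm_nonneg[of p g]
    by (simp add: powr_mult powr_powr)
qed

theorem theorem2p2:
  fixes \<Omega> :: "(real ^ 'n) set" and p s t :: real
  assumes "open \<Omega>" and "bounded_in_one_direction \<Omega>"
    and "(2 \<le> p \<and> 0 \<le> s \<and> s \<le> t) \<or> (1 < p \<and> p < 2 \<and> 1 \<le> t \<and> 0 \<le> s \<and> s \<le> t)"
  shows "\<exists>C::real. C > 0 \<and>
    (\<forall>u \<in> bessel_space_tilde t p \<Omega>.
       distr_Lp_norm p (frac_laplacian s t p u) \<le> ennreal C * distr_Lp_norm p (frac_laplacian t t p u))"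
proof -
  have p: "1 \<le> p" and s: "0 \<le> s" "s \<le> t" and t: "0 \<le> t" using assms(3) by auto
  obtain v c R where v: "v \<noteq> 0" and slab: "\<And>x. x \<in> \<Omega> \<Longrightarrow> \<bar>x \<bullet> v - c\<bar> \<le> R"
    using bounded_in_one_direction_slab[OF assms(2)] by blast
  obtain C0 where C0: "0 \<le> C0" "\<And>\<phi>. \<phi> \<in> schwartz \<Longrightarrow> (\<And>x. \<phi> x \<noteq> 0 \<Longrightarrow> \<bar>x \<bullet> v - c\<bar> \<le> R) \<Longrightarrow>
      Lp_mod p (frac_laplacian_schwartz s \<phi>) \<le> ennreal C0 * Lp_mod p (frac_laplacian_schwartz t \<phi>)"
    using slab_frac_Poincare[OF p s v, of c R] by blast
  \<comment> \<open>One factor 2^p comes from replacing \<open>hs\<close> by its approximations, one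
    from returning to \<open>ht\<close>, with the slab constant \<open>C0\<close> in
    between.\<close>
  define D where "D = 2 powr p * (C0 * 2 powr p)"
  have D: "0 \<le> D" using C0(1) by (simp add: D_def)
  \<comment> \<open>The added 1 makes the constant positive even if \<open>D\<close> is 0.\<close>
  have main: "distr_Lp_norm p (frac_laplacian s t p u) \<le> ennreal (D powr (1 / p) + 1) * distr_Lp_norm p (frac_laplacian t t p u)"
    if u: "u \<in> bessel_space_tilde t p \<Omega>" for u
  proof -
    obtain \<phi> where ub: "u \<in> bessel_space t p" and \<phi>t: "\<And>k::nat. \<phi> k \<in> test_functions \<Omega>"
      and lim: "(\<lambda>k. bessel_norm t p (distr_diff (distr_of (\<phi> k)) u)) \<longlonglongrightarrow> 0"
      using u unfolding bessel_space_tilde_def by blast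
    have \<phi>: "\<phi> k \<in> schwartz" for k by (rule test_functions_schwartz[OF \<phi>t])
    \<comment> \<open>The same test functions approximate for both orders, so the slab estimate can
      be applied term by term before passing to the limit.\<close>
    obtain hs where hs: "hs \<in> Lp_space p" "frac_laplacian s t p u = distr_of hs"
      "(\<lambda>k. Lp_mod p (\<lambda>x. frac_laplacian_schwartz s (\<phi> k) x - hs x)) \<longlonglongrightarrow> 0"
      by (rule frac_laplacian_eq_distr_of[OF p s ub \<phi> lim])
    obtain ht where ht: "ht \<in> Lp_space p" "frac_laplacian t t p u = distr_of ht"
      "(\<lambda>k. Lp_mod p (\<lambda>x. frac_laplacian_schwartz t (\<phi> k) x - ht x)) \<longlonglongrightarrow> 0"
      by (rule frac_laplacian_eq_distr_of[OF p t order_refl ub \<phi> lim])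
    have m: "hs \<in> borel_measurable borel" "ht \<in> borel_measurable borel"
      using hs(1) ht(1) by (auto simp: Lp_space_iff)
    have Fm: "frac_laplacian_schwartz r (\<phi> k) \<in> borel_measurable borel" if "0 \<le> r" for r k
      unfolding frac_laplacian_schwartz_def using integrable_norm_powr_fourier[OF \<phi> that]
      by (intro inv_fourier_measurable) auto
    let ?a = "\<lambda>k. Lp_mod p (\<lambda>x. frac_laplacian_schwartz s (\<phi> k) x - hs x)"
    let ?b = "\<lambda>k. Lp_mod p (\<lambda>x. frac_laplacian_schwartz t (\<phi> k) x - ht x)"
    let ?P = "ennreal (2 powr p)"
    have le: "Lp_mod p hs \<le> ?P * (?a k + ennreal C0 * (?P * (?b k + Lp_mod p ht)))" for k
    proof -
      have "Lp_mod p (\<lambda>x. (hs x - frac_laplacian_schwartz s (\<phi> k) x) + frac_laplacian_schwartz s (\<phi> k) x) \<le>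
          ?P * (Lp_mod p (\<lambda>x. hs x - frac_laplacian_schwartz s (\<phi> k) x) + Lp_mod p (frac_laplacian_schwartz s (\<phi> k)))"
        using p s m Fm[OF s(1)] by (intro Lp_mod_add_le) auto
      then have 1: "Lp_mod p hs \<le> ?P * (?a k + Lp_mod p (frac_laplacian_schwartz s (\<phi> k)))"
        unfolding Lp_mod_minus_commute[of p hs] by simp
      have "Lp_mod p (\<lambda>x. (frac_laplacian_schwartz t (\<phi> k) x - ht x) + ht x) \<le> ?P * (?b k + Lp_mod p ht)"
        using p t m Fm[OF t] by (intro Lp_mod_add_le) auto
      then have 2: "Lp_mod p (frac_laplacian_schwartz t (\<phi> k)) \<le> ?P * (?b k + Lp_mod p ht)" by simp
      have 3: "Lp_mod p (frac_laplacian_schwartz s (\<phi> k)) \<le> ennreal C0 * Lp_mod p (frac_laplacian_schwartz t (\<phi> k))"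
      proof (rule C0(2)[OF \<phi>])
        fix x assume "\<phi> k x \<noteq> 0"
        then have "x \<in> closure {x. \<phi> k x \<noteq> 0}" using closure_subset[of "{x. \<phi> k x \<noteq> 0}"] by blast
        then have "x \<in> \<Omega>" using \<phi>t[of k] unfolding test_functions_def by blast
        then show "\<bar>x \<bullet> v - c\<bar> \<le> R" by (rule slab)
      qed
      show ?thesis
        by (rule order_trans[OF 1], rule mult_left_mono, rule add_left_mono,
            rule order_trans[OF 3], rule mult_left_mono[OF 2]) simp_all
    qed
    have "(\<lambda>k. ?P * (?a k + ennreal C0 * (?P * (?b k + Lp_mod p ht)))) \<longlonglongrightarrow> ?P * (0 + ennreal C0 * (?P * (0 + Lp_mod p ht)))"
      by (intro ennreal_tendsto_cmult tendsto_add hs(3) ht(3) tendsto_const) simp_all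
    then have "Lp_mod p hs \<le> ?P * (0 + ennreal C0 * (?P * (0 + Lp_mod p ht)))"
      by (rule LIMSEQ_le_const) (use le in blast)
    also have "\<dots> = ennreal D * Lp_mod p ht"
      using C0(1) by (simp add: D_def ennreal_mult mult.assoc)
    finally have "Lp_norm p hs \<le> D powr (1 / p) * Lp_norm p ht"
      by (rule Lp_norm_le_of_Lp_mod_le[OF hs(1) ht(1) p D])
    also have "\<dots> \<le> (D powr (1 / p) + 1) * Lp_norm p ht"
      using Lp_norm_nonneg[of p ht] by (intro mult_right_mono) simp_all
    finally have "ennreal (Lp_norm p hs) \<le> ennreal ((D powr (1 / p) + 1) * Lp_norm p ht)"
      by (rule ennreal_leI)
    then show ?thesis
      unfolding hs(2) ht(2) distr_Lp_norm_distr_of[OF hs(1) p] distr_Lp_norm_distr_of[OF ht(1) p]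
      using Lp_norm_nonneg[of p ht] by (simp add: ennreal_mult')
  qed
  show ?thesis
    by (rule exI[of _ "D powr (1 / p) + 1"]) (use main in \<open>simp add: add_nonneg_pos\<close>)
qed

end
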